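(* (1) The set of spectral data $(\lambda_0,\lambda_1,\lambda_2)$ of flat constant mean curvature (cmc) tori in $\mathbb{S}^3$ with a double point on $\mathbb{S}^1$, up to the transformations (A)–(C) of the context, is in one-to-one correspondence with integer triples $$(\ell_0,\ell_1,\ell_2)\in\mathbb{Z}^3\quad\text{with } \gcd(\ell_0,\ell_1,\ell_2)=1 \text{ and } 0\le\ell_1<\ell_0<\ell_2 .$$ (2) Let $\mathbb{T}^2$ be an $(\ell_0,\ell_1,\ell_2)$ flat cmc torus. Then $\mathbb{T}^2$ covers its underlying flat embedded rectangular cmc torus $\ell_0$ times. Each profile curve set $\mathcal{C}_k$ ($k=1,2$) of $\mathbb{T}^2$ has total turning number $\ell_0$. The set $\mathcal{C}_k$ is a union of $\gcd(\ell_0,\ell_k)$ coinciding circles, and each circle is wrapped $\ell_0/\gcd(\ell_0,\ell_k)$ times. (3) The case $\ell_1=0$ occurs if and only if the torus is rotational.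
   Context: Identify $\mathbb{S}^3$ with $\mathrm{SU}_2$ and put $\langle\langle x,y\rangle\rangle=\mathrm{Re}(x\bar y)$ for $x,y\in\mathbb{C}$. Flat cmc tori. Up to isometry and conformal change of coordinate, every flat cmc immersion into $\mathbb{S}^3$ is $f=F_{\lambda_1}F_{\lambda_2}^{-1}:\mathbb{C}\to\mathrm{SU}_2$ with $F_\lambda(z)=\exp\left(\pi i\begin{pmatrix}0& z\lambda^{-1}+\bar z\\ z+\bar z\lambda&0\end{pmatrix}\right)$ and two distinct sym points $\lambda_1,\lambda_2\in\mathbb{S}^1$. Let $\kappa_1=\frac12(\lambda_1^{1/2}+\lambda_2^{1/2})$, $\kappa_2=\frac12(\lambda_1^{1/2}-\lambda_2^{1/2})$, $\Lambda=\kappa_1\mathbb{Z}+\kappa_2\mathbb{Z}$, and $\Lambda^*=\{\gamma\in\mathbb{C}:\langle\langle\gamma,\kappa\rangle\rangle\in\mathbb{Z}\ \forall\kappa\in\Lambda\}$. A flat cmc torus is $f:\mathbb{C}/\Gamma\to\mathbb{S}^3$ for a lattice $\Gamma\subseteq\Lambda^*$ (exactly the lattices with respect to which $f$ is periodic); its underlying embedded rectangular torus is $f:\mathbb{C}/\Lambda^*\to\mathbb{S}^3$. It has a double point at $\lambda_0\in\mathbb{S}^1\setminus\{\lambda_1,\lambda_2\}$ if $\langle\langle\gamma,\lambda_0^{1/2}\rangle\rangle\in\mathbb{Z}$ for all $\gamma\in\Gamma$ (i.e. the monodromy eigenvalues $\exp(\pm\pi i(\gamma\lambda^{-1/2}+\bar\gamma\lambda^{1/2}))$,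 $\gamma\in\Gamma$, are $1$ at $\lambda=\lambda_0$; in the paper's normalization $\ln\mu(\gamma,\lambda_0)\in\pi i\mathbb{Z}$). Spectral data. The spectral data of a flat cmc torus with double point is the triple $(\lambda_0,\lambda_1,\lambda_2)$ of pairwise distinct unimodular numbers given by the double point and the two sym points, modulo: (A) rotation $(\lambda_0,\lambda_1,\lambda_2)\mapsto\delta(\lambda_0,\lambda_1,\lambda_2)$, $\delta\in\mathbb{S}^1$; (B) inversion $(\lambda_0,\lambda_1,\lambda_2)\mapsto(\lambda_0^{-1},\lambda_1^{-1},\lambda_2^{-1})$; (C) swapping $(\lambda_0,\lambda_1,\lambda_2)\mapsto(\lambda_0,\lambda_2,\lambda_1)$. The correspondence. With $m=(\lambda_0^{1/2},\lambda_1^{1/2},\lambda_2^{1/2})$, the vector $i\,m\times\bar m$ is real and a real multiple $(s_0,s_1,s_2)$ of it is integral with $\gcd(s_0,s_1+s_2,s_1-s_2)=2$. Then $(\ell_0,\ell_1,\ell_2)=\frac12\left(|s_0|,\min\{|s_1+s_2|,|s_1-s_2|\},\max\{|s_1+s_2|,|s_1-s_2|\}\right)$. The $(\ell_0,\ell_1,\ell_2)$ flat cmc torus is $f:\mathbb{C}/\Gamma\to\mathbb{S}^3$ with the maximal lattice $\Gamma=\{\gamma\in\Lambda^*:\langle\langle\gamma,\lambda_0^{1/2}\rangle\rangle\in\mathbb{Z}\}$. Profile curves. The image of a flat cmc torus is an orbit of a two-dimensional torus of isometries of $\mathbb{S}^3$, all of whose other orbits are two-dimensional tori except two linked geodesics,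 the axes. For an axis $A$, let $\mathbb{S}^2_A$ be a geodesic 2-sphere containing $A$; $A$ divides it into two hemispheres. The profile curve set with respect to $A$ is the intersection of the (immersed) torus with one of these hemispheres, regarded as a collection of immersed closed curves parameterized by their preimage in $\mathbb{C}/\Gamma$. $\mathcal{C}_1,\mathcal{C}_2$ denote the profile curve sets with respect to the two axes, suitably labelled. The turning number of an immersed closed plane curve is the absolute value of the degree of its Gauss map; the total turning number of a collection is the sum of the turning numbers. Rotational. Normalize $\lambda_0=1$ by (A), and let $\nu_k$ be a square root of $\frac14(\lambda_k-1)(\lambda_k^{-1}-1)$. The torus, with its double point, carries the equivariant action $p\mapsto\exp(x\nu_1e_0)\,p\,\exp(-x\nu_2e_0)$, $x\in\mathbb{R}$, $e_0=\mathrm{diag}(i,-i)$; it is called rotational if this one-parameter group fixes a geodesic of $\mathbb{S}^3$ point-wise (equivalently, if $\lambda_2=\lambda_1^{-1}$ when $\lambda_0=1$).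
   Formalization: The pairing is taken as 2Re(x ȳ) instead of Re(x ȳ), so that Λ* is exactly the period lattice of f and ℂ/Λ* is embedded; a double point then means monodromy eigenvalues ±1 (ln μ in πiℤ) rather than 1. *)

theory Defs
  imports "HOL-Analysis.Analysis" "HOL-Complex_Analysis.Winding_Numbers"
begin

section \<open>The three-sphere\<close>

text \<open>The type \<^typ>\<open>complex^2^2\<close> carries the real inner product Re tr(A B*). For it, SU(2) is the
  sphere of radius sqrt 2 in the quaternions span SU(2), a real vector space of dimension four.\<close>

type_synonym mat2 = "complex^2^2"

definition SU2 :: "mat2 set" where
  "SU2 = {A. A ** (\<chi> i j. cnj (A $ j $ i)) = mat 1 \<and> det A = 1}"

definition mat_exp :: "mat2 \<Rightarrow> mat2" where
  "mat_exp A = (\<Sum>n. (1 / fact n) *\<^sub>R (((**) A ^^ n) (mat 1)))"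

definition geodesic_subsphere :: "nat \<Rightarrow> mat2 set \<Rightarrow> bool" where
  "geodesic_subsphere d S \<longleftrightarrow>
     (\<exists>W. subspace W \<and> W \<subseteq> span SU2 \<and> dim W = d + 1 \<and> S = SU2 \<inter> W)"

abbreviation geodesic :: "mat2 set \<Rightarrow> bool" where
  "geodesic \<equiv> geodesic_subsphere 1"


section \<open>Flat cmc immersions and their lattices\<close>

text \<open>The pairing is 2 Re(x cnj y). With this factor \<open>frame lam \<gamma>\<close> below has the eigenvalues
  \<open>exp (\<plusminus> \<pi> \<i> pairing \<gamma> (csqrt lam))\<close>, and the dual lattice of \<open>Lam\<close> is the full period lattice of the
  immersion. For Re(x cnj y) with the same frame, the dual lattice would have index four in the
  period lattice. The factor rescales the dual lattices and
  the lattices of tori with a double point by 1/2, and changes nothing in the spectral data. A double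
  point is where the monodromy eigenvalues are 1 or -1.\<close>

definition pairing :: "complex \<Rightarrow> complex \<Rightarrow> real" where
  "pairing x y = 2 * Re (x * cnj y)"

definition frame :: "complex \<Rightarrow> complex \<Rightarrow> mat2" where
  "frame lam z = mat_exp (vector [
     vector [0, complex_of_real pi * \<i> * (z * inverse lam + cnj z)],
     vector [complex_of_real pi * \<i> * (z + cnj z * lam), 0]])"

definition flat_cmc :: "complex \<Rightarrow> complex \<Rightarrow> complex \<Rightarrow> mat2" where
  "flat_cmc lam1 lam2 z = frame lam1 z ** matrix_inv (frame lam2 z)"

definition gen_lattice :: "complex \<Rightarrow> complex \<Rightarrow> complex set" where
  "gen_lattice a b = {of_int m * a + of_int n * b | m n. True}"

definition is_lattice :: "complex set \<Rightarrow> bool" where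
  "is_lattice \<Gamma> \<longleftrightarrow> (\<exists>a b. Im (a * cnj b) \<noteq> 0 \<and> \<Gamma> = gen_lattice a b)"

definition is_rectangular_lattice :: "complex set \<Rightarrow> bool" where
  "is_rectangular_lattice \<Gamma> \<longleftrightarrow>
     (\<exists>a b. a \<noteq> 0 \<and> b \<noteq> 0 \<and> Re (a * cnj b) = 0 \<and> \<Gamma> = gen_lattice a b)"

text \<open>Here and below, \<^const>\<open>csqrt\<close> is an arbitrary choice of square roots: replacing any of them by
  its negative changes neither \<open>Lam\<close> nor the predicates \<open>double_point\<close>, \<open>corresponds\<close> and \<open>rotational\<close>.\<close>

definition Lam :: "complex \<Rightarrow> complex \<Rightarrow> complex set" where
  "Lam lam1 lam2 = gen_lattice ((csqrt lam1 + csqrt lam2) / 2) ((csqrt lam1 - csqrt lam2) / 2)"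

definition Lam_dual :: "complex \<Rightarrow> complex \<Rightarrow> complex set" where
  "Lam_dual lam1 lam2 = {\<gamma>. \<forall>\<kappa>\<in>Lam lam1 lam2. pairing \<gamma> \<kappa> \<in> \<int>}"

definition double_point :: "complex set \<Rightarrow> complex \<Rightarrow> bool" where
  "double_point \<Gamma> lam0 \<longleftrightarrow> (\<forall>\<gamma>\<in>\<Gamma>. pairing \<gamma> (csqrt lam0) \<in> \<int>)"

definition max_lattice :: "complex \<times> complex \<times> complex \<Rightarrow> complex set" where
  "max_lattice = (\<lambda>(lam0, lam1, lam2). {\<gamma> \<in> Lam_dual lam1 lam2. pairing \<gamma> (csqrt lam0) \<in> \<int>})"


section \<open>Spectral data\<close>

definition spectral_data :: "(complex \<times> complex \<times> complex) set" where
  "spectral_data = {(lam0, lam1, lam2).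
     norm lam0 = 1 \<and> norm lam1 = 1 \<and> norm lam2 = 1 \<and>
     lam0 \<noteq> lam1 \<and> lam0 \<noteq> lam2 \<and> lam1 \<noteq> lam2 \<and>
     (\<exists>\<Gamma>. is_lattice \<Gamma> \<and> \<Gamma> \<subseteq> Lam_dual lam1 lam2 \<and> double_point \<Gamma> lam0)}"

inductive spec_equiv ::
  "complex \<times> complex \<times> complex \<Rightarrow> complex \<times> complex \<times> complex \<Rightarrow> bool" for x where
  refl: "spec_equiv x x"
| rotation: "spec_equiv x (a, b, c) \<Longrightarrow> norm \<delta> = 1 \<Longrightarrow> spec_equiv x (\<delta> * a, \<delta> * b, \<delta> * c)"
| inversion: "spec_equiv x (a, b, c) \<Longrightarrow> spec_equiv x (inverse a, inverse b, inverse c)"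
| swapping: "spec_equiv x (a, b, c) \<Longrightarrow> spec_equiv x (a, c, b)"

definition spec_rel :: "((complex \<times> complex \<times> complex) \<times> (complex \<times> complex \<times> complex)) set" where
  "spec_rel = {(x, y). x \<in> spectral_data \<and> y \<in> spectral_data \<and> spec_equiv x y}"

lemma equiv_spec_rel: "equiv spectral_data spec_rel"
proof -
  have tr: "spec_equiv x z" if "spec_equiv y z" "spec_equiv x y" for x y z
    using that by (induction rule: spec_equiv.induct) (auto intro: spec_equiv.intros)
  have sy: "spec_equiv y x" if "spec_equiv x y" for x y
    using that
  proof (induction rule: spec_equiv.induct)
    case refl
    show ?case by (rule spec_equiv.refl)
  next
    case (rotation a b c \<delta>)
    have "\<delta> \<noteq> 0" using rotation.hyps by auto
    have "spec_equiv (\<delta> * a, \<delta> * b, \<delta> * c)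
        (inverse \<delta> * (\<delta> * a), inverse \<delta> * (\<delta> * b), inverse \<delta> * (\<delta> * c))"
      by (rule spec_equiv.rotation[OF spec_equiv.refl]) (use rotation.hyps in \<open>simp add: norm_inverse\<close>)
    then have "spec_equiv (\<delta> * a, \<delta> * b, \<delta> * c) (a, b, c)"
      using \<open>\<delta> \<noteq> 0\<close> by (simp add: mult.assoc[symmetric])
    with rotation.IH show ?case by (rule tr)
  next
    case (inversion a b c)
    have "spec_equiv (inverse a, inverse b, inverse c) (a, b, c)"
      using spec_equiv.inversion[OF spec_equiv.refl[of "(inverse a, inverse b, inverse c)"]] by simp
    with inversion.IH show ?case by (rule tr)
  next
    case (swapping a b c)
    have "spec_equiv (a, c, b) (a, b, c)"
      by (rule spec_equiv.swapping[OF spec_equiv.refl])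
    with swapping.IH show ?case by (rule tr)
  qed
  show ?thesis
    by (rule equivI) (auto simp: spec_rel_def refl_on_def sym_def trans_def intro: spec_equiv.refl sy tr)
qed

definition ccross ::
  "complex \<times> complex \<times> complex \<Rightarrow> complex \<times> complex \<times> complex \<Rightarrow> complex \<times> complex \<times> complex" where
  "ccross = (\<lambda>(a0, a1, a2) (b0, b1, b2).
     (a1 * b2 - a2 * b1, a2 * b0 - a0 * b2, a0 * b1 - a1 * b0))"

text \<open>The divisions by two are exact, because of the condition on the gcd.\<close>

definition corresponds :: "complex \<times> complex \<times> complex \<Rightarrow> int \<times> int \<times> int \<Rightarrow> bool" where
  "corresponds = (\<lambda>(lam0, lam1, lam2) l. \<exists>(s0::int) (s1::int) (s2::int) (r::real) c0 c1 c2.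
     ccross (csqrt lam0, csqrt lam1, csqrt lam2) (cnj (csqrt lam0), cnj (csqrt lam1), cnj (csqrt lam2))
       = (c0, c1, c2) \<and>
     of_int s0 = of_real r * (\<i> * c0) \<and>
     of_int s1 = of_real r * (\<i> * c1) \<and>
     of_int s2 = of_real r * (\<i> * c2) \<and>
     gcd s0 (gcd (s1 + s2) (s1 - s2)) = 2 \<and>
     l = (\<bar>s0\<bar> div 2,
          min \<bar>s1 + s2\<bar> \<bar>s1 - s2\<bar> div 2,
          max \<bar>s1 + s2\<bar> \<bar>s1 - s2\<bar> div 2))"

definition ell_triples :: "(int \<times> int \<times> int) set" where
  "ell_triples = {(l0, l1, l2). gcd l0 (gcd l1 l2) = 1 \<and> 0 \<le> l1 \<and> l1 < l0 \<and> l0 < l2}"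


section \<open>Tori and coverings\<close>

text \<open>The points of the torus \<open>\<complex>/\<Gamma>\<close> are the cosets of \<open>\<Gamma>\<close>, with the quotient topology.\<close>

definition torus_pt :: "complex set \<Rightarrow> complex \<Rightarrow> complex set" where
  "torus_pt \<Gamma> z = {w. w - z \<in> \<Gamma>}"

definition torus :: "complex set \<Rightarrow> complex set topology" where
  "torus \<Gamma> = topology (\<lambda>U. U \<subseteq> range (torus_pt \<Gamma>) \<and> open {z. torus_pt \<Gamma> z \<in> U})"

lemma openin_torus:
  "openin (torus \<Gamma>) U \<longleftrightarrow> U \<subseteq> range (torus_pt \<Gamma>) \<and> open {z. torus_pt \<Gamma> z \<in> U}"
proof -
  have "istopology (\<lambda>U. U \<subseteq> range (torus_pt \<Gamma>) \<and> open {z. torus_pt \<Gamma> z \<in> U})"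
    unfolding istopology_def
  proof (intro conjI allI impI)
    fix S T
    assume "S \<subseteq> range (torus_pt \<Gamma>) \<and> open {z. torus_pt \<Gamma> z \<in> S}"
      and "T \<subseteq> range (torus_pt \<Gamma>) \<and> open {z. torus_pt \<Gamma> z \<in> T}"
    then show "S \<inter> T \<subseteq> range (torus_pt \<Gamma>)" "open {z. torus_pt \<Gamma> z \<in> S \<inter> T}"
      by (auto simp: Collect_conj_eq)
  next
    fix K
    assume K: "\<forall>S\<in>K. S \<subseteq> range (torus_pt \<Gamma>) \<and> open {z. torus_pt \<Gamma> z \<in> S}"
    then show "\<Union>K \<subseteq> range (torus_pt \<Gamma>)" by blast
    have "{z. torus_pt \<Gamma> z \<in> \<Union>K} = (\<Union>S\<in>K. {z. torus_pt \<Gamma> z \<in> S})" by blast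
    with K show "open {z. torus_pt \<Gamma> z \<in> \<Union>K}" by auto
  qed
  then show ?thesis by (simp add: torus_def topology_inverse')
qed

text \<open>The map induced on \<open>\<complex>/\<Gamma>\<close> by a \<open>\<Gamma>\<close>-periodic map on the complex plane.\<close>

definition descend :: "(complex \<Rightarrow> 'a) \<Rightarrow> complex set \<Rightarrow> 'a" where
  "descend g x = the_elem (g ` x)"

definition sheeted_covering :: "nat \<Rightarrow> 'a topology \<Rightarrow> 'b topology \<Rightarrow> ('a \<Rightarrow> 'b) \<Rightarrow> bool" where
  "sheeted_covering n X Y p \<longleftrightarrow> continuous_map X Y p \<and>
     (\<forall>y\<in>topspace Y. \<exists>V \<U>. openin Y V \<and> y \<in> V \<and> finite \<U> \<and> card \<U> = n \<and> pairwise disjnt \<U> \<and>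
        \<Union>\<U> = {x \<in> topspace X. p x \<in> V} \<and>
        (\<forall>U\<in>\<U>. openin X U \<and> homeomorphic_map (subtopology X U) (subtopology Y V) p))"


section \<open>Profile curves\<close>

text \<open>\<^term>\<open>frame lam1 z ** p ** matrix_inv (frame lam2 z)\<close>, for z in the complex plane, runs through the
  orbit of p under the two-dimensional torus of isometries whose orbit of \<^term>\<open>mat 1\<close> is the image
  of \<^const>\<open>flat_cmc\<close>.\<close>

definition orbit :: "complex \<Rightarrow> complex \<Rightarrow> mat2 \<Rightarrow> mat2 set" where
  "orbit lam1 lam2 p = range (\<lambda>z. frame lam1 z ** p ** matrix_inv (frame lam2 z))"

definition is_axis :: "complex \<Rightarrow> complex \<Rightarrow> mat2 set \<Rightarrow> bool" where
  "is_axis lam1 lam2 A \<longleftrightarrow> (\<exists>p\<in>SU2. A = orbit lam1 lam2 p) \<and> geodesic A"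

definition hemisphere :: "mat2 set \<Rightarrow> mat2 set \<Rightarrow> bool" where
  "hemisphere A H \<longleftrightarrow> (\<exists>S n. geodesic_subsphere 2 S \<and> A \<subseteq> S \<and> n \<in> span S \<and> n \<noteq> 0 \<and>
     (\<forall>a\<in>A. a \<bullet> n = 0) \<and> H = {p \<in> S. p \<bullet> n > 0})"

definition profile_curves ::
  "complex \<Rightarrow> complex \<Rightarrow> complex set \<Rightarrow> mat2 set \<Rightarrow> complex set set set" where
  "profile_curves lam1 lam2 \<Gamma> H = connected_components_of
     (subtopology (torus \<Gamma>) {x. descend (flat_cmc lam1 lam2) x \<in> H})"

definition C1_regular :: "(real \<Rightarrow> complex) \<Rightarrow> bool" where
  "C1_regular c \<longleftrightarrow> (\<forall>t. c differentiable (at t)) \<and>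
     continuous_on UNIV (\<lambda>t. vector_derivative c (at t)) \<and> (\<forall>t. vector_derivative c (at t) \<noteq> 0)"

text \<open>A parametrization of a closed curve K in \<open>\<complex>/\<Gamma>\<close> by \<open>\<real>/\<int>\<close>, given by a lift to the complex
  plane.\<close>

definition parametrizes :: "complex set \<Rightarrow> complex set set \<Rightarrow> (real \<Rightarrow> complex) \<Rightarrow> bool" where
  "parametrizes \<Gamma> K c \<longleftrightarrow> C1_regular c \<and> (\<forall>t. c (t + 1) - c t \<in> \<Gamma>) \<and>
     bij_betw (\<lambda>t. torus_pt \<Gamma> (c t)) {0..<1} K"

definition immersed_closed_plane_curve :: "(real \<Rightarrow> complex) \<Rightarrow> bool" where
  "immersed_closed_plane_curve g \<longleftrightarrow> C1_regular g \<and> (\<forall>t. g (t + 1) = g t)"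

text \<open>The degree of the Gauss map \<open>g'/|g'|\<close>, a closed path in the unit circle, is its winding number
  around 0.\<close>

definition turning_number :: "(real \<Rightarrow> complex) \<Rightarrow> real" where
  "turning_number g = \<bar>Re (winding_number (\<lambda>t. sgn (vector_derivative g (at t))) 0)\<bar>"

text \<open>A hemisphere bounded by the axis A is a disc. The orthogonal projection to the plane spanned by
  A, with orthonormal basis e1, e2, maps it diffeomorphically onto an open disc of the complex plane,
  and the profile curves are regarded as plane curves in this way. Up to sign, turning numbers do not
  change under diffeomorphisms of discs.\<close>

definition hemisphere_chart :: "mat2 \<Rightarrow> mat2 \<Rightarrow> mat2 \<Rightarrow> complex" where
  "hemisphere_chart e1 e2 x = Complex (x \<bullet> e1) (x \<bullet> e2)"

definition plane_basis :: "mat2 set \<Rightarrow> mat2 \<Rightarrow> mat2 \<Rightarrow> bool" where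
  "plane_basis A e1 e2 \<longleftrightarrow> norm e1 = 1 \<and> norm e2 = 1 \<and> e1 \<bullet> e2 = 0 \<and> span {e1, e2} = span A"

definition has_total_turning_number ::
  "complex \<Rightarrow> complex \<Rightarrow> complex set \<Rightarrow> mat2 set \<Rightarrow> mat2 set \<Rightarrow> real \<Rightarrow> bool" where
  "has_total_turning_number lam1 lam2 \<Gamma> A H \<tau> \<longleftrightarrow>
     finite (profile_curves lam1 lam2 \<Gamma> H) \<and>
     (\<forall>K\<in>profile_curves lam1 lam2 \<Gamma> H. \<exists>c. parametrizes \<Gamma> K c) \<and>
     (\<forall>e1 e2 c. plane_basis A e1 e2 \<longrightarrow>
        (\<forall>K\<in>profile_curves lam1 lam2 \<Gamma> H. parametrizes \<Gamma> K (c K)) \<longrightarrow>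
        (\<forall>K\<in>profile_curves lam1 lam2 \<Gamma> H.
           immersed_closed_plane_curve (hemisphere_chart e1 e2 \<circ> flat_cmc lam1 lam2 \<circ> c K)) \<and>
        (\<Sum>K\<in>profile_curves lam1 lam2 \<Gamma> H.
           turning_number (hemisphere_chart e1 e2 \<circ> flat_cmc lam1 lam2 \<circ> c K)) = \<tau>)"

definition is_circle :: "mat2 set \<Rightarrow> bool" where
  "is_circle C \<longleftrightarrow>
     (\<exists>P q r. subspace P \<and> dim P = 2 \<and> r > 0 \<and> C = {q + x | x. x \<in> P \<and> norm x = r})"

definition is_union_of_wrapped_circles ::
  "complex \<Rightarrow> complex \<Rightarrow> complex set \<Rightarrow> mat2 set \<Rightarrow> nat \<Rightarrow> nat \<Rightarrow> bool" where
  "is_union_of_wrapped_circles lam1 lam2 \<Gamma> H k w \<longleftrightarrow>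
     finite (profile_curves lam1 lam2 \<Gamma> H) \<and> card (profile_curves lam1 lam2 \<Gamma> H) = k \<and>
     (\<exists>C. is_circle C \<and> (\<forall>K\<in>profile_curves lam1 lam2 \<Gamma> H.
        sheeted_covering w (subtopology (torus \<Gamma>) K) (top_of_set C)
          (descend (flat_cmc lam1 lam2))))"


section \<open>Rotational tori\<close>

text \<open>The rotation by the inverse of \<open>lam0\<close> normalizes the spectral data to \<open>lam0 = 1\<close>.\<close>

definition nu :: "complex \<Rightarrow> complex" where
  "nu lam = csqrt (1 / 4 * (lam - 1) * (inverse lam - 1))"

definition exp_e0 :: "complex \<Rightarrow> mat2" where
  "exp_e0 a = mat_exp (vector [vector [a * \<i>, 0], vector [0, - (a * \<i>)]])"

definition rotational :: "complex \<times> complex \<times> complex \<Rightarrow> bool" where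
  "rotational = (\<lambda>(lam0, lam1, lam2). \<exists>A. geodesic A \<and> (\<forall>p\<in>A. \<forall>x::real.
     exp_e0 (of_real x * nu (lam1 / lam0)) ** p ** exp_e0 (- (of_real x * nu (lam2 / lam0))) = p))"

end

theory Submission
  imports Defs
begin

text \<open>The transformation p \<mapsto> F(\<lambda>1, z) p F(\<lambda>2, z)^-1 of the quaternions rotates two orthogonal
  planes by the angles 2\<pi>y and 2\<pi>x, where x and y are the pairings of z with \<kappa>1 and \<kappa>2. Hence the torus
  is a product of two circles with period lattice \<int>\<times>\<int> in the coordinates (x, y), and its axes are
  the great circles in the two planes. A double point means q0 a = q \<kappa>1 + q' \<kappa>2 with coprime integers
  and a a square root of \<lambda>0; then (q0, q, q') is (l0, l1, l2) up to signs and order, and the lattice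
  is given by q0 dvd q x + q' y. The preimage of a hemisphere consists of the lines on which x (or y)
  is congruent to a constant modulo 1, so that profile curves are counted by elementary arithmetic.
  As \<kappa>1 and \<kappa>2 are orthogonal with |\<kappa>1|^2 + |\<kappa>2|^2 = 1, the relation determines their lengths, and with
  them the spectral data up to rotation and inversion; it also forces l1 < l0 < l2.\<close>

text \<open>The planes come from splitting 1 = conj(a1) (\<kappa>1 + \<kappa>2), where a1, a2 are
  square roots of \<lambda>1, \<lambda>2. The two frames turn by t1 = \<pi> <z,a1> and t2 = \<pi>
  <z,a2>; acting from the left and, inverted, from the right, they rotate the plane of \<kappa>1 by
  t1 - t2 and that of \<kappa>2 by t1 + t2. Integers arise because a torus has two independent
  periods: pairing them with \<kappa>1, \<kappa>2 and a gives a linear system with integer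
  coefficients for the coordinates of a. Other square roots, or exchanged sym points, only permute q
  and q' and change signs; hence the absolute values, minimum and maximum. The inequality holds
  because q0^2 is the mean of q^2 and q'^2 with weights |\<kappa>1|^2 and |\<kappa>2|^2. Profile
  curves are topological components in a quotient space, and turning numbers are claimed for every
  regular parametrization. The former are found from a partition into open connected sets. For the
  latter, a lift of any parametrization stays on one line, where its other coordinate is monotone
  with increment plus or minus the shortest period.\<close>

section \<open>Quaternions, and exponentials of multiples of imaginary units\<close>

definition quat :: "complex \<Rightarrow> complex \<Rightarrow> mat2" where
  "quat a b = vector [vector [a, b], vector [- cnj b, cnj a]]"

lemma mat2_eq_iff: "A = B \<longleftrightarrow> A$1$1 = B$1$1 \<and> A$1$2 = B$1$2 \<and> A$2$1 = B$2$1 \<and> A$2$2 = B$2$2"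
  for A B :: mat2
  by (auto simp: vec_eq_iff forall_2)

lemma quat_nth [simp]:
  "quat a b $ 1 $ 1 = a" "quat a b $ 1 $ 2 = b" "quat a b $ 2 $ 1 = - cnj b" "quat a b $ 2 $ 2 = cnj a"
  by (simp_all add: quat_def)

lemma quat_eq_iff [simp]: "quat a b = quat c d \<longleftrightarrow> a = c \<and> b = d"
  by (auto simp: mat2_eq_iff)

lemma quat_add: "quat a b + quat c d = quat (a + c) (b + d)"
  by (simp add: mat2_eq_iff)

lemma quat_scaleR: "r *\<^sub>R quat a b = quat (r *\<^sub>R a) (r *\<^sub>R b)"
  by (simp add: mat2_eq_iff)

lemma quat_mult: "quat a b ** quat c d = quat (a * c - b * cnj d) (a * d + b * cnj c)"
  by (simp add: mat2_eq_iff matrix_matrix_mult_def sum_2 algebra_simps)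

lemma quat_one: "mat 1 = quat 1 0"
  by (simp add: mat2_eq_iff mat_def)

lemma inner_quat: "quat a b \<bullet> quat c d = 2 * (a \<bullet> c + b \<bullet> d)"
  by (simp add: inner_vec_def sum_2 inner_complex_def)

lemma cmod_sum_eq_1_iff: "(norm a)\<^sup>2 + (norm b)\<^sup>2 = 1 \<longleftrightarrow> a * cnj a + b * cnj b = 1"
proof -
  have "a * cnj a + b * cnj b = of_real ((norm a)\<^sup>2 + (norm b)\<^sup>2)"
    by (simp add: complex_norm_square del: of_real_power)
  then show ?thesis by (simp only: of_real_eq_1_iff)
qed

lemma SU2_iff: "p \<in> SU2 \<longleftrightarrow> (\<exists>a b. p = quat a b \<and> (norm a)\<^sup>2 + (norm b)\<^sup>2 = 1)"
proof
  assume "p \<in> SU2"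
  then have *: "p ** (\<chi> i j. cnj (p $ j $ i)) = mat 1" and d: "det p = 1"
    by (auto simp: SU2_def)
  define a b c d where "a = p$1$1" "b = p$1$2" "c = p$2$1" "d = p$2$2"
  from * have 1: "a * cnj a + b * cnj b = 1" and 2: "c * cnj a + d * cnj b = 0"
    by (simp_all add: mat2_eq_iff matrix_matrix_mult_def sum_2 mat_def a_b_c_d_def)
  have 3: "a * d - b * c = 1" using d by (simp add: det_2 a_b_c_d_def)
  \<comment> \<open>Equations \<open>2\<close> and \<open>3\<close> are linear in \<open>c\<close>
    and \<open>d\<close>, with determinant \<open>a * cnj a + b * cnj b\<close>, which is 1; the two
    chains are Cramer's rule.\<close>
  have "d = (a * cnj a + b * cnj b) * d" using 1 by simp
  also have "\<dots> = cnj a * (a * d - b * c) + b * (c * cnj a + d * cnj b)" by algebra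
  finally have d': "d = cnj a" using 2 3 by simp
  have "c = (a * cnj a + b * cnj b) * c" using 1 by simp
  also have "\<dots> = a * (c * cnj a + d * cnj b) - cnj b * (a * d - b * c)" by algebra
  finally have c': "c = - cnj b" using 2 3 by simp
  have "p = quat a b" using c' d' by (simp add: mat2_eq_iff a_b_c_d_def)
  then show "\<exists>a b. p = quat a b \<and> (norm a)\<^sup>2 + (norm b)\<^sup>2 = 1"
    using 1 unfolding cmod_sum_eq_1_iff by blast
next
  assume "\<exists>a b. p = quat a b \<and> (norm a)\<^sup>2 + (norm b)\<^sup>2 = 1"
  then obtain a b where p: "p = quat a b" and 1: "a * cnj a + b * cnj b = 1"
    unfolding cmod_sum_eq_1_iff by blast
  then show "p \<in> SU2"
    by (simp add: p SU2_def mat2_eq_iff matrix_matrix_mult_def sum_2 mat_def det_2 algebra_simps)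
qed

lemma quat_in_span_SU2: "quat a b \<in> span SU2"
proof (cases "a = 0 \<and> b = 0")
  case True
  then have "quat a b = 0" by (simp add: mat2_eq_iff)
  then show ?thesis by (simp add: span_zero)
next
  case False
  define r where "r = sqrt ((norm a)\<^sup>2 + (norm b)\<^sup>2)"
  have "(norm a)\<^sup>2 + (norm b)\<^sup>2 > 0" using False
    by (metis norm_eq_zero sum_power2_gt_zero_iff)
  then have r: "r > 0" "r\<^sup>2 = (norm a)\<^sup>2 + (norm b)\<^sup>2" by (auto simp: r_def)
  have "quat (a /\<^sub>R r) (b /\<^sub>R r) \<in> SU2"
    unfolding SU2_iff
  proof (intro exI conjI)
    show "(norm (a /\<^sub>R r))\<^sup>2 + (norm (b /\<^sub>R r))\<^sup>2 = 1"
      using r by (simp add: power_mult_distrib flip: distrib_left)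
        (metis r(2) left_inverse power_inverse power_not_zero less_irrefl)
  qed simp
  then have "r *\<^sub>R quat (a /\<^sub>R r) (b /\<^sub>R r) \<in> span SU2" by (intro span_scale span_base)
  then show ?thesis using r by (simp add: quat_scaleR)
qed

lemma span_SU2: "span SU2 = {quat a b | a b. True}"
proof
  show "span SU2 \<subseteq> {quat a b | a b. True}"
  proof (rule span_minimal)
    show "SU2 \<subseteq> {quat a b | a b. True}" by (auto simp: SU2_iff)
    have "0 = quat 0 0" by (simp add: mat2_eq_iff)
    then show "subspace {quat a b | a b. True}"
      by (fastforce simp: subspace_def quat_add quat_scaleR)
  qed
qed (auto simp: quat_in_span_SU2)

text \<open>The inner product is twice the Euclidean one on the pair of complex entries, hence the
  value 2. In this form membership can be tested in any orthogonal basis of the quaternions.\<close>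

lemma mem_SU2_iff: "p \<in> SU2 \<longleftrightarrow> p \<in> span SU2 \<and> p \<bullet> p = 2"
  by (auto simp: SU2_iff span_SU2 inner_quat power2_norm_eq_inner)

lemma quat_inverse:
  assumes "(norm a)\<^sup>2 + (norm b)\<^sup>2 = 1"
  shows "matrix_inv (quat a b) = quat (cnj a) (- b)"
proof -
  have 1: "a * cnj a + b * cnj b = 1" using assms by (simp only: cmod_sum_eq_1_iff)
  have *: "quat a b ** quat (cnj a) (- b) = mat 1" "quat (cnj a) (- b) ** quat a b = mat 1"
    using 1 by (simp_all add: quat_mult quat_one algebra_simps)
  \<comment> \<open>\<open>matrix_inv\<close> is a choice operator, so its value is known only
    through the uniqueness of two-sided inverses.\<close>
  show ?thesis
    unfolding matrix_inv_def
  proof (rule some_equality)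
    fix B assume B: "quat a b ** B = mat 1 \<and> B ** quat a b = mat 1"
    have "B = B ** (quat a b ** quat (cnj a) (- b))" using * by simp
    also have "\<dots> = quat (cnj a) (- b)" using B by (simp add: matrix_mul_assoc)
    finally show "B = quat (cnj a) (- b)" .
  qed (use * in simp)
qed

text \<open>Euler's formula with \<open>J\<close> in the role of the imaginary unit: the powers of
  \<open>J\<close> are alternately multiples of 1 and of \<open>J\<close>, and the series splits
  into those of cosine and sine.\<close>

lemma mat_exp_rotation:
  fixes J :: mat2
  assumes "J ** J = - mat 1"
  shows "mat_exp (s *\<^sub>R J) = cos s *\<^sub>R mat 1 + sin s *\<^sub>R J"
proof -
  have [simp]: "J ** (r *\<^sub>R A) = r *\<^sub>R (J ** A)" "(r *\<^sub>R J) ** A = r *\<^sub>R (J ** A)" for r and A :: mat2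
    by (simp_all add: mat2_eq_iff matrix_matrix_mult_def sum_2 scaleR_right_distrib)
  \<comment> \<open>\<open>cos_coeff\<close> vanishes at odd and \<open>sin_coeff\<close> at even
    indices, so one formula serves both parities. The induction runs on the recursion that expresses
    each coefficient at \<open>Suc n\<close> by the other one at \<open>n\<close>.\<close>
  have coeffs: "(1 / fact n) *\<^sub>R (((**) (s *\<^sub>R J) ^^ n) (mat 1)) =
      (cos_coeff n * s ^ n) *\<^sub>R mat 1 + (sin_coeff n * s ^ n) *\<^sub>R J" for n
  proof (induction n)
    case 0
    show ?case by (simp add: sin_coeff_def)
  next
    case (Suc n)
    have "(1 / fact (Suc n)) *\<^sub>R (((**) (s *\<^sub>R J) ^^ Suc n) (mat 1)) =
      (1 / (1 + real n)) *\<^sub>R ((s *\<^sub>R J) ** ((1 / fact n) *\<^sub>R (((**) (s *\<^sub>R J) ^^ n) (mat 1))))"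
      by (simp add: mult.commute)
    also have "\<dots> = (1 / (1 + real n)) *\<^sub>R ((s *\<^sub>R J) **
        ((cos_coeff n * s ^ n) *\<^sub>R mat 1 + (sin_coeff n * s ^ n) *\<^sub>R J))"
      by (simp only: Suc.IH)
    also have "\<dots> = (cos_coeff (Suc n) * s ^ Suc n) *\<^sub>R mat 1 + (sin_coeff (Suc n) * s ^ Suc n) *\<^sub>R J"
      by (simp add: cos_coeff_Suc sin_coeff_Suc matrix_add_ldistrib assms scaleR_right_distrib scaleR_right_diff_distrib mult_ac del: fact_Suc)
    finally show ?case .
  qed
  have "(\<lambda>n. cos_coeff n * s ^ n) sums cos s" "(\<lambda>n. sin_coeff n * s ^ n) sums sin s"
    using cos_converges[of s] sin_converges[of s] by simp_all
  then have "(\<lambda>n. (cos_coeff n * s ^ n) *\<^sub>R mat 1 + (sin_coeff n * s ^ n) *\<^sub>R J) sums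
      (cos s *\<^sub>R mat 1 + sin s *\<^sub>R J)"
    by (intro sums_add bounded_linear.sums[OF bounded_linear_scaleR_left])
  then show ?thesis
    by (simp only: mat_exp_def coeffs sums_unique[symmetric])
qed

text \<open>Once a square root \<open>a\<close> is fixed, both entries of the exponent contain the
  same real factor \<open>pairing z a\<close>; what remains is the imaginary unit
  \<open>quat 0 (\<i> * cnj a)\<close>.\<close>

lemma frame_eq:
  assumes "a\<^sup>2 = lam" "norm a = 1"
  shows "frame lam z = quat (cos (pi * pairing z a)) (\<i> * sin (pi * pairing z a) * cnj a)"
proof -
  have u: "a * cnj a = 1" using assms(2) by (metis complex_norm_square of_real_1 power_one)
  have il: "inverse lam = (cnj a)\<^sup>2"
    using u assms(1) by (metis inverse_unique power_mult_distrib power_one)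
  have p: "complex_of_real (pairing z a) = z * cnj a + cnj z * a"
    by (simp add: pairing_def complex_eq_iff)
  have p1: "z * inverse lam + cnj z = complex_of_real (pairing z a) * cnj a"
    unfolding p il using u by (simp add: algebra_simps power2_eq_square)
  have "complex_of_real (pairing z a) * a = z * (a * cnj a) + cnj z * (a * a)"
    unfolding p by (simp add: algebra_simps)
  then have p2: "z + cnj z * lam = complex_of_real (pairing z a) * a"
    using u assms(1) by (simp add: power2_eq_square)
  have "vector [
     vector [0, complex_of_real pi * \<i> * (z * inverse lam + cnj z)],
     vector [complex_of_real pi * \<i> * (z + cnj z * lam), 0]] = (pi * pairing z a) *\<^sub>R quat 0 (\<i> * cnj a)"
    unfolding p1 p2 by (simp add: mat2_eq_iff) (simp add: scaleR_conv_of_real mult_ac)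
  moreover have "quat 0 (\<i> * cnj a) ** quat 0 (\<i> * cnj a) = - mat 1"
    using u by (simp add: quat_mult mat2_eq_iff mat_def mult_ac)
  ultimately have "frame lam z = cos (pi * pairing z a) *\<^sub>R mat 1 + sin (pi * pairing z a) *\<^sub>R quat 0 (\<i> * cnj a)"
    unfolding frame_def by (simp only: mat_exp_rotation)
  then show ?thesis
    by (simp add: quat_one quat_add quat_scaleR) (simp add: scaleR_conv_of_real mult_ac)
qed

lemma exp_e0_of_real: "exp_e0 (of_real s) = quat (cis s) 0"
proof -
  have "vector [vector [of_real s * \<i>, 0], vector [0, - (of_real s * \<i>)]] = s *\<^sub>R quat \<i> 0"
    by (simp add: mat2_eq_iff) (simp add: scaleR_conv_of_real)
  moreover have "quat \<i> 0 ** quat \<i> 0 = - mat 1" by (simp add: quat_mult mat2_eq_iff mat_def)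
  ultimately have "exp_e0 (of_real s) = cos s *\<^sub>R mat 1 + sin s *\<^sub>R quat \<i> 0"
    unfolding exp_e0_def by (simp only: mat_exp_rotation)
  then show ?thesis
    by (simp add: quat_one quat_add quat_scaleR complex_eq_iff)
qed

section \<open>Quotients of the plane\<close>

text \<open>Subgroups of any rank are allowed, because the coverings between profile curves are
  quotients of a line by groups of rank one.\<close>

definition add_subgroup :: "complex set \<Rightarrow> bool" where
  "add_subgroup \<Gamma> \<longleftrightarrow> 0 \<in> \<Gamma> \<and> (\<forall>x\<in>\<Gamma>. \<forall>y\<in>\<Gamma>. x - y \<in> \<Gamma>)"

lemma add_subgroup_uminus: "add_subgroup \<Gamma> \<Longrightarrow> x \<in> \<Gamma> \<Longrightarrow> - x \<in> \<Gamma>"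
  unfolding add_subgroup_def by (metis diff_0)

lemma add_subgroup_add: "add_subgroup \<Gamma> \<Longrightarrow> x \<in> \<Gamma> \<Longrightarrow> y \<in> \<Gamma> \<Longrightarrow> x + y \<in> \<Gamma>"
  using add_subgroup_uminus[of \<Gamma> y] unfolding add_subgroup_def by fastforce

lemma torus_pt_eq_iff:
  assumes "add_subgroup \<Gamma>"
  shows "torus_pt \<Gamma> z = torus_pt \<Gamma> w \<longleftrightarrow> z - w \<in> \<Gamma>"
proof
  assume "torus_pt \<Gamma> z = torus_pt \<Gamma> w"
  moreover have "z \<in> torus_pt \<Gamma> z" using assms by (simp add: torus_pt_def add_subgroup_def)
  ultimately show "z - w \<in> \<Gamma>" by (simp add: torus_pt_def)
next
  assume zw: "z - w \<in> \<Gamma>"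
  have "u - z \<in> \<Gamma> \<longleftrightarrow> u - w \<in> \<Gamma>" for u
  proof
    assume "u - z \<in> \<Gamma>"
    then have "(u - z) + (z - w) \<in> \<Gamma>" using zw add_subgroup_add[OF assms] by blast
    then show "u - w \<in> \<Gamma>" by simp
  next
    assume "u - w \<in> \<Gamma>"
    then have "(u - w) - (z - w) \<in> \<Gamma>" using zw assms unfolding add_subgroup_def by blast
    then show "u - z \<in> \<Gamma>" by simp
  qed
  then show "torus_pt \<Gamma> z = torus_pt \<Gamma> w" by (simp add: torus_pt_def)
qed

lemma topspace_torus [simp]: "topspace (torus \<Gamma>) = range (torus_pt \<Gamma>)"
proof
  show "topspace (torus \<Gamma>) \<subseteq> range (torus_pt \<Gamma>)"
    by (metis openin_torus openin_topspace)
  have "openin (torus \<Gamma>) (range (torus_pt \<Gamma>))" by (simp add: openin_torus)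
  then show "range (torus_pt \<Gamma>) \<subseteq> topspace (torus \<Gamma>)" by (rule openin_subset)
qed

lemma continuous_map_torus_pt: "continuous_map euclidean (torus \<Gamma>) (torus_pt \<Gamma>)"
  by (auto simp: continuous_map_def openin_torus)

text \<open>The preimage of the image of an open set is the union of its translates by
  \<Gamma>.\<close>

lemma open_map_torus_pt:
  assumes "add_subgroup \<Gamma>"
  shows "open_map euclidean (torus \<Gamma>) (torus_pt \<Gamma>)"
  unfolding open_map_def
proof (intro allI impI)
  fix U :: "complex set" assume "openin euclidean U"
  then have "open U" by simp
  have "{z. torus_pt \<Gamma> z \<in> torus_pt \<Gamma> ` U} = (\<Union>\<gamma>\<in>\<Gamma>. (+) \<gamma> ` U)"
  proof (intro set_eqI iffI)
    fix z assume "z \<in> {z. torus_pt \<Gamma> z \<in> torus_pt \<Gamma> ` U}"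
    then obtain u where u: "u \<in> U" "z - u \<in> \<Gamma>" using assms by (auto simp: torus_pt_eq_iff)
    then have "z = (z - u) + u" by simp
    with u show "z \<in> (\<Union>\<gamma>\<in>\<Gamma>. (+) \<gamma> ` U)" by blast
  next
    fix z assume "z \<in> (\<Union>\<gamma>\<in>\<Gamma>. (+) \<gamma> ` U)"
    then obtain \<gamma> u where "\<gamma> \<in> \<Gamma>" "u \<in> U" "z = \<gamma> + u" by blast
    then have "torus_pt \<Gamma> z = torus_pt \<Gamma> u" using assms by (simp add: torus_pt_eq_iff)
    then show "z \<in> {z. torus_pt \<Gamma> z \<in> torus_pt \<Gamma> ` U}" using \<open>u \<in> U\<close> by simp
  qed
  moreover have "open (\<Union>\<gamma>\<in>\<Gamma>. (+) \<gamma> ` U)" using \<open>open U\<close> by (intro open_UN ballI open_translation)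
  ultimately show "openin (torus \<Gamma>) (torus_pt \<Gamma> ` U)" by (auto simp: openin_torus)
qed

lemma quotient_map_torus_pt:
  assumes "add_subgroup \<Gamma>"
  shows "quotient_map euclidean (torus \<Gamma>) (torus_pt \<Gamma>)"
  using continuous_map_torus_pt open_map_torus_pt[OF assms]
  by (rule continuous_open_imp_quotient_map) simp

lemma descend_torus_pt:
  assumes "add_subgroup \<Gamma>" "\<And>z w. z - w \<in> \<Gamma> \<Longrightarrow> g z = g w"
  shows "descend g (torus_pt \<Gamma> z) = g z"
proof -
  have "z \<in> torus_pt \<Gamma> z" using assms(1) by (simp add: torus_pt_def add_subgroup_def)
  moreover have "g w = g z" if "w \<in> torus_pt \<Gamma> z" for w using assms(2)[of w z] that by (simp add: torus_pt_def)
  ultimately have "g ` torus_pt \<Gamma> z = {g z}" by blast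
  then show ?thesis by (simp add: descend_def)
qed

text \<open>The complement of a member is the union of the others and hence open. So each member is
  clopen, and a nonempty connected clopen set is a component.\<close>

lemma connected_components_of_open_partition:
  assumes \<K>: "pairwise disjnt \<K>" "\<Union>\<K> = topspace X"
    and op: "\<And>K. K \<in> \<K> \<Longrightarrow> openin X K"
    and con: "\<And>K. K \<in> \<K> \<Longrightarrow> connectedin X K"
    and ne: "\<And>K. K \<in> \<K> \<Longrightarrow> K \<noteq> {}"
  shows "connected_components_of X = \<K>"
proof -
  have sub: "C = K" if C: "C \<in> connected_components_of X" and K: "K \<in> \<K>" and dj: "\<not> disjnt C K" for C K
  proof
    show "K \<subseteq> C" using C con[OF K] dj by (rule connected_components_of_maximal)
    have "K \<inter> \<Union>(\<K> - {K}) = {}"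
      using \<K>(1) K unfolding pairwise_def disjnt_def by blast
    moreover have "topspace X = K \<union> \<Union>(\<K> - {K})" using \<K>(2) K by blast
    ultimately have "topspace X - K = \<Union>(\<K> - {K})" by blast
    moreover have "openin X (\<Union>(\<K> - {K}))" by (rule openin_Union) (use op in blast)
    ultimately have "closedin X K" using op[OF K] openin_subset[OF op[OF K]] by (simp add: closedin_def)
    then show "C \<subseteq> K"
      using connectedin_clopen_cases[OF connectedin_connected_components_of[OF C], of K] op[OF K] dj
      by blast
  qed
  show ?thesis
  proof (intro set_eqI iffI)
    fix C assume C: "C \<in> connected_components_of X"
    then have "C \<noteq> {}" "C \<subseteq> topspace X"
      by (rule nonempty_connected_components_of, rule connected_components_of_subset)
    then obtain x K where "x \<in> C" "x \<in> K" "K \<in> \<K>" using \<K>(2) by blast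
    moreover from this have "\<not> disjnt C K" unfolding disjnt_def by blast
    ultimately show "C \<in> \<K>" using sub[OF C, of K] by simp
  next
    fix K assume K: "K \<in> \<K>"
    have "X \<noteq> trivial_topology" using K \<K>(2) ne[OF K] by force
    then obtain C where C: "C \<in> connected_components_of X" "K \<subseteq> C"
      using exists_connected_component_of_superset[OF con[OF K]] by blast
    have "\<not> disjnt C K" using C(2) ne[OF K] unfolding disjnt_def by blast
    then show "K \<in> connected_components_of X" using sub[OF C(1) K] C(1) by simp
  qed
qed

section \<open>Counting cosets, and coverings between quotients\<close>

text \<open>This is how cosets are counted: the quotient map is replaced by a map to residues with
  the same fibres.\<close>

lemma card_image_eq_card_image:
  assumes "\<And>x y. x \<in> A \<Longrightarrow> y \<in> A \<Longrightarrow> f x = f y \<longleftrightarrow> g x = g y"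
  shows "finite (f ` A) \<longleftrightarrow> finite (g ` A)" "card (f ` A) = card (g ` A)"
proof -
  define h where "h s = g (SOME x. x \<in> A \<and> f x = s)" for s
  have h: "h (f x) = g x" if "x \<in> A" for x
  proof -
    have "(SOME y. y \<in> A \<and> f y = f x) \<in> A \<and> f (SOME y. y \<in> A \<and> f y = f x) = f x"
      by (rule someI[of _ x]) (simp add: that)
    then show ?thesis unfolding h_def using assms that by blast
  qed
  have "inj_on h (f ` A)"
    by (rule inj_onI) (metis assms h imageE)
  moreover have "h ` f ` A = g ` A" unfolding image_image using h by (intro image_cong) auto
  ultimately have "bij_betw h (f ` A) (g ` A)" unfolding bij_betw_def ..
  then show "finite (f ` A) \<longleftrightarrow> finite (g ` A)" "card (f ` A) = card (g ` A)"
    by (simp_all add: bij_betw_finite bij_betw_same_card)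
qed

text \<open>\<open>X\<close> and \<open>Y\<close> stand for the quotients of \<open>L\<close> by
  \<Gamma> and \<Lambda>, and \<open>p\<close> for the induced map, whose degree is the index of
  \<Gamma> in \<Lambda>. The set \<open>L\<close> is the whole plane for the covering of tori and a
  line for the covering of circles; for a line neither map is open by general principles, so
  openness is a hypothesis.\<close>

lemma sheeted_covering_quotient:
  fixes L :: "complex set"
  assumes q: "continuous_map (top_of_set L) X q" "open_map (top_of_set L) X q" "q ` L = topspace X"
    and F: "continuous_map (top_of_set L) Y F" "open_map (top_of_set L) Y F" "F ` L = topspace Y"
    and p: "\<And>z. z \<in> L \<Longrightarrow> p (q z) = F z"
    and \<Lambda>: "add_subgroup \<Lambda>" and \<Gamma>: "add_subgroup \<Gamma>" and "\<Gamma> \<subseteq> \<Lambda>"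
    and L: "\<And>z l. z \<in> L \<Longrightarrow> l \<in> \<Lambda> \<Longrightarrow> z + l \<in> L"
    and qeq: "\<And>z w. z \<in> L \<Longrightarrow> w \<in> L \<Longrightarrow> q z = q w \<longleftrightarrow> z - w \<in> \<Gamma>"
    and Feq: "\<And>z w. z \<in> L \<Longrightarrow> w \<in> L \<Longrightarrow> F z = F w \<longleftrightarrow> z - w \<in> \<Lambda>"
    and eps: "eps > 0" "\<And>l. l \<in> \<Lambda> \<Longrightarrow> norm l < eps \<Longrightarrow> l = 0"
    and n: "finite (torus_pt \<Gamma> ` \<Lambda>)" "card (torus_pt \<Gamma> ` \<Lambda>) = n"
  shows "sheeted_covering n X Y p"
proof -
  have quot: "quotient_map (top_of_set L) X q"
    using q by (intro continuous_open_imp_quotient_map) auto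
  have pq: "continuous_map (top_of_set L) Y (p \<circ> q)"
    using F(1) p by (rule_tac continuous_map_eq[OF F(1)]) auto
  have cp: "continuous_map X Y p" using continuous_compose_quotient_map[OF quot pq] .
  have op: "open_map X Y p"
    unfolding open_map_def
  proof (intro allI impI)
    fix U assume U: "openin X U"
    have "openin (top_of_set L) {z \<in> topspace (top_of_set L). q z \<in> U}"
      using openin_continuous_map_preimage[OF q(1) U] .
    then have "openin Y (F ` {z \<in> L. q z \<in> U})"
      using F(2) unfolding open_map_def by simp
    moreover have "F ` {z \<in> L. q z \<in> U} = p ` U"
    proof -
      have "U \<subseteq> q ` L" using openin_subset[OF U] q(3) by simp
      then have U': "q ` {z \<in> L. q z \<in> U} = U" by blast
      have "F ` {z \<in> L. q z \<in> U} = p ` q ` {z \<in> L. q z \<in> U}"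
        unfolding image_image by (intro image_cong HOL.refl p[symmetric]) simp
      then show ?thesis by (simp only: U')
    qed
    ultimately show "openin Y (p ` U)" by simp
  qed
  have "\<exists>V \<U>. openin Y V \<and> y \<in> V \<and> finite \<U> \<and> card \<U> = n \<and> pairwise disjnt \<U> \<and>
        \<Union>\<U> = {x \<in> topspace X. p x \<in> V} \<and>
        (\<forall>U\<in>\<U>. openin X U \<and> homeomorphic_map (subtopology X U) (subtopology Y V) p)"
    if y: "y \<in> topspace Y" for y
  proof -
    obtain z0 where z0: "z0 \<in> L" "F z0 = y" using y F(3) by force
    \<comment> \<open>The candidates for the sheets are the images under \<open>q\<close> of small
      discs in \<open>L\<close> around all translates of \<open>z0\<close>. Radius
      \<open>eps / 2\<close> makes two points of such discs comparable up to
      \<open>eps\<close>.\<close>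
    define B where "B l = L \<inter> ball (z0 + l) (eps / 2)" for l
    define W where "W l = q ` B l" for l
    have Bop: "openin (top_of_set L) (B l)" for l by (simp add: B_def openin_open_Int)
    have BL: "B l \<subseteq> L" for l by (simp add: B_def)
    have z0B: "z0 + l \<in> B l" if "l \<in> \<Lambda>" for l using that eps z0 L by (simp add: B_def)
    have shift: "w - m \<in> B (l - m)" if "w \<in> B l" "m \<in> \<Lambda>" for w l m
    proof -
      have "w + (- m) \<in> L" using that BL add_subgroup_uminus[OF \<Lambda>] by (intro L) auto
      then show ?thesis using that by (auto simp: B_def dist_norm algebra_simps)
    qed
    \<comment> \<open>The defect \<open>(l - m) - (a - b)\<close> is an element of \<Lambda> of norm
      less than \<open>eps\<close>, so discreteness makes it vanish.\<close>
    have close: "a - b = l - m"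
      if "a \<in> B l" "b \<in> B m" "a - b \<in> \<Lambda>" "l \<in> \<Lambda>" "m \<in> \<Lambda>" for a b l m
    proof -
      have "norm ((z0 + l - a) - (z0 + m - b)) < eps / 2 + eps / 2"
        using norm_triangle_ineq4[of "z0 + l - a" "z0 + m - b"] that(1,2)
        unfolding B_def Int_iff mem_ball dist_norm by linarith
      then have "norm ((l - m) - (a - b)) < eps" by (simp add: algebra_simps)
      moreover have "(l - m) - (a - b) \<in> \<Lambda>" using that \<Lambda> unfolding add_subgroup_def by blast
      ultimately show ?thesis using eps(2) by fastforce
    qed
    have meet: "l - m \<in> \<Gamma>" if x: "x \<in> W l" "x \<in> W m" and "l \<in> \<Lambda>" "m \<in> \<Lambda>" for x l m
    proof -
      obtain a b where ab: "a \<in> B l" "b \<in> B m" "q a = q b" using x unfolding W_def by blast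
      have "a - b \<in> \<Gamma>" using qeq[of a b] BL ab by blast
      moreover from this have "a - b = l - m" using close[of a l b m] ab that \<open>\<Gamma> \<subseteq> \<Lambda>\<close> by blast
      ultimately show ?thesis by simp
    qed
    have same: "W l \<subseteq> W m" if "l - m \<in> \<Gamma>" for l m
    proof
      fix x assume "x \<in> W l"
      then obtain a where a: "a \<in> B l" "x = q a" by (auto simp: W_def)
      have "a - (l - m) \<in> B (l - (l - m))" using shift[OF a(1)] that \<open>\<Gamma> \<subseteq> \<Lambda>\<close> by blast
      then have "a - (l - m) \<in> B m" by simp
      moreover have "q a = q (a - (l - m))"
        using qeq[of a "a - (l - m)"] that subsetD[OF BL a(1)] subsetD[OF BL calculation] by simp
      ultimately show "x \<in> W m" using a by (auto simp: W_def)
    qed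
    have Weq: "W l = W m \<longleftrightarrow> l - m \<in> \<Gamma>" if "l \<in> \<Lambda>" "m \<in> \<Lambda>" for l m
    proof
      assume "W l = W m"
      moreover have "q (z0 + l) \<in> W l" using z0B that by (simp add: W_def)
      ultimately show "l - m \<in> \<Gamma>" using meet that by blast
    next
      assume "l - m \<in> \<Gamma>"
      moreover from this have "m - l \<in> \<Gamma>" using add_subgroup_uminus[OF \<Gamma>] by fastforce
      ultimately show "W l = W m" using same by blast
    qed
    define V where "V = F ` B 0"
    have FV: "F ` B l = V" if "l \<in> \<Lambda>" for l
    proof -
      have F': "F w = F (w - m)" if "w \<in> B \<rho>" "m \<in> \<Lambda>" for w m \<rho>
        using Feq[of w "w - m"] subsetD[OF BL shift[OF that]] subsetD[OF BL that(1)] that(2) by simp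
      have "F w \<in> F ` B 0" if "w \<in> B l" for w
        using F'[OF that \<open>l \<in> \<Lambda>\<close>] shift[OF that \<open>l \<in> \<Lambda>\<close>] by (intro image_eqI) simp_all
      moreover have "F w \<in> F ` B l" if "w \<in> B 0" for w
        using F'[OF that, of "- l"] shift[OF that, of "- l"] add_subgroup_uminus[OF \<Lambda> \<open>l \<in> \<Lambda>\<close>]
        by (intro image_eqI) simp_all
      ultimately show ?thesis by (auto simp: V_def)
    qed
    have Vop: "openin Y V" using F(2) Bop by (auto simp: V_def open_map_def)
    have Wop: "openin X (W l)" for l using q(2) Bop by (auto simp: W_def open_map_def)
    have pW: "p ` W l = V" if "l \<in> \<Lambda>" for l
    proof -
      have "p ` W l = F ` B l" unfolding W_def image_image by (intro image_cong HOL.refl p) (use BL in blast)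
      then show ?thesis using FV[OF that] by simp
    qed
    have inj: "inj_on p (W l)" if "l \<in> \<Lambda>" for l
    proof (rule inj_onI)
      fix x y assume "x \<in> W l" "y \<in> W l" and e: "p x = p y"
      then obtain a b where ab: "a \<in> B l" "b \<in> B l" "x = q a" "y = q b" unfolding W_def by blast
      then have "F a = F b" using e p BL by (metis subsetD)
      then have "a - b \<in> \<Lambda>" using Feq[of a b] ab BL by blast
      then show "x = y" using close[of a l b l] ab that by simp
    qed
    have hom: "homeomorphic_map (subtopology X (W l)) (subtopology Y V) p" if l: "l \<in> \<Lambda>" for l
    proof (rule bijective_open_imp_homeomorphic_map)
      have ts: "topspace X \<inter> W l = W l" "topspace Y \<inter> V = V"
        using openin_subset[OF Wop[of l]] openin_subset[OF Vop] by auto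
      show "continuous_map (subtopology X (W l)) (subtopology Y V) p"
        using continuous_map_from_subtopology[OF cp] pW[OF l] by (auto simp: continuous_map_in_subtopology)
      show "open_map (subtopology X (W l)) (subtopology Y V) p"
      proof (rule open_map_into_subtopology)
        show "open_map (subtopology X (W l)) Y p"
          using op Wop[of l] unfolding open_map_def by (metis openin_open_subtopology)
        show "p \<in> topspace (subtopology X (W l)) \<rightarrow> V" using pW[OF l] by auto
      qed
      show "p ` topspace (subtopology X (W l)) = topspace (subtopology Y V)"
        using pW[OF l] by (simp add: ts)
      show "inj_on p (topspace (subtopology X (W l)))" using inj[OF l] by (simp add: ts)
    qed
    have U: "\<Union>(W ` \<Lambda>) = {x \<in> topspace X. p x \<in> V}"
    proof (intro set_eqI iffI)
      fix x assume "x \<in> \<Union>(W ` \<Lambda>)"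
      then show "x \<in> {x \<in> topspace X. p x \<in> V}" using pW openin_subset[OF Wop] by blast
    next
      fix x assume x: "x \<in> {x \<in> topspace X. p x \<in> V}"
      then obtain w where w: "w \<in> L" "x = q w" using q(3) by auto
      then have "F w \<in> V" using x p by auto
      then obtain v where v: "v \<in> B 0" "F w = F v" by (auto simp: V_def)
      then have l: "w - v \<in> \<Lambda>" using Feq w BL by blast
      then have "v - w \<in> \<Lambda>" using add_subgroup_uminus[OF \<Lambda>] by fastforce
      then have "v - (v - w) \<in> B (0 - (v - w))" using shift[OF v(1)] by blast
      then have "w \<in> B (w - v)" by simp
      then show "x \<in> \<Union>(W ` \<Lambda>)" using l w by (auto simp: W_def)
    qed
    \<comment> \<open>Sheets agree exactly when their labels are congruent modulo \<Gamma>, so their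
      number is the number of cosets.\<close>
    have "W l = W m \<longleftrightarrow> torus_pt \<Gamma> l = torus_pt \<Gamma> m" if "l \<in> \<Lambda>" "m \<in> \<Lambda>" for l m
      using Weq[OF that] by (simp add: torus_pt_eq_iff[OF \<Gamma>])
    then have "finite (W ` \<Lambda>)" "card (W ` \<Lambda>) = n"
      using card_image_eq_card_image[of \<Lambda> W "torus_pt \<Gamma>"] n by auto
    moreover have "pairwise disjnt (W ` \<Lambda>)"
    proof (rule pairwiseI)
      fix A B assume "A \<in> W ` \<Lambda>" "B \<in> W ` \<Lambda>" and "A \<noteq> B"
      then obtain l m where l: "l \<in> \<Lambda>" "m \<in> \<Lambda>" "A = W l" "B = W m" by blast
      then have "l - m \<notin> \<Gamma>" using Weq \<open>A \<noteq> B\<close> by blast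
      then show "disjnt A B" unfolding disjnt_iff using meet l by blast
    qed
    moreover have "y \<in> V" using z0B[of 0] z0 \<Lambda> by (auto simp: V_def add_subgroup_def)
    moreover have "\<forall>U\<in>W ` \<Lambda>. openin X U \<and> homeomorphic_map (subtopology X U) (subtopology Y V) p"
      using Wop hom by blast
    ultimately show ?thesis using U Vop by (intro exI[of _ V] exI[of _ "W ` \<Lambda>"] conjI)
  qed
  with cp show ?thesis unfolding sheeted_covering_def by blast
qed

section \<open>Orbits in two planes\<close>

lemma pairing_eq_inner: "pairing z w = 2 * (z \<bullet> w)"
  by (simp add: pairing_def inner_complex_def)

lemma orthogonal_decomposition:
  fixes k k' :: complex
  assumes "k \<noteq> 0" "k' \<noteq> 0" "k \<bullet> k' = 0"
  shows "z = (z \<bullet> k / (k \<bullet> k)) *\<^sub>R k + (z \<bullet> k' / (k' \<bullet> k')) *\<^sub>R k'"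
proof -
  define u where "u = z - ((z \<bullet> k / (k \<bullet> k)) *\<^sub>R k + (z \<bullet> k' / (k' \<bullet> k')) *\<^sub>R k')"
  have "u \<bullet> k = 0" "u \<bullet> k' = 0"
    using assms by (simp_all add: u_def inner_simps inner_commute)
  then have "Re u * Re k + Im u * Im k = 0" "Re u * Re k' + Im u * Im k' = 0"
    by (simp_all add: inner_complex_def)
  moreover have "Re k * Re k' + Im k * Im k' = 0" using assms by (simp add: inner_complex_def)
  \<comment> \<open>The remainder \<open>u\<close> is orthogonal to two orthogonal nonzero vectors
    of the plane. Elimination leaves its coordinates multiplied by the product of the squared
    lengths of \<open>k\<close> and \<open>k'\<close>.\<close>
  ultimately have uu: "Re u * ((Re k)\<^sup>2 + (Im k)\<^sup>2) * ((Re k')\<^sup>2 + (Im k')\<^sup>2) = 0"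
      "Im u * ((Re k)\<^sup>2 + (Im k)\<^sup>2) * ((Re k')\<^sup>2 + (Im k')\<^sup>2) = 0"
    by algebra+
  have "(Re k)\<^sup>2 + (Im k)\<^sup>2 \<noteq> 0" "(Re k')\<^sup>2 + (Im k')\<^sup>2 \<noteq> 0"
    using assms by (simp_all add: complex_eq_iff sum_power2_eq_zero_iff)
  with uu have "Re u = 0" "Im u = 0" by (metis mult_eq_0_iff)+
  then have "u = 0" by (simp add: complex_eq_iff)
  then show ?thesis unfolding u_def by (rule eq_iff_diff_eq_0[THEN iffD2])
qed

lemma mem_span_pair: "p \<in> span {a, b} \<longleftrightarrow> (\<exists>x y. p = x *\<^sub>R a + y *\<^sub>R b)"
proof -
  have "p - x *\<^sub>R a = y *\<^sub>R b \<longleftrightarrow> p = x *\<^sub>R a + y *\<^sub>R b" for x y by (auto simp: algebra_simps)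
  then show ?thesis by (simp add: span_breakdown_eq span_singleton image_iff)
qed

lemma polar_coordinates: "\<exists>r t. r \<ge> 0 \<and> x = r * cos t \<and> y = r * sin t" for x y :: real
proof (intro exI conjI)
  show "x = norm (Complex x y) * cos (Arg (Complex x y))" "y = norm (Complex x y) * sin (Arg (Complex x y))"
    using rcis_cmod_Arg[of "Complex x y"] by (metis Re_rcis complex.sel(1), metis Im_rcis complex.sel(2))
qed simp

lemma sin_zero_cos_pos: "sin x = 0 \<Longrightarrow> cos x > 0 \<Longrightarrow> \<exists>m::int. x = 2 * pi * of_int m" for x :: real
  using sin_cos_eq_iff[of x 0] sin_cos_squared_add[of x] by (simp add: power2_eq_1_iff)

lemma matrix_add_distrib_right: "(A + B) ** C = A ** C + B ** C" for A B C :: mat2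
  by (simp add: mat2_eq_iff matrix_matrix_mult_def sum_2 algebra_simps)

text \<open>The planes spanned by b1, b2 and by d1, d2 are rotated with the frequencies k' and k. Everything
  below concerns the axis in the plane of b1 and b2; the other axis is covered by exchanging the
  planes (lemma \<open>swap\<close>).\<close>

locale clifford =
  fixes lam1 lam2 k k' :: complex and b1 b2 d1 d2 :: mat2
  assumes k_nz: "k \<noteq> 0" "k' \<noteq> 0" and k_orth: "k \<bullet> k' = 0"
    and b_nz: "b1 \<noteq> 0" and b_inner: "b2 \<bullet> b2 = b1 \<bullet> b1" "b1 \<bullet> b2 = 0"
    and d_nz: "d1 \<noteq> 0" and d_inner: "d2 \<bullet> d2 = d1 \<bullet> d1" "d1 \<bullet> d2 = 0"
    and bd_inner: "b1 \<bullet> d1 = 0" "b1 \<bullet> d2 = 0" "b2 \<bullet> d1 = 0" "b2 \<bullet> d2 = 0"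
    and span_basis: "span SU2 = span {b1, b2, d1, d2}"
    and one: "mat 1 = b1 + d1"
    and act:
      "frame lam1 z ** b1 ** matrix_inv (frame lam2 z) =
        cos (2 * pi * pairing z k') *\<^sub>R b1 + sin (2 * pi * pairing z k') *\<^sub>R b2"
      "frame lam1 z ** b2 ** matrix_inv (frame lam2 z) =
        cos (2 * pi * pairing z k') *\<^sub>R b2 - sin (2 * pi * pairing z k') *\<^sub>R b1"
      "frame lam1 z ** d1 ** matrix_inv (frame lam2 z) =
        cos (2 * pi * pairing z k) *\<^sub>R d1 + sin (2 * pi * pairing z k) *\<^sub>R d2"
      "frame lam1 z ** d2 ** matrix_inv (frame lam2 z) =
        cos (2 * pi * pairing z k) *\<^sub>R d2 - sin (2 * pi * pairing z k) *\<^sub>R d1"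
    and dual: "Lam_dual lam1 lam2 = {z. pairing z k \<in> \<int> \<and> pairing z k' \<in> \<int>}"
begin

abbreviation "f \<equiv> flat_cmc lam1 lam2"
abbreviation "\<Lambda> \<equiv> Lam_dual lam1 lam2"
abbreviation "\<alpha> z \<equiv> 2 * pi * pairing z k'"
abbreviation "\<beta> z \<equiv> 2 * pi * pairing z k"

lemma swap: "clifford lam1 lam2 k' k d1 d2 b1 b2"
proof
  show "k' \<bullet> k = 0" using k_orth by (simp add: inner_commute)
  show "d1 \<bullet> b1 = 0" "d1 \<bullet> b2 = 0" "d2 \<bullet> b1 = 0" "d2 \<bullet> b2 = 0"
    using bd_inner by (simp_all add: inner_commute)
  show "span SU2 = span {d1, d2, b1, b2}" using span_basis by (simp add: insert_commute)
  show "mat 1 = d1 + b1" using one by (simp add: add.commute)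
  show "\<Lambda> = {z. pairing z k' \<in> \<int> \<and> pairing z k \<in> \<int>}"
    using dual by (simp add: conj_commute)
qed (use k_nz b_nz d_nz b_inner d_inner act in auto)

lemmas inner_basis = b_inner d_inner bd_inner b_inner(2)[unfolded inner_commute[of b1]]
  d_inner(2)[unfolded inner_commute[of d1]] bd_inner[unfolded inner_commute[of b1] inner_commute[of b2]]

lemma bb_pos: "b1 \<bullet> b1 > 0" and dd_pos: "d1 \<bullet> d1 > 0"
  using b_nz d_nz by auto

lemma bd_sum: "b1 \<bullet> b1 + d1 \<bullet> d1 = 2"
proof -
  have "mat 1 \<bullet> (mat 1 :: mat2) = 2" by (simp add: quat_one inner_quat)
  then show ?thesis by (simp add: one inner_simps inner_basis)
qed

lemma span_basisE:
  assumes "p \<in> span SU2"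
  obtains x y u v where "p = x *\<^sub>R b1 + y *\<^sub>R b2 + u *\<^sub>R d1 + v *\<^sub>R d2"
proof -
  obtain x y u where "p - x *\<^sub>R b1 - y *\<^sub>R b2 - u *\<^sub>R d1 \<in> span {d2}"
    using assms unfolding span_basis by (auto simp: span_breakdown_eq)
  then obtain v where "p - x *\<^sub>R b1 - y *\<^sub>R b2 - u *\<^sub>R d1 = v *\<^sub>R d2"
    by (auto simp: span_singleton)
  then have "p = x *\<^sub>R b1 + y *\<^sub>R b2 + u *\<^sub>R d1 + v *\<^sub>R d2" by (simp add: algebra_simps)
  then show ?thesis by (rule that)
qed

lemma basis_in_span: "b1 \<in> span SU2" "b2 \<in> span SU2" "d1 \<in> span SU2" "d2 \<in> span SU2"
  unfolding span_basis by (auto intro: span_base)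

lemma inner_comb:
  "(x *\<^sub>R b1 + y *\<^sub>R b2 + u *\<^sub>R d1 + v *\<^sub>R d2) \<bullet> (x' *\<^sub>R b1 + y' *\<^sub>R b2 + u' *\<^sub>R d1 + v' *\<^sub>R d2) =
    (x * x' + y * y') * (b1 \<bullet> b1) + (u * u' + v * v') * (d1 \<bullet> d1)"
  by (simp add: inner_simps inner_basis algebra_simps)

text \<open>Together with \<open>gy\<close> this is the basis dual to \<open>k\<close> and
  \<open>k'\<close>; the 2 compensates the factor in \<open>pairing\<close>. Thus
  \<open>x *\<^sub>R gx + y *\<^sub>R gy\<close> is the point with coordinates (x, y).\<close>

definition gx :: complex where "gx = k /\<^sub>R (2 * (k \<bullet> k))"
definition gy :: complex where "gy = k' /\<^sub>R (2 * (k' \<bullet> k'))"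

lemma pairing_g: "pairing gx k = 1" "pairing gx k' = 0" "pairing gy k = 0" "pairing gy k' = 1"
  using k_nz k_orth by (simp_all add: gx_def gy_def pairing_eq_inner inner_commute)

lemma pairing_linear: "pairing (z + w) c = pairing z c + pairing w c"
  "pairing (z - w) c = pairing z c - pairing w c" "pairing (r *\<^sub>R z) c = r * pairing z c" "pairing 0 c = 0"
  by (simp_all add: pairing_eq_inner inner_simps)

lemma pairing_pt: "pairing (x *\<^sub>R gx + y *\<^sub>R gy) k = x" "pairing (x *\<^sub>R gx + y *\<^sub>R gy) k' = y"
  by (simp_all add: pairing_linear pairing_g)

lemma pt_pairing: "z = pairing z k *\<^sub>R gx + pairing z k' *\<^sub>R gy"
proof -
  have *: "(z \<bullet> k / (k \<bullet> k)) *\<^sub>R k = pairing z k *\<^sub>R gx" "(z \<bullet> k' / (k' \<bullet> k')) *\<^sub>R k' = pairing z k' *\<^sub>R gy"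
    unfolding gx_def gy_def pairing_eq_inner scaleR_scaleR divide_inverse
    by (simp_all add: inverse_mult_distrib)
  show ?thesis
    unfolding *[symmetric] by (rule orthogonal_decomposition[OF k_nz k_orth])
qed

lemma eq_iff_pairing: "z = w \<longleftrightarrow> pairing z k = pairing w k \<and> pairing z k' = pairing w k'"
  using pt_pairing[of z] pt_pairing[of w] by metis

text \<open>\<open>f z\<close> is the image of \<open>mat 1 = b1 + d1\<close> under the action, with
  one summand in each of the two rotating planes.\<close>

lemma flat_cmc_eq: "f z =
    cos (\<alpha> z) *\<^sub>R b1 + sin (\<alpha> z) *\<^sub>R b2 +
    cos (\<beta> z) *\<^sub>R d1 + sin (\<beta> z) *\<^sub>R d2"
proof -
  have "f z = frame lam1 z ** mat 1 ** matrix_inv (frame lam2 z)"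
    by (simp add: flat_cmc_def)
  then show ?thesis
    by (simp add: one matrix_add_ldistrib matrix_add_distrib_right act)
qed

lemma flat_cmc_in_SU2: "f z \<in> SU2"
proof -
  have "f z \<in> span SU2"
    unfolding flat_cmc_eq by (intro span_add span_scale basis_in_span)
  moreover have "f z \<bullet> f z = 2"
    unfolding flat_cmc_eq inner_comb using bd_sum
    by (simp only: power2_eq_square[symmetric] sin_cos_squared_add2 mult_1)
  ultimately show ?thesis by (simp add: mem_SU2_iff)
qed

lemma inner_flat_cmc:
  "f z \<bullet> b1 = cos (\<alpha> z) * (b1 \<bullet> b1)"
  "f z \<bullet> b2 = sin (\<alpha> z) * (b1 \<bullet> b1)"
  "f z \<bullet> d1 = cos (\<beta> z) * (d1 \<bullet> d1)"
  "f z \<bullet> d2 = sin (\<beta> z) * (d1 \<bullet> d1)"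
  by (simp_all add: flat_cmc_eq inner_simps inner_basis)

lemma sincos_2pi_eq_iff:
  "cos (2 * pi * x) = cos (2 * pi * y) \<and> sin (2 * pi * x) = sin (2 * pi * y) \<longleftrightarrow> x - y \<in> \<int>"
  for x y :: real
proof -
  have "2 * pi * x = 2 * pi * y + 2 * pi * of_int n \<longleftrightarrow> x - y = of_int n" for n
    by (simp only: distrib_left[symmetric] mult_cancel_left) auto
  then show ?thesis
    using sin_cos_eq_iff[of "2 * pi * x" "2 * pi * y"] by (auto elim: Ints_cases)
qed

text \<open>Inner products with the basis recover cosine and sine of both angles, so a coincidence
  of values forces both coordinates to differ by integers.\<close>

lemma flat_cmc_eq_iff:
  "f z = f w \<longleftrightarrow> z - w \<in> \<Lambda>"
proof
  assume "f z = f w"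
  then have "cos (\<alpha> z) = cos (2 * pi * pairing w k')"
      "sin (\<alpha> z) = sin (2 * pi * pairing w k')"
      "cos (\<beta> z) = cos (2 * pi * pairing w k)"
      "sin (\<beta> z) = sin (2 * pi * pairing w k)"
    using inner_flat_cmc[of z] inner_flat_cmc[of w] bb_pos dd_pos by auto
  then show "z - w \<in> \<Lambda>"
    unfolding dual pairing_linear mem_Collect_eq sincos_2pi_eq_iff[symmetric] by simp
next
  assume "z - w \<in> \<Lambda>"
  then have "pairing z k - pairing w k \<in> \<int>" "pairing z k' - pairing w k' \<in> \<int>"
    by (auto simp: dual pairing_linear)
  then show "f z = f w"
    by (simp add: flat_cmc_eq flip: sincos_2pi_eq_iff)
qed

lemma sub_\<Lambda>: "add_subgroup \<Lambda>"
  by (auto simp: add_subgroup_def dual pairing_linear)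

lemma Lam_dual_eq_gen_lattice: "\<Lambda> = gen_lattice gx gy"
proof (intro set_eqI iffI)
  fix z assume "z \<in> \<Lambda>"
  then obtain m n :: int where mn: "pairing z k = of_int m" "pairing z k' = of_int n"
    by (auto simp: dual elim!: Ints_cases)
  have "z = of_int m * gx + of_int n * gy"
    by (rule pt_pairing[of z, unfolded mn scaleR_conv_of_real of_real_of_int_eq])
  then show "z \<in> gen_lattice gx gy" by (auto simp: gen_lattice_def)
next
  fix z assume "z \<in> gen_lattice gx gy"
  then obtain m n :: int where "z = of_int m * gx + of_int n * gy" by (auto simp: gen_lattice_def)
  then have "z = real_of_int m *\<^sub>R gx + real_of_int n *\<^sub>R gy" by (simp add: scaleR_conv_of_real)
  then show "z \<in> \<Lambda>" by (simp add: dual pairing_pt)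
qed

lemma g_nz: "gx \<noteq> 0" "gy \<noteq> 0"
  using pairing_g by (auto simp: pairing_def)

lemma Re_gx_gy: "Re (gx * cnj gy) = 0"
  using k_orth by (simp add: gx_def gy_def inner_complex_def)

lemma is_rectangular_lattice_dual: "is_rectangular_lattice \<Lambda>"
  unfolding is_rectangular_lattice_def
  using g_nz Re_gx_gy Lam_dual_eq_gen_lattice by blast

lemma continuous_on_pairing [continuous_intros]:
  "continuous_on S h \<Longrightarrow> continuous_on S (\<lambda>x. pairing (h x) c)"
  unfolding pairing_def by (intro continuous_intros)

lemma continuous_on_flat_cmc: "continuous_on S f"
  unfolding flat_cmc_eq[abs_def] by (intro continuous_intros)

lemma descend_flat_cmc:
  assumes "add_subgroup \<Gamma>" "\<Gamma> \<subseteq> \<Lambda>"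
  shows "descend f (torus_pt \<Gamma> z) = f z"
  using assms flat_cmc_eq_iff by (intro descend_torus_pt) auto

lemmas pt_eq_\<Lambda> = torus_pt_eq_iff[OF sub_\<Lambda>]
lemmas descend_\<Lambda> = descend_flat_cmc[OF sub_\<Lambda> order.refl]

text \<open>The torus is the image of the closed unit square in the coordinates; fractional parts
  move every point into it.\<close>

lemma compact_space_torus_dual: "compact_space (torus \<Lambda>)"
proof -
  define Q where "Q = (\<lambda>(x, y). x *\<^sub>R gx + y *\<^sub>R gy) ` ({0..1::real} \<times> {0..1::real})"
  have "compact Q" unfolding Q_def
    by (intro compact_continuous_image compact_Times) (auto intro!: continuous_intros simp: split_def)
  then have "compactin (torus \<Lambda>) (torus_pt \<Lambda> ` Q)"
    using image_compactin[OF _ continuous_map_torus_pt] by (simp add: compactin_euclidean_iff)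
  moreover have "torus_pt \<Lambda> ` Q = range (torus_pt \<Lambda>)"
  proof
    show "range (torus_pt \<Lambda>) \<subseteq> torus_pt \<Lambda> ` Q"
    proof
      fix p assume "p \<in> range (torus_pt \<Lambda>)"
      then obtain z where z: "p = torus_pt \<Lambda> z" by blast
      define w where "w = frac (pairing z k) *\<^sub>R gx + frac (pairing z k') *\<^sub>R gy"
      have "w \<in> Q" unfolding Q_def w_def
        by (intro image_eqI[where x = "(frac (pairing z k), frac (pairing z k'))"]) (auto simp: less_imp_le frac_lt_1)
      moreover have "z - w \<in> \<Lambda>"
        by (simp add: dual pairing_linear w_def pairing_g frac_def)
      then have "p = torus_pt \<Lambda> w"
        using sub_\<Lambda> by (simp add: z torus_pt_eq_iff)
      ultimately show "p \<in> torus_pt \<Lambda> ` Q" by blast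
    qed
  qed auto
  ultimately show ?thesis by (simp add: compact_space_def)
qed

text \<open>A continuous injection of a compact space into a Hausdorff space is closed. Injectivity
  is the statement that \<Lambda> contains all periods.\<close>

lemma embedding_flat_cmc:
  "embedding_map (torus \<Lambda>) (top_of_set SU2) (descend f)"
proof -
  let ?T = "torus \<Lambda>" and ?f = "descend f"
  have "continuous_map euclidean (top_of_set SU2) (?f \<circ> torus_pt \<Lambda>)"
    using continuous_on_flat_cmc flat_cmc_in_SU2
    by (auto simp: comp_def descend_\<Lambda> continuous_map_in_subtopology)
  then have cont: "continuous_map ?T (top_of_set SU2) ?f"
    by (rule continuous_compose_quotient_map[OF quotient_map_torus_pt[OF sub_\<Lambda>]])
  have "Hausdorff_space (top_of_set SU2)"
    by (simp add: Hausdorff_space_subtopology)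
  then have "closed_map ?T (top_of_set SU2) ?f"
    using continuous_imp_closed_map[OF cont compact_space_torus_dual] by blast
  moreover have "inj_on ?f (topspace ?T)"
  proof (rule inj_onI)
    fix p q assume "p \<in> topspace ?T" "q \<in> topspace ?T" and e: "?f p = ?f q"
    then obtain z w where zw: "p = torus_pt \<Lambda> z" "q = torus_pt \<Lambda> w"
      by auto
    show "p = q" using e by (simp add: zw descend_\<Lambda> flat_cmc_eq_iff pt_eq_\<Lambda>)
  qed
  ultimately show ?thesis by (rule injective_closed_imp_embedding_map[OF cont])
qed

end

section \<open>Axes and hemispheres\<close>

lemma orthogonal_triple_independent:
  fixes a b c :: "'a :: euclidean_space"
  assumes "a \<bullet> b = 0" "a \<bullet> c = 0" "b \<bullet> c = 0" "a \<noteq> 0" "b \<noteq> 0" "c \<noteq> 0"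
  shows "independent {a, b, c}" "card {a, b, c} = 3"
proof -
  show "independent {a, b, c}"
    using assms by (intro pairwise_orthogonal_independent) (auto simp: pairwise_def orthogonal_def inner_commute)
  have "a \<noteq> b" "a \<noteq> c" "b \<noteq> c" using assms by auto
  then show "card {a, b, c} = 3" by simp
qed

lemma orthogonal_pair_independent:
  fixes a b :: "'a :: euclidean_space"
  assumes "a \<bullet> b = 0" "a \<noteq> 0" "b \<noteq> 0"
  shows "independent {a, b}" "dim (span {a, b}) = 2"
proof -
  show *: "independent {a, b}"
    using assms by (intro pairwise_orthogonal_independent) (auto simp: pairwise_def orthogonal_def inner_commute)
  have "a \<noteq> b" using assms by auto
  then show "dim (span {a, b}) = 2" using * by (simp add: dim_eq_card_independent)
qed

context clifford
begin

definition axis :: "mat2 set" where "axis = SU2 \<inter> span {b1, b2}"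

definition transport :: "complex \<Rightarrow> mat2 \<Rightarrow> mat2" where
  "transport z p = frame lam1 z ** p ** matrix_inv (frame lam2 z)"

lemma orbit_eq: "orbit lam1 lam2 p = range (\<lambda>z. transport z p)"
  by (simp add: orbit_def transport_def)

lemma transport_comb: "transport z (x *\<^sub>R b1 + y *\<^sub>R b2 + u *\<^sub>R d1 + v *\<^sub>R d2) =
    (x * cos (\<alpha> z) - y * sin (\<alpha> z)) *\<^sub>R b1 +
    (x * sin (\<alpha> z) + y * cos (\<alpha> z)) *\<^sub>R b2 +
    (u * cos (\<beta> z) - v * sin (\<beta> z)) *\<^sub>R d1 +
    (u * sin (\<beta> z) + v * cos (\<beta> z)) *\<^sub>R d2"
proof -
  have lin: "transport z (A + B) = transport z A + transport z B" "transport z (r *\<^sub>R A) = r *\<^sub>R transport z A"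
    for A B r
    unfolding transport_def matrix_add_ldistrib matrix_add_distrib_right
    by (simp_all add: mat2_eq_iff matrix_matrix_mult_def sum_2)
      (simp add: scaleR_conv_of_real algebra_simps)
  show ?thesis
    unfolding lin act[folded transport_def] by (simp add: algebra_simps)
qed

lemma b2_nz: "b2 \<noteq> 0"
  using b_inner b_nz by (metis inner_eq_zero_iff)

lemma dim_span_b: "dim (span {b1, b2}) = 2"
  using b_inner b_nz b2_nz by (intro orthogonal_pair_independent) auto

lemma span_b_subset: "span {b1, b2} \<subseteq> span SU2"
  unfolding span_basis by (intro span_mono) auto

lemma geodesic_axis: "geodesic axis"
  unfolding geodesic_subsphere_def axis_def
  using dim_span_b span_b_subset by (intro exI[of _ "span {b1, b2}"]) simp

text \<open>The factor brings \<open>b1\<close> and \<open>b2\<close> to norm sqrt 2, the radius of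
  the sphere, so that \<open>t\<close> is the angle on the great circle.\<close>

definition axis_pt :: "real \<Rightarrow> mat2" where
  "axis_pt t = sqrt (2 / (b1 \<bullet> b1)) *\<^sub>R (cos t *\<^sub>R b1 + sin t *\<^sub>R b2)"

lemma axis_eq: "axis = range axis_pt"
proof (intro set_eqI iffI)
  fix p assume "p \<in> axis"
  then obtain x y where p: "p = x *\<^sub>R b1 + y *\<^sub>R b2" and "p \<bullet> p = 2"
    by (auto simp: axis_def mem_span_pair mem_SU2_iff)
  then have "(x * x + y * y) * (b1 \<bullet> b1) = 2" using inner_comb[of x y 0 0 x y 0 0] by simp
  moreover obtain r t where r: "r \<ge> 0" "x = r * cos t" "y = r * sin t" using polar_coordinates by blast
  have "x * x + y * y = r\<^sup>2 * ((cos t)\<^sup>2 + (sin t)\<^sup>2)" unfolding r by algebra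
  then have "x * x + y * y = r\<^sup>2" by simp
  ultimately have "r\<^sup>2 = 2 / (b1 \<bullet> b1)" using bb_pos by (simp add: eq_divide_eq)
  then have "r = sqrt (2 / (b1 \<bullet> b1))" using r(1) by (metis real_sqrt_unique)
  then show "p \<in> range axis_pt" using r p by (intro image_eqI[of _ _ t]) (auto simp: axis_pt_def algebra_simps)
next
  fix p assume "p \<in> range axis_pt"
  then obtain t where p: "p = axis_pt t" by blast
  have "p \<in> span {b1, b2}"
    unfolding p axis_pt_def by (intro span_scale span_add) (auto intro: span_base)
  moreover have "(r *\<^sub>R (x *\<^sub>R b1 + y *\<^sub>R b2)) \<bullet> (r *\<^sub>R (x *\<^sub>R b1 + y *\<^sub>R b2)) = (r * r) * ((x * x + y * y) * (b1 \<bullet> b1))"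
    for r x y by (simp add: inner_simps inner_basis algebra_simps)
  from this[of "sqrt (2 / (b1 \<bullet> b1))" "cos t" "sin t", folded axis_pt_def p]
  have "p \<bullet> p = 2" using bb_pos by simp
  ultimately show "p \<in> axis" using span_b_subset by (auto simp: axis_def mem_SU2_iff)
qed

lemma transport_axis_pt: "transport z (axis_pt t) = axis_pt (t + \<alpha> z)"
proof -
  define s where "s = sqrt (2 / (b1 \<bullet> b1))"
  have "axis_pt t = (s * cos t) *\<^sub>R b1 + (s * sin t) *\<^sub>R b2 + 0 *\<^sub>R d1 + 0 *\<^sub>R d2" for t
    by (simp add: axis_pt_def s_def algebra_simps)
  then show ?thesis
    by (simp only: transport_comb) (simp add: cos_add sin_add algebra_simps)
qed

lemma orbit_axis:
  assumes "p \<in> axis"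
  shows "orbit lam1 lam2 p = axis"
proof -
  obtain t where p: "p = axis_pt t" using assms by (auto simp: axis_eq)
  have "axis_pt s \<in> range (\<lambda>z. transport z p)" for s
    by (rule image_eqI[of _ _ "((s - t) / (2 * pi)) *\<^sub>R gy"])
      (simp_all add: p transport_axis_pt pairing_linear pairing_g)
  then show ?thesis by (auto simp: orbit_eq axis_eq p transport_axis_pt)
qed

lemma is_axis_axis: "is_axis lam1 lam2 axis"
proof -
  have "axis_pt 0 \<in> axis" by (simp add: axis_eq)
  then show ?thesis
    unfolding is_axis_def using geodesic_axis orbit_axis
    by (metis IntD1 axis_def)
qed

text \<open>Let \<open>p\<close> have components \<open>pb\<close> and \<open>pd\<close> in the two
  planes. If both were nonzero, the two-dimensional space that contains the orbit would contain
  three orthogonal vectors: \<open>pb\<close>, its quarter turn \<open>pb'\<close>, and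
  \<open>pd\<close>. Hence \<open>p\<close> lies in one plane, and its orbit is the great circle
  there.\<close>

lemma is_axis_cases:
  assumes "is_axis lam1 lam2 A"
  shows "A = axis \<or> A = SU2 \<inter> span {d1, d2}"
proof -
  interpret sw: clifford lam1 lam2 k' k d1 d2 b1 b2 by (rule swap)
  obtain p W where p: "p \<in> SU2" "A = orbit lam1 lam2 p" and W: "subspace W" "dim W = 2" "A = SU2 \<inter> W"
    using assms by (auto simp: is_axis_def geodesic_subsphere_def)
  obtain x y u v where xy: "p = x *\<^sub>R b1 + y *\<^sub>R b2 + u *\<^sub>R d1 + v *\<^sub>R d2"
    using p span_basisE by (metis span_base)
  define pb where "pb = x *\<^sub>R b1 + y *\<^sub>R b2"
  define pb' where "pb' = x *\<^sub>R b2 - y *\<^sub>R b1"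
  define pd where "pd = u *\<^sub>R d1 + v *\<^sub>R d2"
  have W_in: "transport z p \<in> W" for z using p(2) W(3) by (auto simp: orbit_eq)
  \<comment> \<open>Half of the period \<open>gy\<close> turns the plane of \<open>b1\<close>,
    \<open>b2\<close> by a half turn and a quarter of it by a quarter turn; the other plane stays
    fixed. Sums and differences of the three orbit points separate the components.\<close>
  have "transport 0 p = pb + pd" "transport ((1/2) *\<^sub>R gy) p = pd - pb" "transport ((1/4) *\<^sub>R gy) p = pb' + pd"
    unfolding xy transport_comb
    by (simp_all add: pairing_linear pairing_g pb_def pb'_def pd_def)
  then have w: "pb + pd \<in> W" "pd - pb \<in> W" "pb' + pd \<in> W" using W_in by metis+
  have pdW: "pd = (1/2) *\<^sub>R ((pb + pd) + (pd - pb))" by (simp add: algebra_simps flip: scaleR_2)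
  have pdW: "pd \<in> W" by (subst pdW, intro subspace_scale subspace_add W w)
  have "pb = (pb + pd) - pd" "pb' = (pb' + pd) - pd" by simp_all
  then have pbW: "pb \<in> W" "pb' \<in> W" using w pdW W(1) by (metis subspace_diff)+
  have pp: "pb \<bullet> pb = (x * x + y * y) * (b1 \<bullet> b1)" "pb' \<bullet> pb' = (x * x + y * y) * (b1 \<bullet> b1)"
    by (simp_all add: pb_def pb'_def inner_simps inner_basis algebra_simps)
  have orth: "pb \<bullet> pb' = 0" "pb \<bullet> pd = 0" "pb' \<bullet> pd = 0"
    by (simp_all add: pb_def pb'_def pd_def inner_simps inner_basis algebra_simps)
  have "pb = 0 \<or> pd = 0"
  proof (rule ccontr)
    assume "\<not> (pb = 0 \<or> pd = 0)"
    then have nz: "pb \<noteq> 0" "pd \<noteq> 0" by auto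
    then have "pb' \<noteq> 0" using pp by (metis inner_eq_zero_iff)
    from orthogonal_triple_independent[OF orth nz(1) this nz(2)]
    have "card {pb, pb', pd} \<le> dim W" using pbW pdW
      by (intro independent_card_le_dim) auto
    then show False using orthogonal_triple_independent(2)[OF orth nz(1) \<open>pb' \<noteq> 0\<close> nz(2)] W(2) by simp
  qed
  then show ?thesis
  proof
    assume "pb = 0"
    then have "p = pd" using xy by (simp add: pb_def pd_def)
    then have "p \<in> sw.axis" using p(1) by (auto simp: sw.axis_def mem_span_pair pd_def)
    then show ?thesis using p(2) sw.orbit_axis by (simp add: sw.axis_def)
  next
    assume "pd = 0"
    then have "p = pb" using xy by (simp add: pb_def pd_def add.assoc)
    then have "p \<in> axis" using p(1) by (auto simp: axis_def mem_span_pair pb_def)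
    then show ?thesis using p(2) orbit_axis by simp
  qed
qed

lemma axis_neq: "axis \<noteq> SU2 \<inter> span {d1, d2}"
proof -
  have "axis_pt 0 \<notin> span {d1, d2}"
  proof
    assume "axis_pt 0 \<in> span {d1, d2}"
    then obtain u v where "axis_pt 0 = u *\<^sub>R d1 + v *\<^sub>R d2" by (auto simp: mem_span_pair)
    then have "axis_pt 0 \<bullet> b1 = 0" by (simp add: inner_simps inner_basis)
    then show False using bb_pos by (simp add: axis_pt_def)
  qed
  moreover have "axis_pt 0 \<in> axis" by (simp add: axis_eq)
  ultimately show ?thesis by blast
qed

lemma span_axis: "span axis = span {b1, b2}"
proof
  show "span axis \<subseteq> span {b1, b2}" by (rule span_minimal) (auto simp: axis_def)
  define s where "s = sqrt (2 / (b1 \<bullet> b1))"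
  have s: "s > 0" using bb_pos by (simp add: s_def)
  have "axis_pt 0 \<in> axis" "axis_pt (pi / 2) \<in> axis" by (simp_all add: axis_eq)
  then have "(1 / s) *\<^sub>R axis_pt 0 \<in> span axis" "(1 / s) *\<^sub>R axis_pt (pi / 2) \<in> span axis"
    by (auto intro: span_scale span_base)
  then have "b1 \<in> span axis" "b2 \<in> span axis" using s by (simp_all add: axis_pt_def flip: s_def)
  then show "span {b1, b2} \<subseteq> span axis" by (intro span_minimal) auto
qed

text \<open>A normal \<open>n\<close> of the axis lies in the plane of \<open>d1\<close>,
  \<open>d2\<close> and thus has an angle t there. The point \<open>f z\<close> is in the hemisphere
  exactly if its component in that plane points in the direction of \<open>n\<close>, that is, if
  the angle of this component is t modulo a full turn.\<close>

lemma hemisphere_axis: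
  assumes "hemisphere axis H"
  obtains x0 where "\<And>z. f z \<in> H \<longleftrightarrow> pairing z k - x0 \<in> \<int>"
proof -
  obtain S n W where S: "axis \<subseteq> S" "n \<in> span S" "n \<noteq> 0" "\<forall>a\<in>axis. a \<bullet> n = 0" "H = {p \<in> S. p \<bullet> n > 0}"
    and W: "subspace W" "W \<subseteq> span SU2" "dim W = 3" "S = SU2 \<inter> W"
    using assms unfolding hemisphere_def geodesic_subsphere_def by auto
  have nW: "n \<in> W" using S(2) W span_minimal[of S W] by blast
  have "span axis \<subseteq> W" using S(1) W by (intro span_minimal) auto
  then have bW: "b1 \<in> W" "b2 \<in> W" by (auto simp: span_axis intro: span_base)
  have "a \<bullet> n = 0" if "a \<in> span axis" for a
    using orthogonal_to_span[OF that, of n] S(4) by (simp add: orthogonal_def inner_commute)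
  then have nb: "b1 \<bullet> n = 0" "b2 \<bullet> n = 0" by (auto simp: span_axis intro: span_base)
  obtain x y u v where xy: "n = x *\<^sub>R b1 + y *\<^sub>R b2 + u *\<^sub>R d1 + v *\<^sub>R d2"
    using nW W(2) span_basisE by blast
  have "x = 0" "y = 0" using nb bb_pos by (auto simp: xy inner_simps inner_basis)
  obtain r t where r: "r \<ge> 0" "u = r * cos t" "v = r * sin t" using polar_coordinates by blast
  have n: "n = r *\<^sub>R (cos t *\<^sub>R d1 + sin t *\<^sub>R d2)"
    using xy r \<open>x = 0\<close> \<open>y = 0\<close> by (simp add: algebra_simps)
  have "r > 0" using r(1) S(3) n by (cases "r = 0") auto
  \<comment> \<open>\<open>n'\<close> is orthogonal to \<open>W\<close>. A vanishing product with
    \<open>n'\<close> puts \<open>f z\<close> on the great sphere, and a positive product with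
    \<open>n\<close> selects the half.\<close>
  define n' where "n' = cos t *\<^sub>R d2 - sin t *\<^sub>R d1"
  have fn: "f z \<bullet> n = r * (d1 \<bullet> d1) * cos (\<beta> z - t)"
    "f z \<bullet> n' = (d1 \<bullet> d1) * sin (\<beta> z - t)" for z
    by (simp_all add: n n'_def inner_simps inner_flat_cmc cos_diff sin_diff algebra_simps)
  have ind: "independent {b1, b2, n}" "card {b1, b2, n} = 3"
    using orthogonal_triple_independent[OF b_inner(2) nb b_nz b2_nz S(3)] .
  have "W \<subseteq> span {b1, b2, n}"
    using bW nW ind W(3) by (intro card_ge_dim_independent) auto
  moreover have "w \<bullet> n' = 0" if "w \<in> {b1, b2, n}" for w
    using that by (auto simp: n'_def n inner_simps inner_basis)
  then have "w \<bullet> n' = 0" if "w \<in> span {b1, b2, n}" for w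
    using orthogonal_to_span[OF that, of n'] by (simp add: orthogonal_def inner_commute)
  ultimately have Wn': "w \<bullet> n' = 0" if "w \<in> W" for w using that by blast
  have "f z \<in> H \<longleftrightarrow> pairing z k - t / (2 * pi) \<in> \<int>" for z
  proof
    assume "f z \<in> H"
    then have "f z \<in> W" "f z \<bullet> n > 0" using S W by auto
    then have "(d1 \<bullet> d1) * sin (\<beta> z - t) = 0" "r * (d1 \<bullet> d1) * cos (\<beta> z - t) > 0"
      using Wn' unfolding fn by (metis fn(2), blast)
    then have "sin (\<beta> z - t) = 0" "cos (\<beta> z - t) > 0"
      using dd_pos zero_less_mult_pos[OF _ mult_pos_pos[OF \<open>r > 0\<close> dd_pos]] by (metis mult_eq_0_iff less_irrefl, blast)
    then obtain m :: int where "\<beta> z - t = 2 * pi * of_int m" using sin_zero_cos_pos by blast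
    then have "pairing z k - t / (2 * pi) = of_int m" by (simp add: field_simps)
    then show "pairing z k - t / (2 * pi) \<in> \<int>" by simp
  next
    assume "pairing z k - t / (2 * pi) \<in> \<int>"
    then have "cos (\<beta> z) = cos (2 * pi * (t / (2 * pi)))"
      "sin (\<beta> z) = sin (2 * pi * (t / (2 * pi)))"
      by (simp_all only: sincos_2pi_eq_iff[symmetric])
    then have cs: "cos (\<beta> z) = cos t" "sin (\<beta> z) = sin t" by simp_all
    have e: "f z = cos (\<alpha> z) *\<^sub>R b1 + sin (\<alpha> z) *\<^sub>R b2 + (1 / r) *\<^sub>R n"
      using \<open>r > 0\<close> by (simp add: flat_cmc_eq cs n add.assoc)
    have "f z \<in> W" unfolding e by (intro subspace_add subspace_scale W bW nW)
    moreover have "f z \<bullet> n > 0"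
      using \<open>r > 0\<close> dd_pos unfolding fn cos_diff cs by (simp flip: power2_eq_square)
    ultimately show "f z \<in> H" using S W flat_cmc_in_SU2 by simp
  qed
  then show ?thesis by (rule that)
qed

end

section \<open>Double points\<close>

text \<open>Bezout is used twice, for \<open>q0\<close> and \<open>gcd q q'\<close> and then for
  \<open>q\<close> and \<open>q'\<close>. It makes every residue the label of a coset, so that the
  covering has all \<open>q0\<close> sheets.\<close>

lemma bezout_triple:
  fixes q0 q q' :: int
  assumes "gcd q0 (gcd q q') = 1"
  shows "\<exists>m n. (q * m + q' * n) mod q0 = r mod q0"
proof -
  obtain u v where uv: "u * q0 + v * gcd q q' = 1" using bezout_int[of q0 "gcd q q'"] assms by auto
  obtain s t where st: "s * q + t * q' = gcd q q'" using bezout_int[of q q'] by auto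
  have "r - (q * (r * v * s) + q' * (r * v * t)) = r * (u * q0 + v * gcd q q') - r * v * (s * q + t * q')"
    unfolding uv by (simp add: algebra_simps)
  also have "\<dots> = q0 * (r * u)" unfolding st by (simp add: algebra_simps)
  finally have "q0 dvd r - (q * (r * v * s) + q' * (r * v * t))" by simp
  then have "(q * (r * v * s) + q' * (r * v * t)) mod q0 = r mod q0" by (metis mod_eq_dvd_iff)
  then show ?thesis by blast
qed

text \<open>\<Gamma> is the kernel of the homomorphism (m, n) -> q m + q' n from the dual lattice to
  the integers modulo \<open>q0\<close>; the gcd condition makes this homomorphism onto.\<close>

locale clifford_cover = clifford +
  fixes \<Gamma> :: "complex set" and q0 q q' :: int
  assumes q0_pos: "q0 > 0" and coprime_q: "gcd q0 (gcd q q') = 1"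
    and \<Gamma>_eq: "\<Gamma> = {z. \<exists>m n :: int. pairing z k = of_int m \<and> pairing z k' = of_int n \<and> q0 dvd q * m + q' * n}"
begin

text \<open>The number of profile curves with respect to \<open>axis\<close>, and how often each of them is wrapped.\<close>

definition g :: int where "g = gcd q0 q'"
definition w :: int where "w = q0 div g"

lemma g_pos: "g > 0" and w_pos: "w > 0" and q0_eq: "q0 = w * g" and coprime_w: "coprime w (q' div g)"
    and q'_eq: "q' = (q' div g) * g"
proof -
  have "g \<noteq> 0" using q0_pos by (simp add: g_def)
  then show g: "g > 0" using gcd_ge_0_int[of q0 q'] unfolding g_def by linarith
  have "g dvd q0" "g dvd q'" unfolding g_def by (rule gcd_dvd1, rule gcd_dvd2)
  then show q0: "q0 = w * g" and "q' = (q' div g) * g"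
    unfolding w_def by (simp_all only: dvd_div_mult_self)
  show "w > 0" unfolding w_def using \<open>g dvd q0\<close> g q0_pos by (simp add: pos_imp_zdiv_pos_iff zdvd_imp_le)
  show "coprime w (q' div g)" unfolding w_def g_def by (rule div_gcd_coprime) (use q0_pos in linarith)
qed

lemma coprime_g_q: "coprime g q"
proof -
  have "gcd g q = 1" using coprime_q by (simp add: g_def gcd.assoc gcd.commute[of q])
  then show ?thesis by (simp add: coprime_iff_gcd_eq_1)
qed

text \<open>After division by \<open>g\<close> the factor \<open>q' div g\<close> is invertible
  modulo \<open>w\<close>. This makes \<open>w\<close> the shortest period of \<Gamma> in the
  direction of \<open>gy\<close>.\<close>

lemma dvd_q': "q0 dvd q' * n \<longleftrightarrow> w dvd n"
proof -
  have "q' * n = ((q' div g) * g) * n" using q'_eq by (rule arg_cong)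
  also have "\<dots> = ((q' div g) * n) * g" by (simp only: mult_ac)
  finally have "q0 dvd q' * n \<longleftrightarrow> w * g dvd ((q' div g) * n) * g"
    using q0_eq by (rule arg_cong2[of _ _ _ _ "(dvd)", rotated])
  also have "\<dots> \<longleftrightarrow> w dvd (q' div g) * n" using g_pos by simp
  also have "\<dots> \<longleftrightarrow> w dvd n" using coprime_w by (rule coprime_dvd_mult_right_iff)
  finally show ?thesis .
qed

text \<open>This identifies the \<open>k\<close> coordinates of elements of \<Gamma>. They are
  divisible by \<open>g\<close>, which divides \<open>q0\<close> and \<open>q'\<close> and is
  coprime to \<open>q\<close>; Bezout for \<open>q0\<close> and \<open>q'\<close> gives the
  converse.\<close>

lemma dvd_g: "(\<exists>n. q0 dvd q * m + q' * n) \<longleftrightarrow> g dvd m"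
proof
  assume "\<exists>n. q0 dvd q * m + q' * n"
  then obtain n where "q0 dvd q * m + q' * n" by blast
  then have "g dvd q * m + q' * n" unfolding g_def by (meson dvd_trans gcd_dvd1)
  moreover have "g dvd q' * n" unfolding g_def by simp
  ultimately have "g dvd q * m" by (simp add: dvd_add_left_iff)
  then show "g dvd m" using coprime_g_q by (simp add: coprime_dvd_mult_right_iff)
next
  assume "g dvd m"
  then obtain a where a: "m = g * a" by blast
  obtain u v where uv: "u * q0 + v * q' = g" using bezout_int[of q0 q'] by (auto simp: g_def)
  \<comment> \<open>The Bezout identity multiplied by \<open>q * a\<close> shows that
    \<open>n = - (q * a * v)\<close> cancels everything but a multiple of \<open>q0\<close>.\<close>
  have "q * m + q' * (- (q * a * v)) = q * a * (g - v * q')" by (simp add: a algebra_simps)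
  also have "\<dots> = q0 * (q * a * u)" unfolding uv[symmetric] by simp
  finally show "\<exists>n. q0 dvd q * m + q' * n" by (metis dvd_triv_left)
qed

lemma \<Gamma>_subset: "\<Gamma> \<subseteq> \<Lambda>"
  by (auto simp: \<Gamma>_eq dual)

lemma sub_\<Gamma>: "add_subgroup \<Gamma>"
  unfolding add_subgroup_def
proof (intro conjI ballI)
  show "0 \<in> \<Gamma>" unfolding \<Gamma>_eq by (auto simp: pairing_linear intro!: exI[of _ 0])
  fix z z' assume "z \<in> \<Gamma>" "z' \<in> \<Gamma>"
  then obtain m n m' n' where
    "pairing z k = of_int m" "pairing z k' = of_int n" "q0 dvd q * m + q' * n"
    "pairing z' k = of_int m'" "pairing z' k' = of_int n'" "q0 dvd q * m' + q' * n'"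
    unfolding \<Gamma>_eq by blast
  note * = this
  have "q0 dvd (q * m + q' * n) - (q * m' + q' * n')" using * by (intro dvd_diff)
  then have "q0 dvd q * (m - m') + q' * (n - n')" by (simp add: algebra_simps)
  moreover have "pairing (z - z') k = of_int (m - m')" "pairing (z - z') k' = of_int (n - n')"
    by (simp_all add: pairing_linear *)
  ultimately show "z - z' \<in> \<Gamma>" unfolding \<Gamma>_eq by blast
qed

lemmas pt_eq_\<Gamma> = torus_pt_eq_iff[OF sub_\<Gamma>]
lemmas descend_\<Gamma> = descend_flat_cmc[OF sub_\<Gamma> \<Gamma>_subset]

lemma pt_in_\<Gamma>: "of_int m *\<^sub>R gx + of_int n *\<^sub>R gy \<in> \<Gamma> \<longleftrightarrow> q0 dvd q * m + q' * n"
  unfolding \<Gamma>_eq by (auto simp: pairing_pt)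

lemma vertical_in_\<Gamma>: "r *\<^sub>R gy \<in> \<Gamma> \<longleftrightarrow> (\<exists>n. r = of_int (w * n))"
proof
  assume "r *\<^sub>R gy \<in> \<Gamma>"
  then obtain n where "r = of_int n" "q0 dvd q' * n"
    unfolding \<Gamma>_eq by (auto simp: pairing_linear pairing_g)
  then show "\<exists>n. r = of_int (w * n)" using dvd_q' by (auto simp: dvd_def)
next
  assume "\<exists>n. r = of_int (w * n)"
  then obtain n where "r = of_int (w * n)" by blast
  then show "r *\<^sub>R gy \<in> \<Gamma>" using pt_in_\<Gamma>[of 0 "w * n"] dvd_q'[of "w * n"] by simp
qed

lemma pairing_\<Gamma>:
  assumes "z \<in> \<Gamma>"
  obtains a :: int where "pairing z k = of_int (g * a)"
proof -
  obtain m n where m: "pairing z k = of_int m" "q0 dvd q * m + q' * n" using assms unfolding \<Gamma>_eq by blast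
  then have "g dvd m" using dvd_g by blast
  then obtain a where "m = g * a" by (rule dvdE)
  then show ?thesis using m(1) that[of a] by simp
qed

lemma exists_\<Gamma>: "\<exists>z\<in>\<Gamma>. pairing z k = of_int (g * a)"
proof -
  obtain n where "q0 dvd q * (g * a) + q' * n" using dvd_g[of "g * a"] by auto
  then show ?thesis using pt_in_\<Gamma>[of "g * a" n]
    by (intro bexI[of _ "of_int (g * a) *\<^sub>R gx + of_int n *\<^sub>R gy"]) (simp_all only: pairing_pt)
qed

lemma cosets:
  shows "finite (torus_pt \<Gamma> ` \<Lambda>)" "card (torus_pt \<Gamma> ` \<Lambda>) = nat q0"
proof -
  \<comment> \<open>On the dual lattice the floors are the integer coordinates themselves, so
    \<open>c\<close> is there the homomorphism with kernel \<Gamma>.\<close>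
  define c where "c z = (q * \<lfloor>pairing z k\<rfloor> + q' * \<lfloor>pairing z k'\<rfloor>) mod q0" for z
  have eq: "torus_pt \<Gamma> x = torus_pt \<Gamma> y \<longleftrightarrow> c x = c y"
    if "x \<in> \<Lambda>" "y \<in> \<Lambda>" for x y
  proof -
    obtain m n m' n' where *: "pairing x k = of_int m" "pairing x k' = of_int n"
        "pairing y k = of_int m'" "pairing y k' = of_int n'"
      using \<open>x \<in> _\<close> \<open>y \<in> _\<close> by (auto simp: dual elim!: Ints_cases)
    have "x - y \<in> \<Gamma> \<longleftrightarrow> q0 dvd q * (m - m') + q' * (n - n')"
    proof -
      have "x - y \<in> \<Gamma> \<longleftrightarrow> (\<exists>a b. m - m' = a \<and> n - n' = b \<and> q0 dvd q * a + q' * b)"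
        unfolding \<Gamma>_eq by (simp only: mem_Collect_eq pairing_linear * of_int_diff[symmetric] of_int_eq_iff)
      then show ?thesis by blast
    qed
    also have "q * (m - m') + q' * (n - n') = (q * m + q' * n) - (q * m' + q' * n')"
      by (simp add: algebra_simps)
    finally show ?thesis
      by (simp add: pt_eq_\<Gamma> c_def * mod_eq_dvd_iff)
  qed
  have "c ` \<Lambda> = {0..<q0}"
  proof (intro set_eqI iffI)
    fix r assume "r \<in> {0..<q0}"
    then obtain m n where "(q * m + q' * n) mod q0 = r" using bezout_triple[OF coprime_q, of r] by auto
    then have "c (of_int m *\<^sub>R gx + of_int n *\<^sub>R gy) = r" by (simp add: c_def pairing_pt)
    moreover have "of_int m *\<^sub>R gx + of_int n *\<^sub>R gy \<in> \<Lambda>" by (simp add: dual pairing_pt)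
    ultimately show "r \<in> c ` \<Lambda>" by blast
  qed (use q0_pos in \<open>auto simp: c_def\<close>)
  then show "finite (torus_pt \<Gamma> ` \<Lambda>)" "card (torus_pt \<Gamma> ` \<Lambda>) = nat q0"
    using card_image_eq_card_image[of "\<Lambda>" "torus_pt \<Gamma>" c, OF eq] by simp_all
qed

text \<open>The bound is chosen so that, by Cauchy-Schwarz, both pairings have absolute value less
  than 1; being integers, they vanish.\<close>

lemma discrete_dual: "\<exists>eps>0. \<forall>z\<in>\<Lambda>. norm z < eps \<longrightarrow> z = 0"
proof (intro exI conjI ballI impI)
  show "0 < 1 / (2 * (norm k + norm k'))" using k_nz by (simp add: add_pos_pos)
  fix z assume z: "z \<in> \<Lambda>" "norm z < 1 / (2 * (norm k + norm k'))"
  have "norm z * (2 * (norm k + norm k')) < 1"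
    using z(2) k_nz by (simp add: pos_less_divide_eq add_pos_pos)
  then have lt: "2 * (norm z * norm k) + 2 * (norm z * norm k') < 1" by (simp add: algebra_simps)
  have pos: "0 \<le> norm z * norm k" "0 \<le> norm z * norm k'" by simp_all
  have "\<bar>pairing z k\<bar> \<le> 2 * (norm z * norm k)" "\<bar>pairing z k'\<bar> \<le> 2 * (norm z * norm k')"
    using Cauchy_Schwarz_ineq2[of z k] Cauchy_Schwarz_ineq2[of z k'] by (simp_all add: pairing_eq_inner)
  then have "\<bar>pairing z k\<bar> < 1" "\<bar>pairing z k'\<bar> < 1" using lt pos by linarith+
  moreover have "pairing z k \<in> \<int>" "pairing z k' \<in> \<int>" using z(1) by (auto simp: dual)
  ultimately have "pairing z k = 0" "pairing z k' = 0" using Ints_nonzero_abs_less1 by auto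
  then show "z = 0" using pt_pairing[of z] by (metis add_0 scaleR_zero_left)
qed

lemma descend_torus_pt_\<Lambda>: "descend (torus_pt \<Lambda>) (torus_pt \<Gamma> z) = torus_pt \<Lambda> z"
  using \<Gamma>_subset by (intro descend_torus_pt sub_\<Gamma>) (auto simp only: pt_eq_\<Lambda>)

lemma sheeted_covering_\<Gamma>: "sheeted_covering (nat q0) (torus \<Gamma>) (torus \<Lambda>)
    (descend (torus_pt \<Lambda>))"
proof -
  obtain eps where eps: "eps > 0" "\<And>z. z \<in> \<Lambda> \<Longrightarrow> norm z < eps \<Longrightarrow> z = 0"
    using discrete_dual by blast
  show ?thesis
  proof (rule sheeted_covering_quotient[where L = UNIV and eps = eps])
    show "descend (torus_pt \<Lambda>) (torus_pt \<Gamma> z) = torus_pt \<Lambda> z" for z by (rule descend_torus_pt_\<Lambda>)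
    show "torus_pt \<Gamma> x = torus_pt \<Gamma> y \<longleftrightarrow> x - y \<in> \<Gamma>"
      "torus_pt \<Lambda> x = torus_pt \<Lambda> y \<longleftrightarrow> x - y \<in> \<Lambda>" for x y
      using torus_pt_eq_iff sub_\<Gamma> sub_\<Lambda> by auto
  qed (use eps cosets sub_\<Gamma> sub_\<Lambda> \<Gamma>_subset in
    \<open>simp_all add: continuous_map_torus_pt open_map_torus_pt\<close>)
qed

text \<open>A triangular basis: \<open>a\<close> generates the elements whose \<open>k\<close>
  coordinate is 0, and \<open>b\<close> has \<open>k\<close> coordinate \<open>g\<close>, which
  generates all \<open>k\<close> coordinates that occur. Any element is reduced first by multiples
  of \<open>b\<close> and then by multiples of \<open>a\<close>.\<close>

lemma is_lattice_\<Gamma>: "is_lattice \<Gamma>"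
proof -
  obtain y where y: "q0 dvd q * g + q' * y" using dvd_g[of g] by auto
  define a where "a = of_int w *\<^sub>R gy"
  define b where "b = of_int g *\<^sub>R gx + of_int y *\<^sub>R gy"
  have "Im (gy * cnj gx) \<noteq> 0"
  proof
    assume "Im (gy * cnj gx) = 0"
    moreover have "Re (gy * cnj gx) = 0" using Re_gx_gy by (simp add: mult.commute)
    ultimately have "gy * cnj gx = 0" by (simp add: complex_eq_iff)
    then show False using g_nz by simp
  qed
  moreover have "Im (a * cnj b) = of_int w * of_int g * Im (gy * cnj gx)"
    by (simp add: a_def b_def algebra_simps)
  ultimately have "Im (a * cnj b) \<noteq> 0" using w_pos g_pos by simp
  moreover have "\<Gamma> = gen_lattice a b"
  proof (intro set_eqI iffI)
    fix z assume "z \<in> \<Gamma>"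
    then obtain m n where z: "pairing z k = of_int m" "pairing z k' = of_int n" "q0 dvd q * m + q' * n"
      unfolding \<Gamma>_eq by blast
    then obtain s where s: "m = g * s" using dvd_g by (metis dvd_def)
    have "q0 dvd (q * m + q' * n) - (q * g + q' * y) * s" using z(3) y by (intro dvd_diff dvd_mult2)
    then have "q0 dvd q' * (n - y * s)" by (simp add: s algebra_simps)
    then obtain t where t: "n - y * s = w * t" using dvd_q' by (auto simp: dvd_def)
    then have n: "n = w * t + y * s" by simp
    have "z = of_int m *\<^sub>R gx + of_int n *\<^sub>R gy" by (rule pt_pairing[of z, unfolded z(1,2)])
    also have "\<dots> = of_int t * a + of_int s * b"
      by (simp add: a_def b_def s n scaleR_conv_of_real algebra_simps)
    finally show "z \<in> gen_lattice a b" by (auto simp: gen_lattice_def)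
  next
    fix z assume "z \<in> gen_lattice a b"
    then obtain t s where "z = of_int t * a + of_int s * b" by (auto simp: gen_lattice_def)
    then have z: "z = of_int (g * s) *\<^sub>R gx + of_int (w * t + y * s) *\<^sub>R gy"
      by (simp add: a_def b_def scaleR_conv_of_real algebra_simps)
    have "q0 dvd (q * g + q' * y) * s + q' * (w * t)" by (intro dvd_add dvd_mult2[OF y]) (simp add: dvd_q')
    then show "z \<in> \<Gamma>" unfolding z pt_in_\<Gamma> by (simp add: algebra_simps)
  qed
  ultimately show ?thesis unfolding is_lattice_def by blast
qed

end

section \<open>Profile curves\<close>

lemma openin_torus_pt_image:
  "add_subgroup \<Gamma> \<Longrightarrow> open U \<Longrightarrow> openin (torus \<Gamma>) (torus_pt \<Gamma> ` U)"
  using open_map_torus_pt by (simp add: open_map_def)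

context clifford
begin

definition line :: "real \<Rightarrow> complex set" where "line x = {z. pairing z k = x}"

lemma line_eq: "line x = range (\<lambda>y. x *\<^sub>R gx + y *\<^sub>R gy)"
proof (intro set_eqI iffI)
  fix z assume "z \<in> line x"
  then have "pairing z k = x" by (simp add: line_def)
  from pt_pairing[of z, unfolded this] show "z \<in> range (\<lambda>y. x *\<^sub>R gx + y *\<^sub>R gy)" by blast
qed (auto simp: line_def pairing_pt)

lemma connected_line: "connected (line x)"
  unfolding line_eq by (intro connected_continuous_image continuous_intros connected_UNIV)

lemma open_strip: "open {z. \<bar>pairing z k - y\<bar> < r}"
  by (intro open_Collect_less continuous_intros)

lemma small_Ints: "\<bar>r\<bar> < 1 / 2 \<Longrightarrow> r \<in> \<int> \<Longrightarrow> r = 0" for r :: real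
  using Ints_nonzero_abs_less1[of r] by linarith

lemma continuous_map_line:
  "continuous_map (top_of_set (line x)) (subtopology (torus \<Delta>) (torus_pt \<Delta> ` line x)) (torus_pt \<Delta>)"
  using continuous_map_from_subtopology[OF continuous_map_torus_pt]
  by (auto simp: continuous_map_in_subtopology)

text \<open>An open map need not stay open on a line. Here an open set is cut down to the strip of
  half-width 1/2 about the line: elements of \<Delta> change the \<open>k\<close> coordinate by
  integers, so within the strip only points of the line itself are equivalent to points of the
  line.\<close>

lemma open_map_line:
  assumes \<Delta>: "add_subgroup \<Delta>" "\<Delta> \<subseteq> \<Lambda>"
  shows "open_map (top_of_set (line x)) (subtopology (torus \<Delta>) (torus_pt \<Delta> ` line x)) (torus_pt \<Delta>)"
  unfolding open_map_def
proof (intro allI impI)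
  fix U assume "openin (top_of_set (line x)) U"
  then obtain V where V: "open V" "U = line x \<inter> V" by (auto simp: openin_open)
  let ?S = "V \<inter> {z. \<bar>pairing z k - x\<bar> < 1 / 2}"
  have "openin (torus \<Delta>) (torus_pt \<Delta> ` ?S)"
    by (rule openin_torus_pt_image[OF \<Delta>(1) open_Int[OF V(1) open_strip]])
  moreover have "torus_pt \<Delta> ` U = torus_pt \<Delta> ` ?S \<inter> torus_pt \<Delta> ` line x"
  proof (intro set_eqI iffI)
    fix p assume "p \<in> torus_pt \<Delta> ` U"
    then obtain z where "p = torus_pt \<Delta> z" "z \<in> V" "z \<in> line x" unfolding V(2) by blast
    then show "p \<in> torus_pt \<Delta> ` ?S \<inter> torus_pt \<Delta> ` line x" by (simp add: line_def)
  next
    fix p assume "p \<in> torus_pt \<Delta> ` ?S \<inter> torus_pt \<Delta> ` line x"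
    then obtain z z' where z: "p = torus_pt \<Delta> z" "z \<in> ?S" "p = torus_pt \<Delta> z'" "z' \<in> line x" by blast
    then have "z - z' \<in> \<Lambda>" using \<Delta> torus_pt_eq_iff[OF \<Delta>(1)] by blast
    then have "pairing z k - x \<in> \<int>" using z(4) by (auto simp: dual pairing_linear line_def)
    then have "pairing z k - x = 0" using z(2) by (intro small_Ints) auto
    then have "z \<in> U" using z(2) unfolding V(2) by (simp add: line_def)
    then show "p \<in> torus_pt \<Delta> ` U" using z(1) by blast
  qed
  ultimately show "openin (subtopology (torus \<Delta>) (torus_pt \<Delta> ` line x)) (torus_pt \<Delta> ` U)"
    by (auto simp: openin_subtopology)
qed

text \<open>On the quotient by the full dual lattice \<open>f\<close> is an embedding, which reduces
  the claim to \<open>open_map_line\<close> for that lattice.\<close>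

lemma open_map_flat_cmc_line:
  "open_map (top_of_set (line x)) (top_of_set (f ` line x)) f"
  unfolding open_map_def
proof (intro allI impI)
  let ?\<Delta> = "\<Lambda>" and ?f = "f"
  let ?T = "torus ?\<Delta>" and ?q = "torus_pt ?\<Delta>"
  fix U assume U: "openin (top_of_set (line x)) U"
  have "openin (subtopology ?T (?q ` line x)) (?q ` U)"
    using open_map_line[OF sub_\<Lambda> order.refl] U unfolding open_map_def by blast
  then obtain V where V: "openin ?T V" "?q ` U = V \<inter> ?q ` line x" by (auto simp: openin_subtopology)
  have "homeomorphic_map ?T (subtopology (top_of_set SU2) (descend ?f ` topspace ?T)) (descend ?f)"
    using embedding_flat_cmc by (simp add: embedding_map_def)
  then have "open_map ?T (subtopology (top_of_set SU2) (descend ?f ` topspace ?T)) (descend ?f)"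
    by (rule homeomorphic_imp_open_map)
  then have "openin (subtopology (top_of_set SU2) (descend ?f ` topspace ?T)) (descend ?f ` V)"
    using V(1) unfolding open_map_def by blast
  then obtain W where W: "open W" "descend ?f ` V = W \<inter> SU2 \<inter> range ?f"
    by (auto simp: openin_subtopology image_image descend_\<Lambda>)
  have "?f ` U = ?f ` line x \<inter> W"
  proof (intro set_eqI iffI)
    fix p assume "p \<in> ?f ` U"
    then obtain u where u: "u \<in> U" "p = ?f u" by blast
    then have "?q u \<in> V" using V(2) by blast
    then have "p \<in> descend ?f ` V" using u descend_\<Lambda> by (metis image_eqI)
    moreover have "u \<in> line x" using u(1) openin_subset[OF U] by auto
    ultimately show "p \<in> ?f ` line x \<inter> W" using W(2) u by blast
  next
    fix p assume p: "p \<in> ?f ` line x \<inter> W"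
    then obtain v where v: "v \<in> line x" "p = ?f v" by blast
    then have "p \<in> descend ?f ` V" using p W(2) flat_cmc_in_SU2 by blast
    then obtain P where P: "P \<in> V" "p = descend ?f P" by blast
    then obtain z where z: "P = ?q z" using openin_subset[OF V(1)] by auto
    then have "?f z = ?f v" using P v by (simp only: descend_\<Lambda>)
    then have "z - v \<in> ?\<Delta>" by (simp only: flat_cmc_eq_iff)
    then have "?q z = ?q v" by (simp add: pt_eq_\<Lambda>)
    then have "?q v \<in> ?q ` U" using P z V(2) v by auto
    then obtain u where u: "u \<in> U" "?q v = ?q u" by blast
    then have "?f v = ?f u" by (simp add: pt_eq_\<Lambda> flat_cmc_eq_iff)
    then show "p \<in> ?f ` U" using u v by blast
  qed
  then show "openin (top_of_set (?f ` line x)) (?f ` U)" using W(1) by (auto simp: openin_open)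
qed

lemma flat_cmc_line:
  assumes "x - x' \<in> \<int>"
  shows "f ` line x = f ` line x'"
proof -
  have "f ` line x \<subseteq> f ` line x'" if xx: "x - x' \<in> \<int>" for x x'
  proof
    fix p assume "p \<in> f ` line x"
    then obtain y where p: "p = f (x *\<^sub>R gx + y *\<^sub>R gy)" by (auto simp: line_eq)
    have "p = f (x' *\<^sub>R gx + y *\<^sub>R gy)"
      unfolding p flat_cmc_eq_iff using xx by (simp add: dual pairing_linear pairing_g)
    then show "p \<in> f ` line x'" by (auto simp: line_eq)
  qed
  from this[of x x'] this[of x' x] show ?thesis using assms Ints_minus[OF assms] by auto
qed

text \<open>Along a line the component in the plane of \<open>d1\<close>, \<open>d2\<close> is the
  constant \<open>c\<close>, while the other component runs through the circle of radius
  \<open>norm b1\<close>, a rescaled copy of the axis.\<close>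

lemma is_circle_line: "is_circle (f ` line x)"
proof -
  define c where "c = cos (2 * pi * x) *\<^sub>R d1 + sin (2 * pi * x) *\<^sub>R d2"
  define s where "s = sqrt (2 / (b1 \<bullet> b1))"
  have s: "s > 0" "s * s = 2 / (b1 \<bullet> b1)" using bb_pos by (simp_all add: s_def)
  have f: "f (x *\<^sub>R gx + y *\<^sub>R gy) = c + (1 / s) *\<^sub>R axis_pt (2 * pi * y)" for y
    using s(1) by (simp add: flat_cmc_eq pairing_pt c_def axis_pt_def flip: s_def)
  have "f ` line x = {c + p | p. p \<in> span {b1, b2} \<and> norm p = norm b1}"
  proof (intro set_eqI iffI)
    fix p assume "p \<in> f ` line x"
    then obtain y where "p = f (x *\<^sub>R gx + y *\<^sub>R gy)" by (auto simp: line_eq)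
    then have p: "p = c + (1 / s) *\<^sub>R axis_pt (2 * pi * y)" by (simp only: f)
    have "axis_pt (2 * pi * y) \<in> axis" by (simp add: axis_eq)
    then have a: "axis_pt (2 * pi * y) \<in> span {b1, b2}" "axis_pt (2 * pi * y) \<bullet> axis_pt (2 * pi * y) = 2"
      by (auto simp: axis_def mem_SU2_iff)
    have "((1 / s) *\<^sub>R axis_pt (2 * pi * y)) \<bullet> ((1 / s) *\<^sub>R axis_pt (2 * pi * y)) = b1 \<bullet> b1"
      using s bb_pos a(2) by simp
    then have "norm ((1 / s) *\<^sub>R axis_pt (2 * pi * y)) = norm b1" unfolding norm_eq_sqrt_inner by (simp only:)
    moreover have "(1 / s) *\<^sub>R axis_pt (2 * pi * y) \<in> span {b1, b2}" using a(1) by (rule span_scale)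
    ultimately show "p \<in> {c + p | p. p \<in> span {b1, b2} \<and> norm p = norm b1}" using p by blast
  next
    fix p assume "p \<in> {c + p | p. p \<in> span {b1, b2} \<and> norm p = norm b1}"
    then obtain v where v: "p = c + v" "v \<in> span {b1, b2}" "norm v = norm b1" by blast
    have "v \<bullet> v = b1 \<bullet> b1" using v(3) by (simp add: norm_eq_sqrt_inner)
    then have "(s *\<^sub>R v) \<bullet> (s *\<^sub>R v) = s * s * (b1 \<bullet> b1)" by simp
    then have "(s *\<^sub>R v) \<bullet> (s *\<^sub>R v) = 2" unfolding s(2) using bb_pos by simp
    then have "s *\<^sub>R v \<in> axis"
      using v(2) span_b_subset span_scale[OF v(2)] by (auto simp: axis_def mem_SU2_iff)
    then obtain t where t: "s *\<^sub>R v = axis_pt t" by (auto simp: axis_eq)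
    have "v = (1 / s) *\<^sub>R (s *\<^sub>R v)" using s(1) by simp
    also have "\<dots> = (1 / s) *\<^sub>R axis_pt (2 * pi * (t / (2 * pi)))" by (simp add: t)
    finally have "p = f (x *\<^sub>R gx + (t / (2 * pi)) *\<^sub>R gy)" by (simp only: f v(1))
    then show "p \<in> f ` line x" by (auto simp: line_eq)
  qed
  moreover have "norm b1 > 0" using b_nz by simp
  ultimately show ?thesis unfolding is_circle_def using dim_span_b subspace_span by blast
qed

end

context clifford_cover
begin

definition circ :: "real \<Rightarrow> complex set set" where "circ x = torus_pt \<Gamma> ` line x"

lemma circ_subset: "circ x \<subseteq> topspace (torus \<Gamma>)"
  by (auto simp: circ_def)

lemma circ_shift: "circ (x + of_int (g * a)) = circ x"
proof -
  have "circ (x + of_int (g * a)) \<subseteq> circ x" for x a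
  proof
    fix p assume "p \<in> circ (x + of_int (g * a))"
    then obtain z where z: "p = torus_pt \<Gamma> z" "pairing z k = x + of_int (g * a)" by (auto simp: circ_def line_def)
    obtain c where c: "c \<in> \<Gamma>" "pairing c k = of_int (g * a)" using exists_\<Gamma> by blast
    have "p = torus_pt \<Gamma> (z - c)" using c by (simp add: z pt_eq_\<Gamma>)
    then show "p \<in> circ x" using z c by (auto simp: circ_def line_def pairing_linear)
  qed
  from this[of x a] this[of "x + of_int (g * a)" "- a"] show ?thesis by simp
qed

lemma circ_meet:
  assumes "p \<in> circ x" "p \<in> circ y"
  obtains a :: int where "x = y + of_int (g * a)"
proof -
  obtain z w where zw: "p = torus_pt \<Gamma> z" "p = torus_pt \<Gamma> w" "pairing z k = x" "pairing w k = y"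
    using assms by (auto simp: circ_def line_def)
  then have "z - w \<in> \<Gamma>" using pt_eq_\<Gamma> by blast
  then obtain a :: int where "pairing (z - w) k = of_int (g * a)" by (rule pairing_\<Gamma>)
  then have "x = y + of_int (g * a)" using zw by (simp add: pairing_linear)
  then show ?thesis by (rule that)
qed

text \<open>\<Gamma> identifies lines whose \<open>k\<close> coordinates differ by a multiple of
  \<open>g\<close> and no others. This leaves \<open>g\<close> circles over the lines of a
  hemisphere.\<close>

lemma circ_eq_iff: "circ (x + of_int i) = circ (x + of_int j) \<longleftrightarrow> i mod g = j mod g"
proof
  assume "circ (x + of_int i) = circ (x + of_int j)"
  moreover have "circ (x + of_int i) \<noteq> {}" by (simp add: circ_def line_eq)
  ultimately obtain p where "p \<in> circ (x + of_int i)" "p \<in> circ (x + of_int j)" by blast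
  then obtain a :: int where "x + of_int i = x + of_int j + of_int (g * a)" by (rule circ_meet)
  then have "real_of_int i = real_of_int (j + g * a)" by simp
  then have "i = j + g * a" by (simp only: of_int_eq_iff)
  then show "i mod g = j mod g" by simp
next
  assume "i mod g = j mod g"
  then have "g dvd i - j" by (simp add: mod_eq_dvd_iff)
  then obtain a where "i - j = g * a" by (rule dvdE)
  then have "x + real_of_int i = (x + of_int j) + of_int (g * a)" by (simp flip: of_int_add of_int_mult)
  then show "circ (x + of_int i) = circ (x + of_int j)" by (simp only: circ_shift)
qed

abbreviation "circles x0 \<equiv> range (\<lambda>j::int. circ (x0 + of_int j))"

lemma profile_curves_eq:
  assumes H: "\<And>z. f z \<in> H \<longleftrightarrow> pairing z k - x0 \<in> \<int>"
  shows "profile_curves lam1 lam2 \<Gamma> H = circles x0"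
  unfolding profile_curves_def
proof (rule connected_components_of_open_partition)
  let ?f = "f"
  let ?P = "{x. descend ?f x \<in> H}"
  let ?X = "subtopology (torus \<Gamma>) ?P"
  have sub: "circ (x0 + of_int j) \<subseteq> ?P" for j :: int
    by (auto simp: circ_def line_def descend_\<Gamma> H)
  show "pairwise disjnt (circles x0)"
  proof (rule pairwiseI)
    fix A B assume "A \<in> circles x0" "B \<in> circles x0" "A \<noteq> B"
    then obtain i j :: int where ij: "A = circ (x0 + of_int i)" "B = circ (x0 + of_int j)" by blast
    show "disjnt A B"
      unfolding disjnt_iff
    proof (intro allI notI)
      fix p assume p: "p \<in> A \<and> p \<in> B"
      then have "p \<in> circ (x0 + of_int i)" "p \<in> circ (x0 + of_int j)" using ij by auto
      then obtain a :: int where "x0 + of_int i = (x0 + of_int j) + of_int (g * a)" by (rule circ_meet)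
      then have "A = B" unfolding ij by (simp only: circ_shift)
      then show False using \<open>A \<noteq> B\<close> by simp
    qed
  qed
  show "\<Union> (circles x0) = topspace ?X"
  proof (intro set_eqI iffI)
    fix p assume "p \<in> \<Union> (circles x0)"
    then show "p \<in> topspace ?X" using sub circ_subset by fastforce
  next
    fix p assume "p \<in> topspace ?X"
    then obtain z where z: "p = torus_pt \<Gamma> z" "pairing z k - x0 \<in> \<int>" by (auto simp: descend_\<Gamma> H)
    then obtain j :: int where "pairing z k - x0 = of_int j" by (auto elim: Ints_cases)
    then have "z \<in> line (x0 + of_int j)" by (simp add: line_def)
    then show "p \<in> \<Union> (circles x0)" using z(1) by (auto simp: circ_def)
  qed
  fix K assume "K \<in> circles x0"
  then obtain j :: int where K: "K = circ (x0 + of_int j)" by blast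
  \<comment> \<open>Points of the preimage of \<open>H\<close> have \<open>k\<close> coordinate in
    \<open>x0\<close> plus an integer, so a strip of half-width 1/2 isolates one circle and shows
    that it is open.\<close>
  let ?S = "{z. \<bar>pairing z k - (x0 + of_int j)\<bar> < 1 / 2}"
  have "openin (torus \<Gamma>) (torus_pt \<Gamma> ` ?S)"
    by (rule openin_torus_pt_image[OF sub_\<Gamma> open_strip])
  moreover have "K = torus_pt \<Gamma> ` ?S \<inter> ?P"
  proof (intro set_eqI iffI)
    fix p assume "p \<in> K"
    then show "p \<in> torus_pt \<Gamma> ` ?S \<inter> ?P" using sub unfolding K by (force simp: circ_def line_def)
  next
    fix p assume "p \<in> torus_pt \<Gamma> ` ?S \<inter> ?P"
    then obtain z where z: "p = torus_pt \<Gamma> z" "z \<in> ?S" "pairing z k - x0 \<in> \<int>" by (auto simp: descend_\<Gamma> H)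
    have "pairing z k - (x0 + of_int j) = (pairing z k - x0) - of_int j" by simp
    then have "pairing z k - (x0 + of_int j) \<in> \<int>" using z(3) by (metis Ints_diff Ints_of_int)
    then have "pairing z k - (x0 + of_int j) = 0" using z(2) by (intro small_Ints) auto
    then show "p \<in> K" unfolding K using z(1) by (auto simp: circ_def line_def)
  qed
  ultimately show "openin ?X K" by (auto simp: openin_subtopology)
  have "connectedin euclidean (line (x0 + of_int j))" using connected_line by simp
  then have "connectedin (torus \<Gamma>) K"
    unfolding K circ_def by (rule connectedin_continuous_map_image[OF continuous_map_torus_pt])
  then show "connectedin ?X K" using sub K by (simp add: connectedin_subtopology)
  show "K \<noteq> {}" by (simp add: K circ_def line_eq)
qed

lemma card_profile_curves:
  assumes H: "\<And>z. f z \<in> H \<longleftrightarrow> pairing z k - x0 \<in> \<int>"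
  shows "finite (profile_curves lam1 lam2 \<Gamma> H)" "card (profile_curves lam1 lam2 \<Gamma> H) = nat g"
proof -
  have "range (\<lambda>j::int. j mod g) = {0..<g}"
  proof (intro set_eqI iffI)
    fix r assume "r \<in> {0..<g}"
    then show "r \<in> range (\<lambda>j. j mod g)" by (intro image_eqI[of _ _ r]) auto
  qed (use g_pos in auto)
  then show "finite (profile_curves lam1 lam2 \<Gamma> H)" "card (profile_curves lam1 lam2 \<Gamma> H) = nat g"
    using card_image_eq_card_image[of UNIV "\<lambda>j. circ (x0 + of_int j)" "\<lambda>j. j mod g", OF circ_eq_iff]
    unfolding profile_curves_eq[OF H] by simp_all
qed

text \<open>The general covering lemma on a line: the dual lattice acts there through
  \<open>V\<close>, the integer multiples of \<open>gy\<close>, and \<Gamma> through the multiples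
  of \<open>w\<close> times \<open>gy\<close>. The index \<open>w\<close> is the wrapping
  number.\<close>

lemma sheeted_covering_circ:
  "sheeted_covering (nat w) (subtopology (torus \<Gamma>) (circ x)) (top_of_set (f ` line x))
     (descend f)"
proof -
  define V where "V = {z \<in> \<Lambda>. pairing z k = 0}"
  have V: "add_subgroup V"
    using sub_\<Lambda> by (auto simp: add_subgroup_def V_def pairing_linear)
  have \<Gamma>V: "add_subgroup (\<Gamma> \<inter> V)"
    using V sub_\<Gamma> by (auto simp: add_subgroup_def)
  have zw: "z - w \<in> V \<longleftrightarrow> z - w \<in> \<Lambda>" if "z \<in> line x" "w \<in> line x" for z w
    using that by (auto simp: V_def line_def pairing_linear)
  obtain eps where eps: "eps > 0" "\<And>z. z \<in> \<Lambda> \<Longrightarrow> norm z < eps \<Longrightarrow> z = 0"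
    using discrete_dual by blast
  have V_eq: "z \<in> V \<longleftrightarrow> (\<exists>n::int. z = of_int n *\<^sub>R gy)" for z
  proof
    assume z: "z \<in> V"
    then obtain n :: int where n: "pairing z k' = of_int n" "pairing z k = 0" by (auto simp: V_def dual elim: Ints_cases)
    from pt_pairing[of z, unfolded n] show "\<exists>n::int. z = of_int n *\<^sub>R gy" by auto
  qed (auto simp: V_def dual pairing_linear pairing_g)
  let ?t = "torus_pt (\<Gamma> \<inter> V)" and ?y = "\<lambda>z. \<lfloor>pairing z k'\<rfloor> mod w"
  have tp: "?t y = ?t z \<longleftrightarrow> ?y y = ?y z"
    if y: "y \<in> V" and z: "z \<in> V" for y z
  proof -
    obtain m n :: int where mn: "y = of_int m *\<^sub>R gy" "z = of_int n *\<^sub>R gy" using y z V_eq by blast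
    have "y - z \<in> V" using V y z by (auto simp: add_subgroup_def)
    then have "?t y = ?t z \<longleftrightarrow> y - z \<in> \<Gamma>" by (simp add: torus_pt_eq_iff[OF \<Gamma>V])
    also have "y - z = real_of_int (m - n) *\<^sub>R gy" by (simp add: mn scaleR_diff_left)
    also have "\<dots> \<in> \<Gamma> \<longleftrightarrow> w dvd m - n" unfolding vertical_in_\<Gamma> of_int_eq_iff dvd_def by simp
    finally show ?thesis by (simp add: mn pairing_linear pairing_g mod_eq_dvd_iff)
  qed
  have "?y ` V = {0..<w}"
  proof (intro set_eqI iffI)
    fix r assume "r \<in> {0..<w}"
    then show "r \<in> ?y ` V"
      by (intro image_eqI[of _ _ "of_int r *\<^sub>R gy"]) (auto simp: pairing_linear pairing_g V_eq)
  qed (use w_pos in auto)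
  then have card: "finite (?t ` V)" "card (?t ` V) = nat w"
    using card_image_eq_card_image[of V ?t ?y, OF tp] by simp_all
  show ?thesis
  proof (rule sheeted_covering_quotient[where L = "line x" and eps = eps and \<Gamma> = "\<Gamma> \<inter> V" and \<Lambda> = V])
    show "continuous_map (top_of_set (line x)) (subtopology (torus \<Gamma>) (circ x)) (torus_pt \<Gamma>)"
      unfolding circ_def by (rule continuous_map_line)
    show "open_map (top_of_set (line x)) (subtopology (torus \<Gamma>) (circ x)) (torus_pt \<Gamma>)"
      unfolding circ_def by (rule open_map_line[OF sub_\<Gamma> \<Gamma>_subset])
    show "torus_pt \<Gamma> ` line x = topspace (subtopology (torus \<Gamma>) (circ x))" by (auto simp: circ_def)
    show "continuous_map (top_of_set (line x)) (top_of_set (f ` line x)) f"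
      using continuous_on_flat_cmc by (auto simp: continuous_map_in_subtopology)
    show "open_map (top_of_set (line x)) (top_of_set (f ` line x)) f"
      by (rule open_map_flat_cmc_line)
    show "descend f (torus_pt \<Gamma> z) = f z" for z
      by (rule descend_\<Gamma>)
    show "z + l \<in> line x" if "z \<in> line x" "l \<in> V" for z l
      using that by (simp add: line_def V_def pairing_linear)
    show "torus_pt \<Gamma> z = torus_pt \<Gamma> w \<longleftrightarrow> z - w \<in> \<Gamma> \<inter> V" if "z \<in> line x" "w \<in> line x" for z w
      using zw[OF that] \<Gamma>_subset by (auto simp only: pt_eq_\<Gamma>)
    show "f z = f w \<longleftrightarrow> z - w \<in> V" if "z \<in> line x" "w \<in> line x" for z w
      using zw[OF that] by (simp add: flat_cmc_eq_iff)
    show "eps > 0" by (rule eps)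
    show "l = 0" if "l \<in> V" "norm l < eps" for l using that eps(2) by (simp add: V_def)
  qed (use card V \<Gamma>V in auto)
qed

lemma is_union_of_wrapped_circles:
  assumes H: "\<And>z. f z \<in> H \<longleftrightarrow> pairing z k - x0 \<in> \<int>"
  shows "is_union_of_wrapped_circles lam1 lam2 \<Gamma> H (nat g) (nat w)"
  unfolding is_union_of_wrapped_circles_def
proof (intro conjI exI ballI card_profile_curves[OF H])
  show "is_circle (f ` line x0)" by (rule is_circle_line)
  fix K assume "K \<in> profile_curves lam1 lam2 \<Gamma> H"
  then obtain j :: int where K: "K = circ (x0 + of_int j)" using profile_curves_eq[OF H] by blast
  show "sheeted_covering (nat w) (subtopology (torus \<Gamma>) K) (top_of_set (f ` line x0))
     (descend f)"
    using sheeted_covering_circ[of "x0 + of_int j"] flat_cmc_line[of "x0 + of_int j" x0] by (simp add: K)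
qed

end

section \<open>Turning numbers\<close>

text \<open>The sign is an orientation; it is needed since \<open>plane_basis\<close> admits bases
  of both orientations.\<close>

lemma orthogonal_complex_cases:
  fixes a b :: complex
  assumes "a \<bullet> b = 0" "norm b = norm a" "a \<noteq> 0"
  obtains sg :: real where "\<bar>sg\<bar> = 1" "b = \<i> * of_real sg * a"
proof -
  define r where "r = Im (b * cnj a)"
  have "Re (b * cnj a) = 0" using assms(1) by (simp add: inner_complex_def mult.commute)
  then have r: "b * cnj a = \<i> * of_real r" by (simp add: complex_eq_iff r_def)
  then have "norm (b * cnj a) = \<bar>r\<bar>" by (simp add: norm_mult)
  then have "\<bar>r\<bar> = (norm a)\<^sup>2" using assms(2) by (simp add: norm_mult power2_eq_square)
  then have "\<bar>r / (norm a)\<^sup>2\<bar> = 1" using assms(3) by simp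
  moreover have "b * (cnj a * a) = \<i> * of_real r * a" using r by (simp add: mult.assoc[symmetric])
  then have "b = \<i> * of_real (r / (norm a)\<^sup>2) * a"
    using assms(3) complex_norm_square[of a] by (simp add: field_simps)
  ultimately show ?thesis by (rule that)
qed

text \<open>It keeps the lift of a parametrization on a single one of the parallel lines that cover
  a profile curve.\<close>

lemma continuous_integer_shift_constant:
  fixes h :: "real \<Rightarrow> real"
  assumes "continuous_on UNIV h" "\<And>t. h t - x \<in> \<int>"
  shows "h t = h s"
proof -
  have "h constant_on UNIV"
  proof (rule continuous_discrete_range_constant[OF connected_UNIV assms(1)])
    fix t :: real
    have "1 \<le> norm (h s - h t)" if "h s \<noteq> h t" for s
    proof -
      have "h s - h t \<in> \<int>" using Ints_diff[OF assms(2)[of s] assms(2)[of t]] by simp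
      then show ?thesis using that Ints_nonzero_abs_ge1[of "h s - h t"] by simp
    qed
    then show "\<exists>e>0. \<forall>y. y \<in> UNIV \<and> h y \<noteq> h t \<longrightarrow> e \<le> norm (h y - h t)"
      by (intro exI[of _ 1]) simp
  qed
  then show ?thesis unfolding constant_on_def by auto
qed

lemma continuous_nonzero_sgn_constant:
  fixes h :: "real \<Rightarrow> real"
  assumes "continuous_on UNIV h" "\<And>t. h t \<noteq> 0"
  shows "sgn (h t) = sgn (h s)"
proof (rule ccontr)
  assume "sgn (h t) \<noteq> sgn (h s)"
  then have "(h t < 0 \<and> h s > 0) \<or> (h s < 0 \<and> h t > 0)"
    using assms(2)[of t] assms(2)[of s] by (auto simp: sgn_if split: if_splits)
  moreover have "connected (range h)" by (rule connected_continuous_image[OF assms(1) connected_UNIV])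
  ultimately have "0 \<in> range h"
    using connectedD_interval[of "range h" "h t" "h s" 0] connectedD_interval[of "range h" "h s" "h t" 0] by fastforce
  then show False using assms(2) by auto
qed

lemma C1_regularI:
  assumes "\<And>t. (c has_vector_derivative c' t) (at t)" "continuous_on UNIV c'" "\<And>t. c' t \<noteq> 0"
  shows "C1_regular c" "\<And>t. vector_derivative c (at t) = c' t"
proof -
  show v: "vector_derivative c (at t) = c' t" for t using assms(1) by (rule vector_derivative_at)
  show "C1_regular c" using assms unfolding C1_regular_def v differentiable_def has_vector_derivative_def by blast
qed

text \<open>The angle function \<open>y\<close> is arbitrary because the parametrization is. The
  tangent is a nonzero real multiple of \<i> times the position vector, so the Gauss map makes as
  many turns as the point on the circle.\<close>

lemma turning_number_circle:
  assumes B: "B \<noteq> 0" and sg: "\<bar>sg\<bar> = 1"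
    and y: "\<And>t. (y has_real_derivative y' t) (at t)" and y': "continuous_on UNIV y'" "\<And>t. y' t \<noteq> 0"
    and g: "\<And>t. g t = B * cis (sg * (2 * pi * y t))"
  shows "C1_regular g" "turning_number g = \<bar>y 1 - y 0\<bar>"
proof -
  define g' where "g' t = of_real (sg * (2 * pi * y' t)) * (\<i> * B * cis (sg * (2 * pi * y t)))" for t
  have g_eq: "g = (\<lambda>t. B * cis (sg * (2 * pi * y t)))" using g by blast
  have "sg \<noteq> 0" using sg by auto
  have der: "(g has_vector_derivative g' t) (at t)" for t
  proof -
    have "((\<lambda>t. sg * (2 * pi * y t)) has_real_derivative sg * (2 * pi * y' t)) (at t)"
      by (auto intro!: derivative_eq_intros y)
    then have "((\<lambda>t. sg * (2 * pi * y t)) has_vector_derivative sg * (2 * pi * y' t)) (at t)"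
      by (simp add: has_real_derivative_iff_has_vector_derivative)
    moreover have "((\<lambda>s. B * cis s) has_vector_derivative \<i> * B * cis s) (at s)" for s
      unfolding has_vector_derivative_def
      by (auto intro!: derivative_eq_intros has_derivative_cis simp: scaleR_conv_of_real)
    ultimately have "((\<lambda>s. B * cis s) \<circ> (\<lambda>t. sg * (2 * pi * y t)) has_vector_derivative
        (sg * (2 * pi * y' t)) *\<^sub>R (\<i> * B * cis (sg * (2 * pi * y t)))) (at t)"
      by (intro vector_diff_chain_at)
    then show ?thesis by (simp add: g_eq g'_def comp_def scaleR_conv_of_real)
  qed
  have cy: "continuous_on UNIV y" using y by (meson DERIV_isCont continuous_at_imp_continuous_on)
  have cg': "continuous_on UNIV g'" unfolding g'_def cis_conv_exp
    by (intro continuous_intros cy y')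
  have nz: "g' t \<noteq> 0" for t using B \<open>sg \<noteq> 0\<close> y'(2) by (simp add: g'_def)
  show "C1_regular g" by (rule C1_regularI[OF der cg' nz])
  \<comment> \<open>The constant factor of the unit tangent; it is constant because
    \<open>y'\<close> never changes sign.\<close>
  define u where "u = of_real (sg * sgn (y' 0)) * (\<i> * sgn B)"
  have "norm u = 1" using sg B y'(2)[of 0] by (simp add: u_def norm_mult norm_sgn abs_mult)
  then obtain ps where ps: "u = cis ps" by (metis cis_Arg norm_zero zero_neq_one sgn_div_norm divide_self_if scaleR_one inverse_1)
  \<comment> \<open>A continuous logarithm of the Gauss map, so that the winding number is its
    increment divided by \<open>2 * pi * \<i>\<close>.\<close>
  define p where "p t = \<i> * of_real (ps + sg * (2 * pi * y t))" for t
  have "sgn (vector_derivative g (at t)) = (exp \<circ> p) t" for t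
  proof -
    have "sgn (sg * (2 * pi * y' t)) = sg * sgn (y' 0)"
      using sg continuous_nonzero_sgn_constant[OF y', of t 0] by (auto simp: sgn_mult abs_if split: if_splits)
    then have "sgn (g' t) = of_real (sg * sgn (y' 0)) * (\<i> * sgn B * cis (sg * (2 * pi * y t)))"
      unfolding g'_def sgn_mult sgn_of_real by (simp add: sgn_mult sgn_eq)
    also have "\<dots> = u * cis (sg * (2 * pi * y t))" by (simp add: u_def)
    also have "\<dots> = (exp \<circ> p) t" by (simp add: ps p_def cis_conv_exp exp_add distrib_left)
    finally show ?thesis by (simp add: C1_regularI(2)[OF der cg' nz])
  qed
  then have "(\<lambda>t. sgn (vector_derivative g (at t))) = exp \<circ> p" by blast
  moreover have "path p" unfolding path_def p_def
    by (intro continuous_intros continuous_on_subset[OF cy]) auto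
  then have "winding_number (exp \<circ> p) 0 = (pathfinish p - pathstart p) / (2 * of_real pi * \<i>)"
    by (rule winding_number_compose_exp)
  moreover have "(pathfinish p - pathstart p) / (2 * of_real pi * \<i>) = of_real (sg * (y 1 - y 0))"
    by (simp add: p_def pathfinish_def pathstart_def field_simps)
  ultimately show "turning_number g = \<bar>y 1 - y 0\<bar>"
    using sg by (simp add: turning_number_def abs_mult)
qed

context clifford
begin

text \<open>The chart kills \<open>d1\<close> and \<open>d2\<close> and is an isometry on the plane
  of \<open>b1\<close> and \<open>b2\<close>. So the images of \<open>b1\<close> and
  \<open>b2\<close> are orthogonal of equal length, and the second is plus or minus \<i> times the
  first.\<close>

lemma hemisphere_chart_flat_cmc:
  assumes "plane_basis axis e1 e2"
  obtains B :: complex and sg :: real where "B \<noteq> 0" "\<bar>sg\<bar> = 1"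
    "\<And>z. hemisphere_chart e1 e2 (f z) = B * cis (sg * (\<alpha> z))"
proof -
  have e: "e1 \<bullet> e1 = 1" "e2 \<bullet> e2 = 1" "e1 \<bullet> e2 = 0" "e2 \<bullet> e1 = 0" "span {e1, e2} = span {b1, b2}"
    using assms by (auto simp: plane_basis_def span_axis norm_eq_1 inner_commute)
  have de: "d1 \<bullet> v = 0" "d2 \<bullet> v = 0" if "v \<in> {e1, e2}" for v
  proof -
    have "v \<in> span {b1, b2}" using that e(5) by (metis span_base)
    then show "d1 \<bullet> v = 0" "d2 \<bullet> v = 0" by (auto simp: mem_span_pair inner_simps inner_basis)
  qed
  have inner_e: "b \<bullet> b' = Complex (b \<bullet> e1) (b \<bullet> e2) \<bullet> Complex (b' \<bullet> e1) (b' \<bullet> e2)"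
    if "b \<in> {b1, b2}" "b' \<in> {b1, b2}" for b b'
  proof -
    have "b \<in> span {e1, e2}" "b' \<in> span {e1, e2}" using that e(5) by (metis span_base)+
    then obtain x y x' y' where b: "b = x *\<^sub>R e1 + y *\<^sub>R e2" "b' = x' *\<^sub>R e1 + y' *\<^sub>R e2"
      by (auto simp: mem_span_pair)
    show ?thesis unfolding b by (simp add: inner_complex_def inner_simps e)
  qed
  define B1 where "B1 = Complex (b1 \<bullet> e1) (b1 \<bullet> e2)"
  define B2 where "B2 = Complex (b2 \<bullet> e1) (b2 \<bullet> e2)"
  have B: "B1 \<bullet> B2 = 0" "B1 \<bullet> B1 = b1 \<bullet> b1" "B2 \<bullet> B2 = b1 \<bullet> b1"
    using inner_e b_inner by (auto simp: B1_def B2_def)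
  then have nz: "B1 \<noteq> 0" using bb_pos by auto
  have "norm B2 = norm B1" using B by (simp add: norm_eq_sqrt_inner)
  then obtain sg where sg: "\<bar>sg\<bar> = 1" "B2 = \<i> * of_real sg * B1"
    using orthogonal_complex_cases[OF B(1) _ nz] by blast
  have "hemisphere_chart e1 e2 (f z) = B1 * cis (sg * (\<alpha> z))" for z
  proof -
    have "hemisphere_chart e1 e2 (f z) =
        of_real (cos (\<alpha> z)) * B1 + of_real (sin (\<alpha> z)) * B2"
      by (simp add: hemisphere_chart_def flat_cmc_eq inner_simps de complex_eq_iff B1_def B2_def)
    also have "\<dots> = B1 * (of_real (cos (\<alpha> z)) + \<i> * of_real (sg * sin (\<alpha> z)))"
      unfolding sg(2) by (simp add: algebra_simps)
    also have "of_real (cos (\<alpha> z)) + \<i> * of_real (sg * sin (\<alpha> z)) =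
        cis (sg * (\<alpha> z))"
      using sg(1) by (auto simp: complex_eq_iff abs_if split: if_splits)
    finally show ?thesis .
  qed
  with nz sg(1) show ?thesis by (rule that)
qed

end

context clifford_cover
begin

lemma parametrizes_circ: "parametrizes \<Gamma> (circ x) (\<lambda>t. x *\<^sub>R gx + (of_int w * t) *\<^sub>R gy)"
  unfolding parametrizes_def
proof (intro conjI allI)
  let ?c = "\<lambda>t. x *\<^sub>R gx + (of_int w * t) *\<^sub>R gy"
  have "(?c has_vector_derivative of_int w *\<^sub>R gy) (at t)" for t
    unfolding has_vector_derivative_def by (auto intro!: derivative_eq_intros simp: algebra_simps)
  then show "C1_regular ?c"
    by (rule C1_regularI) (use w_pos g_nz in auto)
  show "?c (t + 1) - ?c t \<in> \<Gamma>" for t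
    using vertical_in_\<Gamma>[of "of_int w"] by (simp add: algebra_simps)
  show "bij_betw (\<lambda>t. torus_pt \<Gamma> (?c t)) {0..<1} (circ x)"
  proof (rule bij_betwI')
    fix s t :: real assume st: "s \<in> {0..<1}" "t \<in> {0..<1}"
    show "torus_pt \<Gamma> (?c s) = torus_pt \<Gamma> (?c t) \<longleftrightarrow> s = t"
    proof
      assume "torus_pt \<Gamma> (?c s) = torus_pt \<Gamma> (?c t)"
      then have "?c s - ?c t \<in> \<Gamma>" by (simp only: pt_eq_\<Gamma>)
      moreover have "?c s - ?c t = (of_int w * (s - t)) *\<^sub>R gy" by (simp add: algebra_simps)
      ultimately obtain n where "of_int w * (s - t) = of_int (w * n)" using vertical_in_\<Gamma> by metis
      then have "s - t = of_int n" using w_pos by simp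
      then have "s - t \<in> \<int>" by simp
      moreover have "\<bar>s - t\<bar> < 1" using st by auto
      ultimately show "s = t" using Ints_nonzero_abs_less1[of "s - t"] by simp
    qed simp
  next
    fix t show "torus_pt \<Gamma> (?c t) \<in> circ x" by (auto simp: circ_def line_eq)
  next
    fix p assume "p \<in> circ x"
    then obtain y where p: "p = torus_pt \<Gamma> (x *\<^sub>R gx + y *\<^sub>R gy)" by (auto simp: circ_def line_eq)
    define t where "t = frac (y / of_int w)"
    have "y - of_int w * t = of_int (w * \<lfloor>y / of_int w\<rfloor>)"
      using w_pos by (simp add: t_def frac_def algebra_simps)
    then have "(y - of_int w * t) *\<^sub>R gy \<in> \<Gamma>" unfolding vertical_in_\<Gamma> by blast
    then have "p = torus_pt \<Gamma> (?c t)"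
      unfolding p pt_eq_\<Gamma> by (simp add: algebra_simps)
    moreover have "t \<in> {0..<1}" by (simp add: t_def frac_lt_1)
    ultimately show "\<exists>t\<in>{0..<1}. p = torus_pt \<Gamma> (?c t)" by blast
  qed
qed

lemma parametrizes_shift:
  assumes "parametrizes \<Gamma> K c"
  shows "c (t + of_int n) - c t \<in> \<Gamma>"
proof (induction n rule: int_induct[where k = 0])
  case base
  show ?case using sub_\<Gamma> by (simp add: add_subgroup_def)
next
  case (step1 i)
  have "c (t + of_int i + 1) - c (t + of_int i) \<in> \<Gamma>" using assms by (simp add: parametrizes_def)
  from add_subgroup_add[OF sub_\<Gamma> this step1(2)] show ?case by (simp add: algebra_simps)
next
  case (step2 i)
  have "\<forall>t. c (t + 1) - c t \<in> \<Gamma>" using assms by (simp add: parametrizes_def)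
  then have "c (t + of_int (i - 1) + 1) - c (t + of_int (i - 1)) \<in> \<Gamma>" by (rule spec)
  moreover have "t + of_int (i - 1) + 1 = t + real_of_int i" by simp
  ultimately have "c (t + of_int i) - c (t + of_int (i - 1)) \<in> \<Gamma>" by (simp only:)
  then have "(c (t + of_int i) - c t) - (c (t + of_int i) - c (t + of_int (i - 1))) \<in> \<Gamma>"
    using step2(2) sub_\<Gamma> unfolding add_subgroup_def by blast
  then show ?case by simp
qed

text \<open>The lift stays on a line, so regularity makes the remaining coordinate y strictly
  monotone, and closedness makes its increment over one period a multiple of \<open>w\<close>.
  Injectivity on \<open>{0..<1}\<close> excludes every multiple except plus or minus
  \<open>w\<close>.\<close>

lemma parametrization_coordinate:
  assumes c: "parametrizes \<Gamma> (circ x) c"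
  obtains y' where "\<And>t. ((\<lambda>t. pairing (c t) k') has_real_derivative y' t) (at t)" "continuous_on UNIV y'"
    "\<And>t. y' t \<noteq> 0" "\<bar>pairing (c 1) k' - pairing (c 0) k'\<bar> = of_int w"
    "\<And>t. pairing (c (t + 1)) k' - pairing (c t) k' \<in> \<int>"
proof -
  define c' where "c' t = vector_derivative c (at t)" for t
  define y where "y t = pairing (c t) k'" for t
  define y' where "y' t = pairing (c' t) k'" for t
  have der: "(c has_vector_derivative c' t) (at t)" and cont: "continuous_on UNIV c'" and nz: "c' t \<noteq> 0" for t
    using c by (auto simp: parametrizes_def C1_regular_def c'_def[abs_def] vector_derivative_works[symmetric])
  have bl: "bounded_linear (\<lambda>z. pairing z u)" for u
    unfolding pairing_eq_inner by (intro bounded_linear_const_mult bounded_linear_inner_left)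
  have der_p: "((\<lambda>t. pairing (c t) u) has_real_derivative pairing (c' t) u) (at t)" for t u
    using bounded_linear.has_vector_derivative[OF bl der]
    by (simp add: has_real_derivative_iff_has_vector_derivative)
  then have cont_p: "continuous_on S (\<lambda>t. pairing (c t) u)" for u S
    by (meson DERIV_isCont continuous_at_imp_continuous_on)
  have "pairing (c t) k - x \<in> \<int>" for t
  proof -
    \<comment> \<open>Membership in the circle is known only for parameters in
      \<open>{0..<1}\<close>, so \<open>t\<close> is first reduced by its integer part.\<close>
    have "c (frac t + of_int \<lfloor>t\<rfloor>) - c (frac t) \<in> \<Gamma>" by (rule parametrizes_shift[OF c])
    then have *: "c t - c (frac t) \<in> \<Gamma>" by (simp add: frac_def)
    have "frac t \<in> {0..<1}" by (simp add: frac_lt_1)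
    then have "torus_pt \<Gamma> (c (frac t)) \<in> circ x" using c unfolding parametrizes_def bij_betw_def by blast
    then obtain z where "torus_pt \<Gamma> (c (frac t)) = torus_pt \<Gamma> z" "pairing z k = x" by (auto simp: circ_def line_def)
    then have "c (frac t) - z \<in> \<Gamma>" "pairing z k = x" by (auto simp: pt_eq_\<Gamma>)
    then have "(c t - c (frac t)) + (c (frac t) - z) \<in> \<Gamma>" using * add_subgroup_add[OF sub_\<Gamma>] by blast
    then have "c t - z \<in> \<Lambda>" using \<Gamma>_subset by auto
    then show ?thesis using \<open>pairing z k = x\<close> by (auto simp: dual pairing_linear)
  qed
  then have const: "pairing (c t) k = pairing (c s) k" for s t
    by (rule continuous_integer_shift_constant[OF cont_p])
  have "pairing (c' t) k = 0" for t
  proof -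
    have "(\<lambda>t. pairing (c t) k) = (\<lambda>t. pairing (c 0) k)" using const by blast
    then have "((\<lambda>t. pairing (c 0) k) has_real_derivative pairing (c' t) k) (at t)" using der_p[of k t] by simp
    then show ?thesis by (metis DERIV_const DERIV_unique)
  qed
  then have y'_nz: "y' t \<noteq> 0" for t
    using nz[of t] eq_iff_pairing[of "c' t" 0] by (auto simp: y'_def pairing_linear)
  have cont_y': "continuous_on UNIV y'" unfolding y'_def by (intro continuous_intros cont)
  have vert: "c t - c s = (y t - y s) *\<^sub>R gy" for s t
    using const[of t s] pt_pairing[of "c t - c s"] by (simp add: pairing_linear y_def)
  have incr: "\<exists>n. y (t + 1) - y t = of_int (w * n)" for t
  proof -
    have "c (t + 1) - c t \<in> \<Gamma>" using c by (simp add: parametrizes_def)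
    then show ?thesis unfolding vert vertical_in_\<Gamma> .
  qed
  have dy: "(y has_real_derivative y' t) (at t)" for t using der_p unfolding y_def y'_def .
  have cy: "continuous_on S y" for S using cont_p unfolding y_def .
  obtain n where n: "y 1 - y 0 = of_int (w * n)" using incr[of 0] by auto
  \<comment> \<open>A return to the initial height would produce a zero of \<open>y'\<close>, by the
    mean value theorem.\<close>
  have "n \<noteq> 0"
  proof
    assume "n = 0"
    obtain z where "y 1 - y 0 = (1 - 0) * y' z" using MVT2[of 0 1 y y'] dy by auto
    then show False using n \<open>n = 0\<close> y'_nz by simp
  qed
  \<comment> \<open>If the total increment is not plus or minus \<open>w\<close>, then a height at
    distance \<open>w\<close> from the start cannot be attained: it would be attained before the
    parameter 1, at a point equal to the initial one in the quotient. The intermediate value theorem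
    below provides such a parameter.\<close>
  have no: False if t: "0 \<le> t" "t \<le> 1" and e: "y t = y 0 + of_int (w * m)" and m: "\<bar>m\<bar> = 1" and n: "\<bar>n\<bar> \<noteq> 1" for t m
  proof -
    have "c t - c 0 \<in> \<Gamma>" unfolding vert vertical_in_\<Gamma> using e by auto
    then have tp: "torus_pt \<Gamma> (c t) = torus_pt \<Gamma> (c 0)" by (simp add: pt_eq_\<Gamma>)
    have "t \<noteq> 1"
    proof
      assume "t = 1"
      then have "real_of_int (w * m) = of_int (w * n)" using e \<open>y 1 - y 0 = of_int (w * n)\<close> by simp
      then have "w * m = w * n" by (simp only: of_int_eq_iff)
      then show False using w_pos m n by auto
    qed
    then have "t \<in> {0..<1}" using t by auto
    then have "t = 0" using c tp unfolding parametrizes_def bij_betw_def inj_on_def by auto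
    then show False using e w_pos m by auto
  qed
  have "\<bar>n\<bar> = 1"
  proof (rule ccontr)
    assume n1: "\<bar>n\<bar> \<noteq> 1"
    show False
    proof (cases "n > 0")
      case True
      then have "w * 1 \<le> w * n" using w_pos by (intro mult_left_mono) auto
      then have "real_of_int (w * 1) \<le> of_int (w * n)" by (simp only: of_int_le_iff)
      then have "y 0 + of_int (w * 1) \<le> y 1" using n by linarith
      moreover have "y 0 \<le> y 0 + of_int (w * 1)" using w_pos by simp
      ultimately obtain t where "0 \<le> t" "t \<le> 1" "y t = y 0 + of_int (w * 1)"
        using IVT'[of y 0 "y 0 + of_int (w * 1)" 1] cy by auto
      then show False using no[of t 1] n1 by simp
    next
      case False
      then have "w * n \<le> w * (- 1)" using w_pos \<open>n \<noteq> 0\<close> by (intro mult_left_mono) auto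
      then have "real_of_int (w * n) \<le> of_int (w * (- 1))" by (simp only: of_int_le_iff)
      then have "y 1 \<le> y 0 + of_int (w * (- 1))" using n by linarith
      moreover have "y 0 + of_int (w * (- 1)) \<le> y 0" using w_pos by simp
      ultimately obtain t where "0 \<le> t" "t \<le> 1" "y t = y 0 + of_int (w * (- 1))"
        using IVT2'[of y 1 "y 0 + of_int (w * (- 1))" 0] cy by auto
      then show False using no[of t "- 1"] n1 by simp
    qed
  qed
  then have "\<bar>y 1 - y 0\<bar> = of_int w" using n w_pos by (simp add: abs_mult)
  moreover have "y (t + 1) - y t \<in> \<int>" for t using incr[of t] by auto
  ultimately show ?thesis using that[of y'] dy cont_y' y'_nz unfolding y_def by blast
qed

text \<open>There are \<open>g\<close> curves, each with turning number \<open>w\<close>, and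
  \<open>w * g = q0\<close>.\<close>

lemma has_total_turning_number:
  assumes H: "\<And>z. f z \<in> H \<longleftrightarrow> pairing z k - x0 \<in> \<int>"
  shows "has_total_turning_number lam1 lam2 \<Gamma> axis H (of_int q0)"
  unfolding has_total_turning_number_def
proof (intro conjI allI impI ballI)
  let ?P = "profile_curves lam1 lam2 \<Gamma> H"
  show "finite ?P" by (rule card_profile_curves[OF H])
  show "\<exists>c. parametrizes \<Gamma> K c" if "K \<in> ?P" for K
    using that parametrizes_circ unfolding profile_curves_eq[OF H] by blast
  fix e1 e2 c assume e: "plane_basis axis e1 e2" and c: "\<forall>K\<in>?P. parametrizes \<Gamma> K (c K)"
  obtain B sg where B: "B \<noteq> 0" "\<bar>sg\<bar> = 1"
    "\<And>z. hemisphere_chart e1 e2 (f z) = B * cis (sg * (\<alpha> z))"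
    using hemisphere_chart_flat_cmc[OF e] by blast
  have main: "immersed_closed_plane_curve (hemisphere_chart e1 e2 \<circ> f \<circ> c K)"
     "turning_number (hemisphere_chart e1 e2 \<circ> f \<circ> c K) = of_int w" if K: "K \<in> ?P" for K
  proof -
    let ?g = "hemisphere_chart e1 e2 \<circ> f \<circ> c K"
    obtain j :: int where "K = circ (x0 + of_int j)" using K profile_curves_eq[OF H] by blast
    then have "parametrizes \<Gamma> (circ (x0 + of_int j)) (c K)" using c K by metis
    then obtain y' where y': "\<And>t. ((\<lambda>t. pairing (c K t) k') has_real_derivative y' t) (at t)"
      "continuous_on UNIV y'" "\<And>t. y' t \<noteq> 0"
      "\<bar>pairing (c K 1) k' - pairing (c K 0) k'\<bar> = of_int w"
      "\<And>t. pairing (c K (t + 1)) k' - pairing (c K t) k' \<in> \<int>"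
      by (rule parametrization_coordinate) blast
    have g: "?g t = B * cis (sg * (2 * pi * pairing (c K t) k'))" for t by (simp add: B(3))
    note tn = turning_number_circle[where g = ?g, OF B(1,2) y'(1-3) g]
    show "turning_number ?g = of_int w" using tn(2) y'(4) by simp
    have "?g (t + 1) = ?g t" for t
    proof -
      have "cos (2 * pi * pairing (c K (t + 1)) k') = cos (2 * pi * pairing (c K t) k')"
        "sin (2 * pi * pairing (c K (t + 1)) k') = sin (2 * pi * pairing (c K t) k')"
        using y'(5)[of t] sincos_2pi_eq_iff by blast+
      then have "cis (sg * (2 * pi * pairing (c K (t + 1)) k')) = cis (sg * (2 * pi * pairing (c K t) k'))"
        using B(2) by (auto simp: complex_eq_iff abs_if split: if_splits)
      then show ?thesis unfolding g by (simp only:)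
    qed
    with tn(1) show "immersed_closed_plane_curve ?g" by (simp add: immersed_closed_plane_curve_def)
  qed
  show "immersed_closed_plane_curve (hemisphere_chart e1 e2 \<circ> f \<circ> c K)" if "K \<in> ?P" for K
    by (rule main(1)[OF that])
  have "(\<Sum>K\<in>?P. turning_number (hemisphere_chart e1 e2 \<circ> f \<circ> c K)) = (\<Sum>K\<in>?P. of_int w)"
    by (rule sum.cong[OF HOL.refl main(2)])
  also have "\<dots> = of_int (w * g)" using card_profile_curves(2)[OF H] g_pos by simp
  also have "\<dots> = of_int q0" using q0_eq by (rule arg_cong[OF sym])
  finally show "(\<Sum>K\<in>?P. turning_number (hemisphere_chart e1 e2 \<circ> f \<circ> c K)) = of_int q0" .
qed

lemma profile_curves_axis:
  assumes "hemisphere axis H"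
  shows "has_total_turning_number lam1 lam2 \<Gamma> axis H (of_int q0) \<and>
    is_union_of_wrapped_circles lam1 lam2 \<Gamma> H (nat (gcd q0 \<bar>q'\<bar>)) (nat (q0 div gcd q0 \<bar>q'\<bar>))"
proof -
  obtain x0 where x0: "\<And>z. f z \<in> H \<longleftrightarrow> pairing z k - x0 \<in> \<int>"
    using hemisphere_axis[OF assms] by blast
  show ?thesis
    using has_total_turning_number[OF x0] is_union_of_wrapped_circles[OF x0] by (simp add: g_def w_def)
qed

end

section \<open>Flat cmc tori\<close>

lemma cnj_mult_self: "norm a = 1 \<Longrightarrow> a * cnj a = 1" "norm a = 1 \<Longrightarrow> cnj a * a = 1"
  by (simp_all add: complex_norm_square[symmetric] mult.commute[of "cnj a"])

lemma norm_csqrt: "norm lam = 1 \<Longrightarrow> norm (csqrt lam) = 1"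
  by (metis norm_ge_zero norm_power power2_csqrt power2_eq_1_iff abs_norm_cancel abs_one power2_eq_iff_nonneg one_power2 zero_le_one)

lemma quat_diff: "quat a b - quat c d = quat (a - c) (b - d)"
  by (simp add: mat2_eq_iff)

text \<open>The sign \<open>e\<close> treats both planes at once: for \<open>e = 1\<close> the
  vector \<open>K\<close> is the half sum and rotates with the half difference as frequency, for
  \<open>e = - 1\<close> the roles are exchanged.\<close>

lemma frame_action:
  assumes a: "a1\<^sup>2 = lam1" "a2\<^sup>2 = lam2" "norm a1 = 1" "norm a2 = 1"
    and e: "e = 1 \<or> e = - 1" and K: "K = (a1 + of_real e * a2) / 2"
  shows
    "frame lam1 z ** quat (cnj a1 * K) 0 ** matrix_inv (frame lam2 z) =
      cos (2 * pi * pairing z ((a1 - of_real e * a2) / 2)) *\<^sub>R quat (cnj a1 * K) 0 +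
      sin (2 * pi * pairing z ((a1 - of_real e * a2) / 2)) *\<^sub>R quat 0 (\<i> * cnj K)" (is ?A)
    "frame lam1 z ** quat 0 (\<i> * cnj K) ** matrix_inv (frame lam2 z) =
      cos (2 * pi * pairing z ((a1 - of_real e * a2) / 2)) *\<^sub>R quat 0 (\<i> * cnj K) -
      sin (2 * pi * pairing z ((a1 - of_real e * a2) / 2)) *\<^sub>R quat (cnj a1 * K) 0" (is ?B)
proof -
  define x where "x = cnj a1 * K"
  define t1 where "t1 = pi * pairing z a1"
  define t2 where "t2 = pi * pairing z a2"
  have u: "a1 * cnj a1 = 1" "a2 * cnj a2 = 1" using a cnj_mult_self by auto
  have ee: "complex_of_real e * of_real e = 1" using e by auto
  \<comment> \<open>The choice of \<open>K\<close> is made for the first identity: conjugating and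
    multiplying by \<open>a2\<close> reproduces \<open>cnj a1 * K\<close> up to the sign
    \<open>e\<close>. So both frames act within one and the same plane and their angles
    combine.\<close>
  have r: "a2 * cnj K = of_real e * x" "cnj a2 * x = of_real e * cnj K" "cnj a1 * cnj x = cnj K"
    "cnj a1 * cnj a2 * K = of_real e * cnj K"
    unfolding x_def K using u ee by (simp_all add: field_simps) algebra+
  have arg: "2 * pi * pairing z ((a1 - of_real e * a2) / 2) = t1 - e * t2"
    by (simp add: t1_def t2_def pairing_def field_simps)
  have F1: "frame lam1 z = quat (cos t1) (\<i> * sin t1 * cnj a1)"
    unfolding t1_def using a by (intro frame_eq) auto
  have F2: "frame lam2 z = quat (cos t2) (\<i> * sin t2 * cnj a2)"
    unfolding t2_def using a by (intro frame_eq) auto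
  have F2': "matrix_inv (frame lam2 z) = quat (cos t2) (- (\<i> * sin t2 * cnj a2))"
    unfolding F2 by (subst quat_inverse) (simp_all add: norm_mult a power_mult_distrib)
  have ang: "cos (t1 - e * t2) = cos t1 * cos t2 + e * (sin t1 * sin t2)"
      "sin (t1 - e * t2) = sin t1 * cos t2 - e * (cos t1 * sin t2)"
    using e by (auto simp: cos_diff sin_diff cos_add sin_add)
  have "frame lam1 z ** quat x 0 = quat (cos t1 * x) (\<i> * sin t1 * cnj K)"
    unfolding F1 quat_mult by (simp add: r(3) mult.assoc)
  then have "frame lam1 z ** quat x 0 ** matrix_inv (frame lam2 z) =
      quat (cos t1 * cos t2 * x + sin t1 * sin t2 * (a2 * cnj K))
        (\<i> * (sin t1 * cos t2 * cnj K - cos t1 * sin t2 * (cnj a2 * x)))"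
    unfolding F2' by (simp add: quat_mult algebra_simps)
  then show ?A
    unfolding arg ang r x_def[symmetric] quat_scaleR quat_add
    by (simp add: scaleR_conv_of_real algebra_simps)
  have "frame lam1 z ** quat 0 (\<i> * cnj K) = quat (- (sin t1 * x)) (cos t1 * (\<i> * cnj K))"
    unfolding F1 quat_mult x_def by (simp add: algebra_simps)
  then have "frame lam1 z ** quat 0 (\<i> * cnj K) ** matrix_inv (frame lam2 z) =
      quat (cos t1 * sin t2 * (a2 * cnj K) - sin t1 * cos t2 * x)
        (\<i> * (cos t1 * cos t2 * cnj K + sin t1 * sin t2 * (cnj a2 * x)))"
    unfolding F2' by (simp add: quat_mult algebra_simps)
  then show ?B
    unfolding arg ang r x_def[symmetric] quat_scaleR quat_diff
    by (simp add: scaleR_conv_of_real algebra_simps)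
qed

lemma inner_mult_cnj: "(cnj a * x) \<bullet> (cnj a * y) = (norm a)\<^sup>2 * (x \<bullet> y)"
  unfolding cmod_power2 by (simp add: inner_complex_def) algebra

text \<open>Orthogonality of the diagonals of a rhombus, and the parallelogram law.\<close>

lemma half_sums_orthogonal:
  fixes a1 a2 :: complex
  assumes "norm a1 = 1" "norm a2 = 1"
  shows "((a1 + a2) / 2) \<bullet> ((a1 - a2) / 2) = 0" "(norm ((a1 + a2) / 2))\<^sup>2 + (norm ((a1 - a2) / 2))\<^sup>2 = 1"
proof -
  have "a1 \<bullet> a1 = 1" "a2 \<bullet> a2 = 1" using assms by (simp_all add: norm_eq_1)
  then show "((a1 + a2) / 2) \<bullet> ((a1 - a2) / 2) = 0"
    by (simp add: inner_complex_def field_simps)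
  show "(norm ((a1 + a2) / 2))\<^sup>2 + (norm ((a1 - a2) / 2))\<^sup>2 = 1"
    using \<open>a1 \<bullet> a1 = 1\<close> \<open>a2 \<bullet> a2 = 1\<close>
    unfolding power2_norm_eq_inner by (simp add: inner_complex_def field_simps)
qed

lemma pairing_gen:
  "z \<in> Lam_dual lam1 lam2 \<longleftrightarrow> pairing z ((csqrt lam1 + csqrt lam2) / 2) \<in> \<int> \<and>
     pairing z ((csqrt lam1 - csqrt lam2) / 2) \<in> \<int>" (is "_ \<longleftrightarrow> pairing z ?k \<in> \<int> \<and> pairing z ?k' \<in> \<int>")
proof
  assume z: "z \<in> Lam_dual lam1 lam2"
  have "?k = of_int 1 * ?k + of_int 0 * ?k'" "?k' = of_int 0 * ?k + of_int 1 * ?k'" by simp_all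
  then have "?k \<in> Lam lam1 lam2" "?k' \<in> Lam lam1 lam2"
    unfolding Lam_def gen_lattice_def by blast+
  then show "pairing z ?k \<in> \<int> \<and> pairing z ?k' \<in> \<int>" using z by (simp add: Lam_dual_def)
next
  assume z: "pairing z ?k \<in> \<int> \<and> pairing z ?k' \<in> \<int>"
  have "pairing z c \<in> \<int>" if c: "c \<in> Lam lam1 lam2" for c
  proof -
    obtain m n :: int where "c = of_int m * ?k + of_int n * ?k'" using c unfolding Lam_def gen_lattice_def by blast
    then have "pairing z c = of_int m * pairing z ?k + of_int n * pairing z ?k'"
      by (simp add: pairing_def algebra_simps)
    then show ?thesis using z by (metis Ints_add Ints_mult Ints_of_int)
  qed
  then show "z \<in> Lam_dual lam1 lam2" by (simp add: Lam_dual_def)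
qed

text \<open>The vectors \<open>cnj a1 * k1\<close> and \<open>cnj a1 * k2\<close> are an orthogonal
  basis of the first complex coordinate with sum 1; \<open>\<i> * cnj k1\<close> and
  \<open>\<i> * cnj k2\<close> are one of the second. Each plane takes one vector from either
  coordinate.\<close>

lemma clifford_instance:
  assumes "norm lam1 = 1" "norm lam2 = 1" "lam1 \<noteq> lam2"
  defines "k1 \<equiv> (csqrt lam1 + csqrt lam2) / 2" and "k2 \<equiv> (csqrt lam1 - csqrt lam2) / 2"
  shows "\<exists>b1 b2 d1 d2. clifford lam1 lam2 k1 k2 b1 b2 d1 d2"
proof -
  define a1 where "a1 = csqrt lam1"
  define a2 where "a2 = csqrt lam2"
  have a: "a1\<^sup>2 = lam1" "a2\<^sup>2 = lam2" "norm a1 = 1" "norm a2 = 1"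
    using assms(1,2) norm_csqrt by (auto simp: a1_def a2_def)
  have ne: "a1 \<noteq> a2" "a1 \<noteq> - a2" using assms(3) a by auto
  have k: "k1 = (a1 + a2) / 2" "k2 = (a1 - a2) / 2" by (simp_all add: k1_def k2_def a1_def a2_def)
  have k1_nz: "k1 \<noteq> 0" and k2_nz: "k2 \<noteq> 0" using ne by (auto simp: k add_eq_0_iff2)
  have orth: "k1 \<bullet> k2 = 0" unfolding k using half_sums_orthogonal a by blast
  have a1_nz: "a1 \<noteq> 0" using a(3) by auto
  have sq: "(cnj a1 * x) \<bullet> (cnj a1 * y) = x \<bullet> y" for x y using inner_mult_cnj[of a1] a(3) by simp
  have sqi: "(\<i> * cnj x) \<bullet> (\<i> * cnj y) = x \<bullet> y" for x y by (simp add: inner_complex_def)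
  have kk: "k1 = (a1 + of_real 1 * a2) / 2" "(a1 - of_real 1 * a2) / 2 = k2"
    "k2 = (a1 + of_real (- 1) * a2) / 2" "(a1 - of_real (- 1) * a2) / 2 = k1" by (simp_all add: k)
  have e: "(1::real) = 1 \<or> (1::real) = - 1" "(- 1::real) = 1 \<or> (- 1::real) = - 1" by simp_all
  note acts = frame_action[OF a e(1) kk(1), unfolded kk(2)] frame_action[OF a e(2) kk(3), unfolded kk(4)]
  have "clifford lam1 lam2 k1 k2 (quat (cnj a1 * k1) 0) (quat 0 (\<i> * cnj k1))
      (quat (cnj a1 * k2) 0) (quat 0 (\<i> * cnj k2))"
  proof
    show "span SU2 = span {quat (cnj a1 * k1) 0, quat 0 (\<i> * cnj k1), quat (cnj a1 * k2) 0, quat 0 (\<i> * cnj k2)}"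
      (is "_ = span ?B")
    proof
      show "span ?B \<subseteq> span SU2" using quat_in_span_SU2 by (intro span_minimal) auto
      show "span SU2 \<subseteq> span ?B"
      proof
        fix p assume "p \<in> span SU2"
        then obtain u v where p: "p = quat u v" by (auto simp: span_SU2)
        have "cnj a1 * k1 \<noteq> 0" "cnj a1 * k2 \<noteq> 0" "(cnj a1 * k1) \<bullet> (cnj a1 * k2) = 0"
          using k1_nz k2_nz a1_nz orth sq by auto
        then obtain r s where u: "u = r *\<^sub>R (cnj a1 * k1) + s *\<^sub>R (cnj a1 * k2)"
          using orthogonal_decomposition by metis
        have "\<i> * cnj k1 \<noteq> 0" "\<i> * cnj k2 \<noteq> 0" "(\<i> * cnj k1) \<bullet> (\<i> * cnj k2) = 0"
          using k1_nz k2_nz orth sqi by auto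
        then obtain r' s' where v: "v = r' *\<^sub>R (\<i> * cnj k1) + s' *\<^sub>R (\<i> * cnj k2)"
          using orthogonal_decomposition by metis
        have "p = r *\<^sub>R quat (cnj a1 * k1) 0 + r' *\<^sub>R quat 0 (\<i> * cnj k1) +
            s *\<^sub>R quat (cnj a1 * k2) 0 + s' *\<^sub>R quat 0 (\<i> * cnj k2)"
          unfolding p quat_scaleR quat_add by (simp add: u v)
        moreover have "\<dots> \<in> span ?B" by (intro span_add span_scale span_base) auto
        ultimately show "p \<in> span ?B" by simp
      qed
    qed
    have "cnj a1 * k1 + cnj a1 * k2 = cnj a1 * a1" by (simp add: k field_simps)
    then show "mat 1 = quat (cnj a1 * k1) 0 + quat (cnj a1 * k2) 0"
      using cnj_mult_self(2)[OF a(3)] by (simp add: quat_one quat_add)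
    show "Lam_dual lam1 lam2 = {z. pairing z k1 \<in> \<int> \<and> pairing z k2 \<in> \<int>}"
      using pairing_gen[of _ lam1 lam2] by (auto simp: k1_def k2_def)
    have z: "(0 :: mat2) = quat 0 0" by (simp add: mat2_eq_iff)
    show "quat (cnj a1 * k1) 0 \<noteq> 0" "quat (cnj a1 * k2) 0 \<noteq> 0"
      using a1_nz k1_nz k2_nz by (simp_all add: z)
  qed (use k1_nz k2_nz orth acts in \<open>simp_all add: inner_quat sq sqi\<close>)
  then show ?thesis by blast
qed

section \<open>Spectral data\<close>

text \<open>Here a0, a1, a2 are square roots of the spectral data, so the half sums are \<kappa>1 and \<kappa>2.\<close>

definition int_rel :: "complex \<Rightarrow> complex \<Rightarrow> complex \<Rightarrow> int \<Rightarrow> int \<Rightarrow> int \<Rightarrow> bool" where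
  "int_rel a0 a1 a2 q0 q q' \<longleftrightarrow> norm a0 = 1 \<and> norm a1 = 1 \<and> norm a2 = 1 \<and> q0 \<noteq> 0 \<and>
     gcd q0 (gcd q q') = 1 \<and>
     of_int q0 * a0 = of_int q * ((a1 + a2) / 2) + of_int q' * ((a1 - a2) / 2)"

abbreviation "root_rel lam0 lam1 lam2 \<equiv> int_rel (csqrt lam0) (csqrt lam1) (csqrt lam2)"

abbreviation squares :: "complex \<Rightarrow> complex \<Rightarrow> complex \<Rightarrow> complex \<times> complex \<times> complex" where
  "squares a0 a1 a2 \<equiv> (a0\<^sup>2, a1\<^sup>2, a2\<^sup>2)"

text \<open>This discards exactly what depends on the choice of square roots and the order of the
  sym points: the signs, and the order of \<open>q\<close> and \<open>q'\<close>.\<close>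

definition ell_of :: "int \<Rightarrow> int \<Rightarrow> int \<Rightarrow> int \<times> int \<times> int" where
  "ell_of q0 q q' = (\<bar>q0\<bar>, min \<bar>q\<bar> \<bar>q'\<bar>, max \<bar>q\<bar> \<bar>q'\<bar>)"

lemma int_rel_uminus0:
  "int_rel a0 a1 a2 q0 q q' \<Longrightarrow> int_rel (- a0) a1 a2 (- q0) q q'"
  by (simp add: int_rel_def)

text \<open>The sign change of \<open>a1\<close> exchanges half sum and half difference up to sign;
  the coefficients follow.\<close>

lemma int_rel_uminus1:
  assumes "int_rel a0 a1 a2 q0 q q'"
  shows "int_rel a0 (- a1) a2 q0 (- q') (- q)"
proof -
  have "of_int (- q') * ((- a1 + a2) / 2) + of_int (- q) * ((- a1 - a2) / 2) =
      of_int q * ((a1 + a2) / 2) + of_int q' * ((a1 - a2) / 2)"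
    by (simp add: field_simps)
  then show ?thesis using assms by (simp add: int_rel_def gcd.commute[of q'])
qed

lemma int_rel_uminus2:
  "int_rel a0 a1 a2 q0 q q' \<Longrightarrow> int_rel a0 a1 (- a2) q0 q' q"
  by (simp add: int_rel_def gcd.commute[of q'] add_divide_distrib diff_divide_distrib algebra_simps)

lemma int_rel_uminus:
  assumes "int_rel a0 a1 a2 q0 q q'"
  shows "int_rel a0 a1 a2 (- q0) (- q) (- q')"
proof -
  have "of_int (- q) * ((a1 + a2) / 2) + of_int (- q') * ((a1 - a2) / 2) =
      - (of_int q * ((a1 + a2) / 2) + of_int q' * ((a1 - a2) / 2))"
    by simp
  then show ?thesis using assms by (simp add: int_rel_def)
qed

lemma int_rel_swap:
  "int_rel a0 a1 a2 q0 q q' \<Longrightarrow> int_rel a0 a2 a1 q0 q (- q')"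
  by (simp add: int_rel_def add_divide_distrib diff_divide_distrib algebra_simps)

lemma int_rel_rotate:
  assumes "int_rel a0 a1 a2 q0 q q'" "norm d = 1"
  shows "int_rel (d * a0) (d * a1) (d * a2) q0 q q'"
proof -
  have "d * (of_int q0 * a0) = d * (of_int q * ((a1 + a2) / 2) + of_int q' * ((a1 - a2) / 2))"
    using assms(1) unfolding int_rel_def by metis
  then show ?thesis using assms by (simp add: int_rel_def norm_mult field_simps)
qed

lemma int_rel_cnj:
  assumes "int_rel a0 a1 a2 q0 q q'"
  shows "int_rel (cnj a0) (cnj a1) (cnj a2) q0 q q'"
proof -
  have "cnj (of_int q0 * a0) = cnj (of_int q * ((a1 + a2) / 2) + of_int q' * ((a1 - a2) / 2))"
    using assms unfolding int_rel_def by metis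
  then show ?thesis using assms by (simp add: int_rel_def)
qed

lemma ell_of_simps: "ell_of (- q0) q q' = ell_of q0 q q'" "ell_of q0 (- q) q' = ell_of q0 q q'"
  "ell_of q0 q (- q') = ell_of q0 q q'" "ell_of q0 q' q = ell_of q0 q q'"
  by (simp_all add: ell_of_def min.commute max.commute)

lemma square_roots_cases: "a\<^sup>2 = b\<^sup>2 \<Longrightarrow> b = a \<or> b = - a" for a b :: complex
  using power2_eq_iff by metis

lemma int_rel_square_roots:
  assumes "int_rel a0 a1 a2 q0 q q'" "a0\<^sup>2 = b0\<^sup>2" "a1\<^sup>2 = b1\<^sup>2" "a2\<^sup>2 = b2\<^sup>2"
  shows "\<exists>p0 p p'. int_rel b0 b1 b2 p0 p p' \<and> ell_of p0 p p' = ell_of q0 q q'"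
proof -
  have 0: "\<exists>p0 p p'. int_rel b0 a1 a2 p0 p p' \<and> ell_of p0 p p' = ell_of q0 q q'"
    using int_rel_uminus0[OF assms(1)] assms(1) square_roots_cases[OF assms(2)] ell_of_simps by metis
  have 1: "\<exists>p0 p p'. int_rel b0 b1 a2 p0 p p' \<and> ell_of p0 p p' = ell_of q0 q q'"
    using int_rel_uminus1 0 square_roots_cases[OF assms(3)] ell_of_simps by metis
  then show ?thesis
    using int_rel_uminus2 square_roots_cases[OF assms(4)] ell_of_simps by metis
qed

definition has_ell :: "complex \<times> complex \<times> complex \<Rightarrow> int \<times> int \<times> int \<Rightarrow> bool" where
  "has_ell lam l \<longleftrightarrow> (\<exists>a0 a1 a2 q0 q q'. lam = squares a0 a1 a2 \<and>
     int_rel a0 a1 a2 q0 q q' \<and> l = ell_of q0 q q')"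

lemma has_ell_csqrt:
  "has_ell (lam0, lam1, lam2) l \<longleftrightarrow>
    (\<exists>q0 q q'. root_rel lam0 lam1 lam2 q0 q q' \<and> l = ell_of q0 q q')"
proof
  assume "has_ell (lam0, lam1, lam2) l"
  then obtain a0 a1 a2 q0 q q' where *: "lam0 = a0\<^sup>2" "lam1 = a1\<^sup>2" "lam2 = a2\<^sup>2"
    "int_rel a0 a1 a2 q0 q q'" "l = ell_of q0 q q'" unfolding has_ell_def by blast
  show "\<exists>q0 q q'. root_rel lam0 lam1 lam2 q0 q q' \<and> l = ell_of q0 q q'"
    using int_rel_square_roots[OF *(4), of "csqrt lam0" "csqrt lam1" "csqrt lam2"] *
    by (metis power2_csqrt)
next
  assume "\<exists>q0 q q'. root_rel lam0 lam1 lam2 q0 q q' \<and> l = ell_of q0 q q'"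
  then show "has_ell (lam0, lam1, lam2) l" unfolding has_ell_def
    by (metis power2_csqrt)
qed

text \<open>For unit numbers \<open>a * cnj b\<close> is the quotient of \<open>a\<close> by
  \<open>b\<close>; if it were real, it would be 1 or -1.\<close>

lemma unit_Im_nonzero:
  assumes "norm a = 1" "norm b = 1" "a\<^sup>2 \<noteq> b\<^sup>2"
  shows "Im (a * cnj b) \<noteq> 0"
proof
  assume "Im (a * cnj b) = 0"
  then have "a * cnj b = cnj (a * cnj b)" by (simp add: complex_eq_iff)
  then have "a * cnj b * (a * b) = cnj a * b * (a * b)" by simp
  moreover have "a * cnj b * (a * b) = a\<^sup>2 * (b * cnj b)" "cnj a * b * (a * b) = b\<^sup>2 * (a * cnj a)" by algebra+
  ultimately have "a\<^sup>2 = b\<^sup>2" using cnj_mult_self assms by simp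
  then show False using assms(3) by simp
qed

section \<open>The cross product and the integral relation\<close>

lemma gcd_double: "gcd (2 * a) (gcd (2 * b) (2 * c)) = 2 * gcd a (gcd b c)" for a b c :: int
  by (simp add: gcd_mult_left)

lemma ell_of_double: "(\<bar>2 * q0\<bar> div 2, min \<bar>2 * q\<bar> \<bar>2 * q'\<bar> div 2, max \<bar>2 * q\<bar> \<bar>2 * q'\<bar> div 2) = ell_of q0 q q'"
  for q0 q q' :: int
  unfolding ell_of_def by (auto simp: abs_mult min_def max_def)

text \<open>The cross product is orthogonal to its first factor for the bilinear product, so
  \<open>s0 * a0 + s1 * a1 + s2 * a2 = 0\<close>. As \<open>a1\<close> and \<open>a2\<close> are
  independent over the reals, the real relations form a line, and every integral relation is a
  multiple of the cross product. In terms of half sum and half difference, the coefficients are the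
  halves of \<open>s0\<close>, \<open>- (s1 + s2)\<close> and \<open>- (s1 - s2)\<close>.\<close>

lemma corresponds_iff_has_ell:
  assumes n: "norm lam0 = 1" "norm lam1 = 1" "norm lam2 = 1" and ne: "lam1 \<noteq> lam2"
  shows "corresponds (lam0, lam1, lam2) l \<longleftrightarrow> has_ell (lam0, lam1, lam2) l"
proof -
  define a0 where "a0 = csqrt lam0"
  define a1 where "a1 = csqrt lam1"
  define a2 where "a2 = csqrt lam2"
  have na: "norm a0 = 1" "norm a1 = 1" "norm a2 = 1" using n norm_csqrt by (auto simp: a0_def a1_def a2_def)
  have ne': "a1\<^sup>2 \<noteq> a2\<^sup>2" using ne by (simp add: a1_def a2_def)
  have im: "Im (a1 * cnj a2) \<noteq> 0" using unit_Im_nonzero na ne' by blast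
  define c0 where "c0 = a1 * cnj a2 - a2 * cnj a1"
  define c1 where "c1 = a2 * cnj a0 - a0 * cnj a2"
  define c2 where "c2 = a0 * cnj a1 - a1 * cnj a0"
  have c: "\<i> * c0 = of_real (- 2 * Im (a1 * cnj a2))" "\<i> * c1 = of_real (- 2 * Im (a2 * cnj a0))"
    "\<i> * c2 = of_real (- 2 * Im (a0 * cnj a1))"
    by (simp_all add: c0_def c1_def c2_def complex_eq_iff)
  have c0: "c0 \<noteq> 0" using c(1) im by (metis mult_zero_right of_real_eq_0_iff mult_eq_0_iff neg_equal_0_iff_equal zero_neq_numeral)
  have corr: "corresponds (lam0, lam1, lam2) l \<longleftrightarrow> (\<exists>(s0::int) (s1::int) (s2::int) (r::real).
     of_int s0 = of_real r * (\<i> * c0) \<and> of_int s1 = of_real r * (\<i> * c1) \<and> of_int s2 = of_real r * (\<i> * c2) \<and>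
     gcd s0 (gcd (s1 + s2) (s1 - s2)) = 2 \<and>
     l = (\<bar>s0\<bar> div 2, min \<bar>s1 + s2\<bar> \<bar>s1 - s2\<bar> div 2, max \<bar>s1 + s2\<bar> \<bar>s1 - s2\<bar> div 2))" (is "_ \<longleftrightarrow> ?S")
    unfolding corresponds_def c0_def c1_def c2_def a0_def a1_def a2_def by (auto simp: ccross_def)
  show ?thesis
    unfolding has_ell_csqrt corr a0_def[symmetric] a1_def[symmetric] a2_def[symmetric]
  proof
    assume ?S
    then obtain s0 s1 s2 :: int and r :: real where
      s: "of_int s0 = of_real r * (\<i> * c0)" "of_int s1 = of_real r * (\<i> * c1)" "of_int s2 = of_real r * (\<i> * c2)"
      and g: "gcd s0 (gcd (s1 + s2) (s1 - s2)) = 2"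
      and l: "l = (\<bar>s0\<bar> div 2, min \<bar>s1 + s2\<bar> \<bar>s1 - s2\<bar> div 2, max \<bar>s1 + s2\<bar> \<bar>s1 - s2\<bar> div 2)"
      by blast
    have "2 dvd s0" "2 dvd s1 + s2" "2 dvd s1 - s2" using g by (metis gcd_dvd1 gcd_dvd2 dvd_trans)+
    then obtain q0 m m' where q: "s0 = 2 * q0" "s1 + s2 = 2 * m" "s1 - s2 = 2 * m'" by (metis dvdE)
    have "r \<noteq> 0"
    proof
      assume "r = 0"
      then have "s0 = 0" "s1 = 0" "s2 = 0" using s by simp_all
      then show False using g by simp
    qed
    then have "s0 \<noteq> 0" using s(1) c0 by auto
    have "of_int s0 * a0 + of_int s1 * a1 + of_int s2 * a2 = of_real r * \<i> * (c0 * a0 + c1 * a1 + c2 * a2)"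
      unfolding s by (simp add: algebra_simps)
    also have "c0 * a0 + c1 * a1 + c2 * a2 = 0" unfolding c0_def c1_def c2_def by algebra
    finally have z: "of_int s0 * a0 + of_int s1 * a1 + of_int s2 * a2 = 0" by simp
    have s12: "s1 = m + m'" "s2 = m - m'" using q by auto
    have "of_int q0 * a0 = of_int (- m) * ((a1 + a2) / 2) + of_int (- m') * ((a1 - a2) / 2)"
      using z unfolding s12 q(1) by (simp add: field_simps) algebra
    moreover have "gcd q0 (gcd m m') = 1" using g gcd_double[of q0 m m'] unfolding q by simp
    ultimately have "int_rel a0 a1 a2 q0 (- m) (- m')"
      using na \<open>s0 \<noteq> 0\<close> q(1) by (simp add: int_rel_def)
    moreover have "l = ell_of q0 (- m) (- m')" unfolding ell_of_simps(1-3) l q by (rule ell_of_double)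
    ultimately show "\<exists>q0 q q'. int_rel a0 a1 a2 q0 q q' \<and> l = ell_of q0 q q'" by blast
  next
    assume "\<exists>q0 q q'. int_rel a0 a1 a2 q0 q q' \<and> l = ell_of q0 q q'"
    then obtain q0 q q' where h: "int_rel a0 a1 a2 q0 q q'" and l: "l = ell_of q0 q q'" by blast
    define s0 s1 s2 where "s0 = 2 * q0" "s1 = - (q + q')" "s2 = - (q - q')"
    have s: "s1 + s2 = 2 * (- q)" "s1 - s2 = 2 * (- q')" by (simp_all add: s0_s1_s2_def)
    have "of_int q0 * a0 = of_int q * ((a1 + a2) / 2) + of_int q' * ((a1 - a2) / 2)"
      using h by (simp add: int_rel_def)
    then have z: "of_int s0 * a0 + of_int s1 * a1 + of_int s2 * a2 = 0"
      unfolding s0_s1_s2_def by (simp add: field_simps) algebra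
    \<comment> \<open>The imaginary part removes the term of the root equal to \<open>b\<close>.
      Taking \<open>b\<close> as \<open>a2\<close> and as \<open>a1\<close> compares
      \<open>s1\<close> and \<open>s2\<close> with \<open>s0\<close>.\<close>
    have im': "of_int s0 * Im (a0 * cnj b) + of_int s1 * Im (a1 * cnj b) + of_int s2 * Im (a2 * cnj b) = 0" for b
    proof -
      have "of_int s0 * (a0 * cnj b) + of_int s1 * (a1 * cnj b) + of_int s2 * (a2 * cnj b) = 0"
        using arg_cong[OF z, of "\<lambda>x. x * cnj b"] by (simp add: algebra_simps)
      then have "Im (of_int s0 * (a0 * cnj b) + of_int s1 * (a1 * cnj b) + of_int s2 * (a2 * cnj b)) = 0" by simp
      then show ?thesis by simp
    qed
    define r where "r = of_int s0 / (- 2 * Im (a1 * cnj a2))"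
    have "of_int s1 * Im (a1 * cnj a2) = of_int s0 * Im (a2 * cnj a0)"
      using im'[of a2] by (simp add: algebra_simps)
    then have r1: "of_int s1 = r * (- 2 * Im (a2 * cnj a0))" using im by (simp add: r_def field_simps)
    have "of_int s2 * Im (a1 * cnj a2) = of_int s0 * Im (a0 * cnj a1)"
      using im'[of a1] by (simp add: algebra_simps)
    then have r2: "of_int s2 = r * (- 2 * Im (a0 * cnj a1))" using im by (simp add: r_def field_simps)
    have r0: "of_int s0 = r * (- 2 * Im (a1 * cnj a2))" using im by (simp add: r_def)
    have "of_int s0 = of_real r * (\<i> * c0)" "of_int s1 = of_real r * (\<i> * c1)" "of_int s2 = of_real r * (\<i> * c2)"
      unfolding c of_real_mult[symmetric] r0[symmetric] r1[symmetric] r2[symmetric] by simp_all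
    moreover have "gcd s0 (gcd (s1 + s2) (s1 - s2)) = 2"
      unfolding s unfolding s0_s1_s2_def gcd_double using h by (simp add: int_rel_def)
    moreover have "l = (\<bar>s0\<bar> div 2, min \<bar>s1 + s2\<bar> \<bar>s1 - s2\<bar> div 2, max \<bar>s1 + s2\<bar> \<bar>s1 - s2\<bar> div 2)"
      unfolding s unfolding s0_s1_s2_def(1) ell_of_double l ell_of_simps(1-3) ..
    ultimately show ?S by blast
  qed
qed

text \<open>The moves lift to the square roots: multiplication by a root of \<delta>, complex
  conjugation, and an exchange, of which only the last changes the relation, by the sign of
  \<open>q'\<close>.\<close>

lemma has_ell_spec_equiv:
  assumes "spec_equiv lam lam'" "has_ell lam l"
  shows "has_ell lam' l"
  using assms
proof (induction rule: spec_equiv.induct)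
  case (rotation a b c \<delta>)
  then obtain a0 a1 a2 q0 q q' where *: "a = a0\<^sup>2" "b = a1\<^sup>2" "c = a2\<^sup>2"
    "int_rel a0 a1 a2 q0 q q'" "l = ell_of q0 q q'" unfolding has_ell_def by blast
  have "int_rel (csqrt \<delta> * a0) (csqrt \<delta> * a1) (csqrt \<delta> * a2) q0 q q'"
    using int_rel_rotate[OF *(4)] norm_csqrt[OF rotation.hyps(2)] .
  moreover have "(\<delta> * a, \<delta> * b, \<delta> * c) = ((csqrt \<delta> * a0)\<^sup>2, (csqrt \<delta> * a1)\<^sup>2, (csqrt \<delta> * a2)\<^sup>2)"
    by (simp add: * power_mult_distrib)
  ultimately show ?case unfolding has_ell_def using *(5) by blast
next
  case (inversion a b c)
  then obtain a0 a1 a2 q0 q q' where *: "a = a0\<^sup>2" "b = a1\<^sup>2" "c = a2\<^sup>2"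
    "int_rel a0 a1 a2 q0 q q'" "l = ell_of q0 q q'" unfolding has_ell_def by blast
  have "inverse z = cnj z" if "norm z = 1" for z using cnj_mult_self(1)[OF that] by (rule inverse_unique)
  then have "(inverse a, inverse b, inverse c) = ((cnj a0)\<^sup>2, (cnj a1)\<^sup>2, (cnj a2)\<^sup>2)"
    using *(4) by (simp add: * int_rel_def flip: power_inverse)
  then show ?case unfolding has_ell_def using int_rel_cnj[OF *(4)] *(5) by blast
next
  case (swapping a b c)
  then obtain a0 a1 a2 q0 q q' where *: "a = a0\<^sup>2" "b = a1\<^sup>2" "c = a2\<^sup>2"
    "int_rel a0 a1 a2 q0 q q'" "l = ell_of q0 q q'" unfolding has_ell_def by blast
  then show ?case unfolding has_ell_def using int_rel_swap[OF *(4)] ell_of_simps by metis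
qed

section \<open>Uniqueness, range and existence of the integral relation\<close>

lemma dvd_if_dvd_mult_gcd:
  fixes a b c d :: int
  assumes "gcd a (gcd b c) = 1" "a dvd d * b" "a dvd d * c"
  shows "a dvd d"
proof -
  have "a dvd gcd (d * b) (d * c)" using assms(2,3) by (rule gcd_greatest)
  then have "a dvd d * gcd b c" by (simp only: gcd_mult_left dvd_normalize_iff)
  moreover have "coprime a (gcd b c)" using assms(1) by (simp only: coprime_iff_gcd_eq_1)
  ultimately show ?thesis by (simp only: coprime_dvd_mult_left_iff)
qed

text \<open>Eliminating \<open>a0\<close> from the two relations leaves a real relation between half
  sum and half difference, which are independent. So the triples are proportional, and primitive
  proportional triples agree up to a common sign.\<close>

lemma ell_unique:
  assumes h: "int_rel a0 a1 a2 q0 q q'" "int_rel a0 a1 a2 p0 p p'" and ne: "a1\<^sup>2 \<noteq> a2\<^sup>2"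
  shows "ell_of q0 q q' = ell_of p0 p p'"
proof -
  have im: "Im (a1 * cnj a2) \<noteq> 0" using unit_Im_nonzero h(1) ne by (auto simp: int_rel_def)
  have e: "of_int q0 * a0 = of_int q * ((a1 + a2) / 2) + of_int q' * ((a1 - a2) / 2)"
    "of_int p0 * a0 = of_int p * ((a1 + a2) / 2) + of_int p' * ((a1 - a2) / 2)"
    using h by (auto simp: int_rel_def)
  define u where "u = real_of_int (q0 * p - p0 * q)"
  define v where "v = real_of_int (q0 * p' - p0 * q')"
  define X Y where "X = (a1 + a2) / 2" "Y = (a1 - a2) / 2"
  have a12: "a1 = X + Y" "a2 = X - Y" by (simp_all add: X_Y_def field_simps)
  have "of_int q0 * (of_int p * X + of_int p' * Y) = of_int p0 * (of_int q * X + of_int q' * Y)"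
    unfolding e[folded X_Y_def, symmetric] by (simp only: mult.left_commute)
  then have "of_real u * X + of_real v * Y = 0"
    unfolding u_def v_def by (simp add: algebra_simps)
  moreover have "of_real (u + v) * a1 + of_real (u - v) * a2 = 2 * (of_real u * X + of_real v * Y)"
    unfolding a12 by (simp add: algebra_simps)
  ultimately have z: "of_real (u + v) * a1 + of_real (u - v) * a2 = 0" by simp
  have "Im ((of_real s * a1 + of_real t * a2) * cnj a2) = s * Im (a1 * cnj a2)"
    "Im ((of_real s * a1 + of_real t * a2) * cnj a1) = t * Im (a2 * cnj a1)" for s t
    by (simp_all add: algebra_simps)
  from this[of "u + v" "u - v", unfolded z]
  have "(u + v) * Im (a1 * cnj a2) = 0" "(u - v) * Im (a2 * cnj a1) = 0" by simp_all
  moreover have "Im (a2 * cnj a1) = - Im (a1 * cnj a2)" by simp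
  then have "Im (a2 * cnj a1) \<noteq> 0" using im by (simp only: neg_equal_0_iff_equal not_False_eq_True)
  ultimately have "u + v = 0" "u - v = 0" using im by (metis mult_eq_0_iff)+
  then have "u = 0" "v = 0" by linarith+
  then have r: "q0 * p = p0 * q" "q0 * p' = p0 * q'" unfolding u_def v_def by (simp_all only: of_int_eq_0_iff right_minus_eq)
  have g: "gcd q0 (gcd q q') = 1" "gcd p0 (gcd p p') = 1" "q0 \<noteq> 0" "p0 \<noteq> 0" using h by (auto simp: int_rel_def)
  have "q0 dvd p0"
    using g(1) dvdI[OF r(1)[symmetric]] dvdI[OF r(2)[symmetric]] by (rule dvd_if_dvd_mult_gcd)
  moreover have "p0 dvd q0"
    using g(2) dvdI[OF r(1)] dvdI[OF r(2)] by (rule dvd_if_dvd_mult_gcd)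
  ultimately have a: "\<bar>q0\<bar> = \<bar>p0\<bar>" by (rule zdvd_antisym_abs)
  have "\<bar>q0\<bar> * \<bar>p\<bar> = \<bar>p0\<bar> * \<bar>q\<bar>" "\<bar>q0\<bar> * \<bar>p'\<bar> = \<bar>p0\<bar> * \<bar>q'\<bar>"
    unfolding abs_mult[symmetric] r by (rule HOL.refl)+
  note n = this[unfolded a]
  have nz: "\<bar>p0\<bar> \<noteq> 0" using g(4) by simp
  note * = mult_left_cancel[OF nz, THEN iffD1, OF n(1)] mult_left_cancel[OF nz, THEN iffD1, OF n(2)]
  show ?thesis by (simp only: ell_of_def a *)
qed

lemma has_ell_unique:
  assumes "has_ell (lam0, lam1, lam2) l" "has_ell (lam0, lam1, lam2) l'" "lam1 \<noteq> lam2"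
  shows "l = l'"
proof -
  obtain q0 q q' p0 p p' where
    *: "root_rel lam0 lam1 lam2 q0 q q'" "l = ell_of q0 q q'"
    "root_rel lam0 lam1 lam2 p0 p p'" "l' = ell_of p0 p p'"
    using assms(1,2) unfolding has_ell_csqrt by blast
  have "(csqrt lam1)\<^sup>2 \<noteq> (csqrt lam2)\<^sup>2" using assms(3) by simp
  from ell_unique[OF *(1,3) this] show ?thesis unfolding *(2,4) .
qed

lemma int_rel_norm:
  assumes "int_rel a0 a1 a2 q0 q q'"
  shows "(real_of_int q0)\<^sup>2 = (real_of_int q)\<^sup>2 * (norm ((a1 + a2) / 2))\<^sup>2 + (real_of_int q')\<^sup>2 * (norm ((a1 - a2) / 2))\<^sup>2"
proof -
  define X Y where XY: "X = (a1 + a2) / 2" "Y = (a1 - a2) / 2"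
  have n: "norm a0 = 1" "norm a1 = 1" "norm a2 = 1" and e: "of_int q0 * a0 = of_int q * X + of_int q' * Y"
    using assms by (auto simp: int_rel_def XY)
  have orth: "X \<bullet> Y = 0" using half_sums_orthogonal(1)[OF n(2,3)] by (simp add: XY)
  have "real_of_int q0 *\<^sub>R a0 = real_of_int q *\<^sub>R X + real_of_int q' *\<^sub>R Y"
    using e by (simp add: scaleR_conv_of_real)
  then have "(norm (real_of_int q0 *\<^sub>R a0))\<^sup>2 = (norm (real_of_int q *\<^sub>R X + real_of_int q' *\<^sub>R Y))\<^sup>2"
    by (rule arg_cong)
  also have "\<dots> = (norm (real_of_int q *\<^sub>R X))\<^sup>2 + (norm (real_of_int q' *\<^sub>R Y))\<^sup>2"
    by (rule norm_add_Pythagorean) (simp add: orthogonal_def orth)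
  finally show ?thesis using n by (simp add: power_mult_distrib flip: XY)
qed

text \<open>The square of \<open>q0\<close> is a mean of the squares of \<open>q\<close> and
  \<open>q'\<close> with positive weights. So the absolute value of \<open>q0\<close> lies strictly
  between the other two unless all three are equal.\<close>

lemma ell_of_in_ell_triples:
  assumes h: "int_rel a0 a1 a2 q0 q q'" and ne: "a0\<^sup>2 \<noteq> a1\<^sup>2" "a0\<^sup>2 \<noteq> a2\<^sup>2" "a1\<^sup>2 \<noteq> a2\<^sup>2"
  shows "ell_of q0 q q' \<in> ell_triples"
proof -
  define X Y where XY: "X = (a1 + a2) / 2" "Y = (a1 - a2) / 2"
  have n: "norm a1 = 1" "norm a2 = 1" "q0 \<noteq> 0" "gcd q0 (gcd q q') = 1" and e: "of_int q0 * a0 = of_int q * X + of_int q' * Y"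
    using h by (auto simp: int_rel_def XY)
  define A B where AB: "A = (norm X)\<^sup>2" "B = (norm Y)\<^sup>2"
  have sum: "A + B = 1" using half_sums_orthogonal(2)[OF n(1,2)] by (simp add: AB XY)
  have "X \<noteq> 0" "Y \<noteq> 0" using ne(3) by (auto simp: XY add_eq_0_iff2)
  then have pos: "A > 0" "B > 0" by (simp_all add: AB)
  have nrm: "(real_of_int q0)\<^sup>2 = (real_of_int q)\<^sup>2 * A + (real_of_int q')\<^sup>2 * B"
    using int_rel_norm[OF h] by (simp only: XY AB)
  have A: "A = 1 - B" using sum by simp
  have key: "((real_of_int q0)\<^sup>2 - (real_of_int q)\<^sup>2) * A = ((real_of_int q')\<^sup>2 - (real_of_int q0)\<^sup>2) * B"
    using nrm unfolding A by (simp add: algebra_simps)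
  have sq: "(real_of_int x)\<^sup>2 \<le> (real_of_int y)\<^sup>2 \<longleftrightarrow> \<bar>x\<bar> \<le> \<bar>y\<bar>" for x y
    unfolding abs_le_square_iff[symmetric] of_int_abs[symmetric] of_int_le_iff by (rule HOL.refl)
  have le: "\<bar>q\<bar> \<le> \<bar>q0\<bar> \<longleftrightarrow> \<bar>q0\<bar> \<le> \<bar>q'\<bar>"
  proof -
    have "\<bar>q\<bar> \<le> \<bar>q0\<bar> \<longleftrightarrow> 0 \<le> ((real_of_int q0)\<^sup>2 - (real_of_int q)\<^sup>2) * A"
      using pos by (simp add: zero_le_mult_iff sq)
    also have "\<dots> \<longleftrightarrow> \<bar>q0\<bar> \<le> \<bar>q'\<bar>"
      unfolding key using pos by (simp add: zero_le_mult_iff sq)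
    finally show ?thesis .
  qed
  have ge: "\<bar>q0\<bar> \<le> \<bar>q\<bar> \<longleftrightarrow> \<bar>q'\<bar> \<le> \<bar>q0\<bar>"
  proof -
    have "\<bar>q0\<bar> \<le> \<bar>q\<bar> \<longleftrightarrow> ((real_of_int q0)\<^sup>2 - (real_of_int q)\<^sup>2) * A \<le> 0"
      using pos by (simp add: mult_le_0_iff sq)
    also have "\<dots> \<longleftrightarrow> \<bar>q'\<bar> \<le> \<bar>q0\<bar>"
      unfolding key using pos by (simp add: mult_le_0_iff sq)
    finally show ?thesis .
  qed
  \<comment> \<open>Equality of the three absolute values would give \<open>a0\<close> as plus or
    minus \<open>X + Y = a1\<close> or \<open>X - Y = a2\<close>, that is, a double point at a sym
    point.\<close>
  have ne': "\<not> (\<bar>q\<bar> = \<bar>q0\<bar> \<and> \<bar>q'\<bar> = \<bar>q0\<bar>)"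
  proof
    assume "\<bar>q\<bar> = \<bar>q0\<bar> \<and> \<bar>q'\<bar> = \<bar>q0\<bar>"
    then have "(q = q0 \<or> q = - q0) \<and> (q' = q0 \<or> q' = - q0)" by (simp only: abs_eq_iff)
    then have "of_int q0 * a0 = of_int q0 * (X + Y) \<or> of_int q0 * a0 = of_int q0 * (- (X + Y)) \<or>
       of_int q0 * a0 = of_int q0 * (X - Y) \<or> of_int q0 * a0 = of_int q0 * (- (X - Y))"
      unfolding e by (auto simp: algebra_simps)
    then have "a0 = X + Y \<or> a0 = - (X + Y) \<or> a0 = X - Y \<or> a0 = - (X - Y)"
      using n(3) by (simp only: mult_cancel_left of_int_eq_0_iff) simp
    moreover have "X + Y = a1" "X - Y = a2" by (simp_all add: XY field_simps)
    ultimately have "a0\<^sup>2 = a1\<^sup>2 \<or> a0\<^sup>2 = a2\<^sup>2" by (metis power2_minus)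
    then show False using ne by simp
  qed
  show ?thesis
  proof (cases "\<bar>q\<bar> \<le> \<bar>q0\<bar>")
    case True
    then have "\<bar>q\<bar> < \<bar>q0\<bar>" "\<bar>q0\<bar> < \<bar>q'\<bar>" using le ge ne' by linarith+
    then have "ell_of q0 q q' = (\<bar>q0\<bar>, \<bar>q\<bar>, \<bar>q'\<bar>)" by (simp add: ell_of_def)
    then show ?thesis using n(4) \<open>\<bar>q\<bar> < \<bar>q0\<bar>\<close> \<open>\<bar>q0\<bar> < \<bar>q'\<bar>\<close> by (simp add: ell_triples_def)
  next
    case False
    then have "\<bar>q'\<bar> < \<bar>q0\<bar>" "\<bar>q0\<bar> < \<bar>q\<bar>" using le ge by linarith+
    then have "ell_of q0 q q' = (\<bar>q0\<bar>, \<bar>q'\<bar>, \<bar>q\<bar>)" by (simp add: ell_of_def)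
    then show ?thesis using n(4) \<open>\<bar>q'\<bar> < \<bar>q0\<bar>\<close> \<open>\<bar>q0\<bar> < \<bar>q\<bar>\<close>
      by (simp add: ell_triples_def gcd.commute[of q'])
  qed
qed

text \<open>Write \<open>a0 = r *\<^sub>R X + s *\<^sub>R Y\<close>. Pairing with the two generators
  of the lattice gives two equations for r and s with integer coefficients, and Cramer's rule gives
  \<open>D\<close>, \<open>E\<close>, \<open>F\<close>. The determinant \<open>D\<close> is nonzero
  since the generators and the pair \<open>X\<close>, \<open>Y\<close> are both independent.\<close>

lemma exists_int_rel:
  assumes sd: "(lam0, lam1, lam2) \<in> spectral_data"
  shows "\<exists>q0 q q'. root_rel lam0 lam1 lam2 q0 q q'"
proof -
  define a0 a1 a2 where a: "a0 = csqrt lam0" "a1 = csqrt lam1" "a2 = csqrt lam2"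
  define X Y where XY: "X = (a1 + a2) / 2" "Y = (a1 - a2) / 2"
  have n: "norm a0 = 1" "norm a1 = 1" "norm a2 = 1" "lam1 \<noteq> lam2"
    using sd norm_csqrt by (auto simp: spectral_data_def a)
  obtain g h where gh: "Im (g * cnj h) \<noteq> 0" "gen_lattice g h \<subseteq> Lam_dual lam1 lam2"
    "double_point (gen_lattice g h) lam0"
    using sd by (auto simp: spectral_data_def is_lattice_def)
  have "g = of_int 1 * g + of_int 0 * h" "h = of_int 0 * g + of_int 1 * h" by simp_all
  then have "g \<in> gen_lattice g h" "h \<in> gen_lattice g h" unfolding gen_lattice_def by blast+
  then have ints: "pairing v X \<in> \<int>" "pairing v Y \<in> \<int>" "pairing v a0 \<in> \<int>" if "v \<in> {g, h}" for v
    using that gh(2,3) pairing_gen[of v lam1 lam2] by (auto simp: double_point_def a XY)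
  obtain m n p m' n' p' :: int where mn: "pairing g X = of_int m" "pairing g Y = of_int n" "pairing g a0 = of_int p"
    "pairing h X = of_int m'" "pairing h Y = of_int n'" "pairing h a0 = of_int p'"
    using ints[of g] ints[of h] by (auto elim!: Ints_cases)
  have "a1 \<noteq> a2" "a1 \<noteq> - a2" using n(4) by (metis a(2,3) power2_csqrt power2_minus)+
  then have nz: "X \<noteq> 0" "Y \<noteq> 0" by (auto simp: XY add_eq_0_iff2)
  have orth: "X \<bullet> Y = 0" using half_sums_orthogonal(1)[OF n(2,3)] by (simp add: XY)
  obtain r s where rs: "a0 = r *\<^sub>R X + s *\<^sub>R Y" using orthogonal_decomposition[OF nz orth] by metis
  have lin: "pairing v a0 = r * pairing v X + s * pairing v Y" for v
    unfolding rs by (simp add: pairing_eq_inner inner_simps)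
  have p: "of_int p = r * of_int m + s * of_int n" "of_int p' = r * of_int m' + s * of_int n'"
    using lin[of g] lin[of h] by (simp_all only: mn)
  define D E F where DEF: "D = m * n' - m' * n" "E = p * n' - p' * n" "F = m * p' - m' * p"
  have "real_of_int D = 4 * (Im (g * cnj h) * Im (X * cnj Y))"
  proof -
    have "real_of_int D = pairing g X * pairing h Y - pairing h X * pairing g Y" unfolding DEF mn by simp
    then show ?thesis by (simp add: pairing_def algebra_simps)
  qed
  moreover have "Im (X * cnj Y) \<noteq> 0"
  proof
    assume "Im (X * cnj Y) = 0"
    then have "X * cnj Y = 0" using orth by (simp add: complex_eq_iff inner_complex_def)
    then show False using nz by simp
  qed
  ultimately have "D \<noteq> 0" using gh(1) by auto
  have rs': "of_int D * r = of_int E" "of_int D * s = of_int F"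
    unfolding DEF of_int_diff of_int_mult p by (simp_all add: algebra_simps)
  have "of_real (of_int D) * a0 = of_real (of_int D * r) * X + of_real (of_int D * s) * Y"
    unfolding rs by (simp add: scaleR_conv_of_real algebra_simps)
  then have rel: "of_int D * a0 = of_int E * X + of_int F * Y"
    by (simp only: rs' of_real_of_int_eq)
  \<comment> \<open>Cramer's rule gives some integral relation; division by the gcd makes it
    primitive.\<close>
  define d where "d = gcd D (gcd E F)"
  have "d \<noteq> 0" using \<open>D \<noteq> 0\<close> by (simp add: d_def)
  have "d dvd D" "d dvd E" "d dvd F" unfolding d_def by (meson gcd_dvd1 gcd_dvd2 dvd_trans)+
  then obtain q0 q q' where q: "D = d * q0" "E = d * q" "F = d * q'" by (metis dvdE)
  have "\<bar>d\<bar> = d" by (simp add: d_def)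
  then have "d * gcd q0 (gcd q q') = gcd (d * q0) (gcd (d * q) (d * q'))"
    by (simp only: gcd_mult_distrib_int[symmetric])
  also have "\<dots> = d * 1"
    unfolding q[symmetric] mult_1_right by (rule d_def[symmetric])
  finally have "d * gcd q0 (gcd q q') = d * 1" .
  then have "gcd q0 (gcd q q') = 1" by (rule mult_left_cancel[OF \<open>d \<noteq> 0\<close>, THEN iffD1])
  moreover have "of_int d * (of_int q0 * a0) = of_int d * (of_int q * X + of_int q' * Y)"
    using rel unfolding q by (simp add: algebra_simps)
  then have "of_int q0 * a0 = of_int q * X + of_int q' * Y" using \<open>d \<noteq> 0\<close> by simp
  moreover have "q0 \<noteq> 0" using \<open>D \<noteq> 0\<close> q(1) by auto
  ultimately have "int_rel a0 a1 a2 q0 q q'" using n by (simp add: int_rel_def XY)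
  then show ?thesis unfolding a by blast
qed

text \<open>Pairing a lattice point with the relation turns integrality at the double point into
  divisibility by \<open>q0\<close>. The two instances serve the two axes and have \<open>q\<close>
  and \<open>q'\<close> exchanged.\<close>

lemma clifford_cover_instance:
  assumes "norm lam1 = 1" "norm lam2 = 1" "lam1 \<noteq> lam2"
    and h: "root_rel lam0 lam1 lam2 q0 q q'" and q0: "q0 > 0"
  obtains k1 k2 b1 b2 d1 d2 where "clifford_cover lam1 lam2 k1 k2 b1 b2 d1 d2 (max_lattice (lam0, lam1, lam2)) q0 q q'"
    "clifford_cover lam1 lam2 k2 k1 d1 d2 b1 b2 (max_lattice (lam0, lam1, lam2)) q0 q' q"
proof -
  define k1 where "k1 = (csqrt lam1 + csqrt lam2) / 2"
  define k2 where "k2 = (csqrt lam1 - csqrt lam2) / 2"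
  obtain b1 b2 d1 d2 where c: "clifford lam1 lam2 k1 k2 b1 b2 d1 d2"
    using clifford_instance[OF assms(1-3)] unfolding k1_def k2_def by blast
  have g: "gcd q0 (gcd q q') = 1" using h by (simp add: int_rel_def)
  have a0: "of_int q0 * csqrt lam0 = of_int q * k1 + of_int q' * k2"
    using h by (simp add: int_rel_def k1_def k2_def)
  have lin: "of_int q0 * pairing z (csqrt lam0) = of_int q * pairing z k1 + of_int q' * pairing z k2" for z
  proof -
    have "pairing z (of_int q0 * csqrt lam0) = pairing z (of_int q * k1 + of_int q' * k2)" by (simp only: a0)
    then show ?thesis by (simp add: pairing_def algebra_simps)
  qed
  have iff: "pairing z (csqrt lam0) \<in> \<int> \<longleftrightarrow> q0 dvd q * m + q' * n"
    if mn: "pairing z k1 = of_int m" "pairing z k2 = of_int n" for z m n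
  proof -
    have e: "of_int q0 * pairing z (csqrt lam0) = of_int (q * m + q' * n)" using lin[of z] by (simp add: mn)
    show ?thesis
    proof
      assume "pairing z (csqrt lam0) \<in> \<int>"
      then obtain j where "pairing z (csqrt lam0) = of_int j" by (auto elim: Ints_cases)
      then have "real_of_int (q0 * j) = of_int (q * m + q' * n)" using e by simp
      then have "q0 * j = q * m + q' * n" by (simp only: of_int_eq_iff)
      then show "q0 dvd q * m + q' * n" by (metis dvd_triv_left)
    next
      assume "q0 dvd q * m + q' * n"
      then obtain j where "q * m + q' * n = q0 * j" by (rule dvdE)
      then have "of_int q0 * pairing z (csqrt lam0) = of_int q0 * of_int j" using e by simp
      then have "pairing z (csqrt lam0) = of_int j" using q0 by simp
      then show "pairing z (csqrt lam0) \<in> \<int>" by simp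
    qed
  qed
  have lat: "max_lattice (lam0, lam1, lam2) =
      {z. \<exists>m n. pairing z k1 = of_int m \<and> pairing z k2 = of_int n \<and> q0 dvd q * m + q' * n}"
    (is "_ = ?L")
  proof (intro set_eqI iffI)
    fix z assume z: "z \<in> max_lattice (lam0, lam1, lam2)"
    then have "pairing z k1 \<in> \<int>" "pairing z k2 \<in> \<int>" "pairing z (csqrt lam0) \<in> \<int>"
      by (auto simp: max_lattice_def k1_def k2_def pairing_gen)
    moreover from this obtain m n :: int where mn: "pairing z k1 = of_int m" "pairing z k2 = of_int n"
      by (auto elim!: Ints_cases)
    ultimately show "z \<in> ?L" using iff[OF mn] by blast
  next
    fix z assume "z \<in> ?L"
    then obtain m n :: int where mn: "pairing z k1 = of_int m" "pairing z k2 = of_int n" "q0 dvd q * m + q' * n" by blast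
    then have "pairing z (csqrt lam0) \<in> \<int>" using iff by blast
    moreover have "z \<in> Lam_dual lam1 lam2" using mn by (simp add: pairing_gen flip: k1_def k2_def)
    ultimately show "z \<in> max_lattice (lam0, lam1, lam2)" by (simp add: max_lattice_def)
  qed
  have 1: "clifford_cover lam1 lam2 k1 k2 b1 b2 d1 d2 (max_lattice (lam0, lam1, lam2)) q0 q q'"
    unfolding clifford_cover_def clifford_cover_axioms_def using c q0 g lat by blast
  have "max_lattice (lam0, lam1, lam2) =
      {z. \<exists>m n. pairing z k2 = of_int m \<and> pairing z k1 = of_int n \<and> q0 dvd q' * m + q * n}"
    unfolding lat by (auto simp: add.commute)
  moreover have "gcd q0 (gcd q' q) = 1" using g by (simp only: gcd.commute[of q' q])
  ultimately have "clifford_cover lam1 lam2 k2 k1 d1 d2 b1 b2 (max_lattice (lam0, lam1, lam2)) q0 q' q"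
    unfolding clifford_cover_def clifford_cover_axioms_def using clifford.swap[OF c] q0 by blast
  with 1 show ?thesis by (rule that)
qed

text \<open>The maximal lattice is the witness; an integral relation is what makes it a
  lattice.\<close>

lemma spectral_dataI:
  assumes h: "int_rel a0 a1 a2 q0 q q'" and ne: "a0\<^sup>2 \<noteq> a1\<^sup>2" "a0\<^sup>2 \<noteq> a2\<^sup>2" "a1\<^sup>2 \<noteq> a2\<^sup>2"
  shows "(squares a0 a1 a2) \<in> spectral_data"
proof -
  obtain p0 p p' where h': "root_rel (a0\<^sup>2) (a1\<^sup>2) (a2\<^sup>2) p0 p p'"
    using int_rel_square_roots[OF h, of "csqrt (a0\<^sup>2)" "csqrt (a1\<^sup>2)" "csqrt (a2\<^sup>2)"] by auto
  have n: "norm (a0\<^sup>2) = 1" "norm (a1\<^sup>2) = 1" "norm (a2\<^sup>2) = 1"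
    using h by (auto simp: int_rel_def norm_power)
  \<comment> \<open>The locale asks for a positive first coefficient; a common change of sign
    provides it.\<close>
  have "\<exists>p0 p p'. root_rel (a0\<^sup>2) (a1\<^sup>2) (a2\<^sup>2) p0 p p' \<and> p0 > 0"
  proof (cases "p0 > 0")
    case False
    moreover have "p0 \<noteq> 0" using h' by (simp add: int_rel_def)
    ultimately show ?thesis using int_rel_uminus[OF h'] by (intro exI conjI) auto
  qed (use h' in blast)
  then obtain p0 p p' where h': "root_rel (a0\<^sup>2) (a1\<^sup>2) (a2\<^sup>2) p0 p p'" "p0 > 0" by blast
  have "is_lattice (max_lattice (squares a0 a1 a2))"
    by (rule clifford_cover_instance[OF n(2,3) ne(3) h'], rule clifford_cover.is_lattice_\<Gamma>)
  moreover have "max_lattice (squares a0 a1 a2) \<subseteq> Lam_dual (a1\<^sup>2) (a2\<^sup>2)"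
    "double_point (max_lattice (squares a0 a1 a2)) (a0\<^sup>2)"
    by (auto simp: max_lattice_def double_point_def)
  ultimately show ?thesis using n ne by (auto simp: spectral_data_def)
qed

section \<open>Rotational tori\<close>

text \<open>On the unit circle the radicand is a quarter of the squared chord from
  \<open>lam\<close> to 1, and the principal root of a nonnegative real is nonnegative.\<close>

lemma nu_eq:
  assumes "norm lam = 1"
  shows "nu lam = of_real (norm (lam - 1) / 2)"
proof -
  have "inverse lam = cnj lam" using cnj_mult_self(1)[OF assms] by (rule inverse_unique)
  then have "1 / 4 * (lam - 1) * (inverse lam - 1) = 1 / 4 * ((lam - 1) * cnj (lam - 1))" by simp
  also have "\<dots> = of_real ((norm (lam - 1) / 2)\<^sup>2)"
    unfolding complex_norm_square[symmetric] by (simp add: power_divide)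
  finally show ?thesis unfolding nu_def by (simp only: csqrt_of_real_nonneg zero_le_power2) simp
qed

lemma geodesic_nonempty:
  assumes "geodesic A"
  obtains p where "p \<in> A" "p \<in> SU2"
proof -
  obtain W where W: "subspace W" "W \<subseteq> span SU2" "dim W = 2" "A = SU2 \<inter> W"
    using assms by (auto simp: geodesic_subsphere_def)
  have "W \<noteq> {0}"
  proof
    assume "W = {0}"
    then have "dim W = 0" by simp
    then show False using W(3) by simp
  qed
  then obtain v where v: "v \<in> W" "v \<noteq> 0" using W(1) subspace_0 by blast
  define p where "p = (sqrt 2 / norm v) *\<^sub>R v"
  have pW: "p \<in> W" unfolding p_def by (rule subspace_scale[OF W(1) v(1)])
  have "norm p = sqrt 2" using v(2) by (simp add: p_def)
  then have "p \<bullet> p = 2" by (simp add: norm_eq_sqrt_inner)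
  then have "p \<in> SU2" using pW W(2) by (auto simp: mem_SU2_iff)
  then show ?thesis using pW W(4) that by blast
qed

lemma rotational_action:
  "exp_e0 (of_real s) ** quat a b ** exp_e0 (- of_real t) = quat (cis (s - t) * a) (cis (s + t) * b)"
proof -
  have "exp_e0 (- of_real t) = quat (cis (- t)) 0" using exp_e0_of_real[of "- t"] by simp
  moreover have "cis (s - t) = cis s * cis (- t)" "cis (s + t) = cis s * cis t" by (simp_all add: cis_mult)
  ultimately show ?thesis
    by (simp add: exp_e0_of_real quat_mult cis_cnj)
qed

lemma cis_pi_multiple_eq_1:
  assumes "\<And>x::real. cis (x * c) = 1"
  shows "c = 0"
proof (rule ccontr)
  assume "c \<noteq> 0"
  then have "cis pi = 1" using assms[of "pi / c"] by simp
  then show False by simp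
qed

text \<open>On \<open>quat a b\<close> the group acts by the phases \<open>x * (u - v)\<close> and
  \<open>x * (u + v)\<close>, where \<open>u\<close> and \<open>v\<close> are half chords and hence
  positive. A fixed point therefore has \<open>b = 0\<close> and forces \<open>u = v\<close>;
  conversely the circle \<open>b = 0\<close> is then fixed. For distinct sym points equal chords
  mean that they are mirror images in the line through 0 and \<open>lam0\<close>.\<close>

lemma rotational_iff:
  assumes n: "norm lam0 = 1" "norm lam1 = 1" "norm lam2 = 1" and ne: "lam0 \<noteq> lam1" "lam0 \<noteq> lam2"
  shows "rotational (lam0, lam1, lam2) \<longleftrightarrow> norm (lam1 - lam0) = norm (lam2 - lam0)"
proof -
  define u where "u = norm (lam1 - lam0) / 2"
  define v where "v = norm (lam2 - lam0) / 2"
  have nz: "lam0 \<noteq> 0" using n by auto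
  have nrm: "norm (lam / lam0 - 1) = norm (lam - lam0)" for lam
  proof -
    have "lam / lam0 - 1 = (lam - lam0) / lam0" using nz by (simp add: field_simps)
    then show ?thesis using n by (simp add: norm_divide)
  qed
  have nu: "nu (lam1 / lam0) = of_real u" "nu (lam2 / lam0) = of_real v"
    using n by (simp_all add: nu_eq nrm norm_divide u_def v_def)
  have pos: "u > 0" "v > 0" using ne by (simp_all add: u_def v_def)
  have rot: "rotational (lam0, lam1, lam2) \<longleftrightarrow> (\<exists>A. geodesic A \<and> (\<forall>p\<in>A. \<forall>x::real.
     exp_e0 (of_real (x * u)) ** p ** exp_e0 (- of_real (x * v)) = p))"
    unfolding rotational_def nu prod.case of_real_mult ..
  have "rotational (lam0, lam1, lam2) \<longleftrightarrow> u = v"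
  proof
    assume "rotational (lam0, lam1, lam2)"
    then obtain A where A: "geodesic A"
      "\<And>p x. p \<in> A \<Longrightarrow> exp_e0 (of_real (x * u)) ** p ** exp_e0 (- of_real (x * v)) = p"
      unfolding rot by blast
    obtain p where p: "p \<in> A" "p \<in> SU2" using geodesic_nonempty[OF A(1)] by blast
    then obtain a b where ab: "p = quat a b" "(norm a)\<^sup>2 + (norm b)\<^sup>2 = 1" by (auto simp: SU2_iff)
    have e: "cis (x * (u - v)) * a = a" "cis (x * (u + v)) * b = b" for x
      using A(2)[OF p(1), of x] unfolding ab(1) rotational_action by (simp_all add: algebra_simps)
    have "b = 0"
    proof (rule ccontr)
      assume "b \<noteq> 0"
      then have "cis (x * (u + v)) = 1" for x using e(2)[of x] by simp
      then have "u + v = 0" by (rule cis_pi_multiple_eq_1)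
      then show False using pos by simp
    qed
    then have "a \<noteq> 0" using ab(2) by auto
    then have "cis (x * (u - v)) = 1" for x using e(1)[of x] by simp
    then have "u - v = 0" by (rule cis_pi_multiple_eq_1)
    then show "u = v" by simp
  next
    assume uv: "u = v"
    define A where "A = SU2 \<inter> span {quat 1 0, quat \<i> 0}"
    have "quat 1 0 \<bullet> quat \<i> 0 = 0" by (simp add: inner_quat inner_complex_def)
    moreover have "quat 1 0 \<bullet> quat 1 0 = 2" "quat \<i> 0 \<bullet> quat \<i> 0 = 2" by (simp_all add: inner_quat inner_complex_def)
    then have "quat 1 0 \<noteq> 0" "quat \<i> 0 \<noteq> 0" by auto
    ultimately have "dim (span {quat 1 0, quat \<i> 0}) = 2" by (rule orthogonal_pair_independent)
    moreover have "span {quat 1 0, quat \<i> 0} \<subseteq> span SU2" using quat_in_span_SU2 by (intro span_minimal) auto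
    ultimately have "geodesic A"
      unfolding geodesic_subsphere_def A_def by (intro exI[of _ "span {quat 1 0, quat \<i> 0}"]) simp
    moreover have "exp_e0 (of_real (x * u)) ** p ** exp_e0 (- of_real (x * v)) = p" if "p \<in> A" for p x
    proof -
      have "p \<in> span {quat 1 0, quat \<i> 0}" using that by (simp add: A_def)
      then obtain y z where "p = quat (y *\<^sub>R 1 + z *\<^sub>R \<i>) 0"
        by (auto simp: mem_span_pair quat_scaleR quat_add)
      then show ?thesis unfolding uv by (simp only: rotational_action) simp
    qed
    ultimately show "rotational (lam0, lam1, lam2)" unfolding rot by blast
  qed
  then show ?thesis by (simp add: u_def v_def)
qed

text \<open>A chord of the unit circle is twice the sine of half the angle, and the square roots
  carry the half angles.\<close>

lemma norm_square_diff:
  assumes "norm a = 1" "norm b = 1"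
  shows "norm (a\<^sup>2 - b\<^sup>2) = 2 * \<bar>Im (a * cnj b)\<bar>"
proof -
  have "a\<^sup>2 - b\<^sup>2 = a\<^sup>2 * (b * cnj b) - b\<^sup>2 * (a * cnj a)" using assms by (simp add: cnj_mult_self)
  also have "\<dots> = a * b * (a * cnj b - cnj (a * cnj b))" by (simp add: power2_eq_square algebra_simps)
  also have "a * cnj b - cnj (a * cnj b) = 2 * \<i> * of_real (Im (a * cnj b))" by (simp add: complex_eq_iff)
  finally show ?thesis by (simp only: norm_mult norm_of_real assms norm_ii norm_numeral mult_1 mult_1_right)
qed

text \<open>The relation, multiplied by \<open>2 * cnj a0\<close>, has real right-hand side, so
  \<open>(q + q') * I1 + (q - q') * I2 = 0\<close>. Equal chords mean \<open>I1 = I2\<close>, which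
  leaves \<open>q = 0\<close>, or \<open>I1 = - I2\<close>, which leaves
  \<open>q' = 0\<close>.\<close>

lemma rotational_iff_ell:
  assumes h: "int_rel a0 a1 a2 q0 q q'" and ne: "a0\<^sup>2 \<noteq> a1\<^sup>2" "a0\<^sup>2 \<noteq> a2\<^sup>2"
  shows "rotational (squares a0 a1 a2) \<longleftrightarrow> min \<bar>q\<bar> \<bar>q'\<bar> = 0"
proof -
  have n: "norm a0 = 1" "norm a1 = 1" "norm a2 = 1" "q0 \<noteq> 0"
    and e: "of_int q0 * a0 = of_int q * ((a1 + a2) / 2) + of_int q' * ((a1 - a2) / 2)"
    using h by (auto simp: int_rel_def)
  define I1 where "I1 = Im (a1 * cnj a0)"
  define I2 where "I2 = Im (a2 * cnj a0)"
  have nz: "I1 \<noteq> 0" "I2 \<noteq> 0" using unit_Im_nonzero n ne by (auto simp: I1_def I2_def)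
  have rot: "rotational (squares a0 a1 a2) \<longleftrightarrow> \<bar>I1\<bar> = \<bar>I2\<bar>"
    using n ne by (simp add: rotational_iff norm_square_diff norm_power I1_def I2_def)
  have "(of_int q + of_int q') * (a1 * cnj a0) + (of_int q - of_int q') * (a2 * cnj a0) =
    2 * (of_int q * ((a1 + a2) / 2) + of_int q' * ((a1 - a2) / 2)) * cnj a0"
    by (simp add: field_simps)
  also have "\<dots> = 2 * of_int q0 * (a0 * cnj a0)" unfolding e[symmetric] by simp
  also have "\<dots> = of_int (2 * q0)" using cnj_mult_self n by simp
  finally have "Im ((of_int q + of_int q') * (a1 * cnj a0) + (of_int q - of_int q') * (a2 * cnj a0)) = Im (of_int (2 * q0))"
    by (rule arg_cong)
  moreover have "Im ((of_int q + of_int q') * (a1 * cnj a0) + (of_int q - of_int q') * (a2 * cnj a0)) =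
     (of_int q + of_int q') * I1 + (of_int q - of_int q') * I2"
    unfolding I1_def I2_def by (simp add: algebra_simps)
  ultimately have lin: "(real_of_int q + of_int q') * I1 + (of_int q - of_int q') * I2 = 0" by simp
  have "\<not> (q = 0 \<and> q' = 0)"
  proof
    assume "q = 0 \<and> q' = 0"
    then have "of_int q0 * a0 = 0" using e by simp
    then show False using n by auto
  qed
  have "\<bar>I1\<bar> = \<bar>I2\<bar> \<longleftrightarrow> q = 0 \<or> q' = 0"
  proof
    assume "\<bar>I1\<bar> = \<bar>I2\<bar>"
    then consider "I1 = I2" | "I1 = - I2" by (auto simp: abs_eq_iff)
    then show "q = 0 \<or> q' = 0"
    proof cases
      case 1
      then have "2 * (real_of_int q * I2) = 0" using lin by (simp add: algebra_simps)
      then show ?thesis using nz by simp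
    next
      case 2
      then have "2 * (real_of_int q' * I2) = 0" using lin by (simp add: algebra_simps)
      then show ?thesis using nz by simp
    qed
  next
    assume "q = 0 \<or> q' = 0"
    then show "\<bar>I1\<bar> = \<bar>I2\<bar>"
    proof
      assume "q = 0"
      then have "real_of_int q' * (I1 - I2) = 0" "q' \<noteq> 0" using lin \<open>\<not> (q = 0 \<and> q' = 0)\<close> by (auto simp: algebra_simps)
      then show ?thesis by simp
    next
      assume "q' = 0"
      then have "real_of_int q * (I1 + I2) = 0" "q \<noteq> 0" using lin \<open>\<not> (q = 0 \<and> q' = 0)\<close> by (auto simp: algebra_simps)
      then show ?thesis by (simp add: add_eq_0_iff2)
    qed
  qed
  also have "\<dots> \<longleftrightarrow> min \<bar>q\<bar> \<bar>q'\<bar> = 0" by (auto simp: min_def)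
  finally show ?thesis unfolding rot .
qed

section \<open>Normal forms\<close>

text \<open>The square roots for which \<kappa>1 is a positive real x and \<kappa>2 is \<open>\<i> y\<close> with y > 0. The lengths
  solve x^2 + y^2 = 1 and l0^2 = l1^2 x^2 + l2^2 y^2.\<close>

definition normal_form :: "int \<Rightarrow> int \<Rightarrow> int \<Rightarrow> complex \<times> complex \<times> complex" where
  "normal_form l0 l1 l2 =
    (let x = sqrt ((of_int l2 ^ 2 - of_int l0 ^ 2) / (of_int l2 ^ 2 - of_int l1 ^ 2));
         y = sqrt ((of_int l0 ^ 2 - of_int l1 ^ 2) / (of_int l2 ^ 2 - of_int l1 ^ 2))
     in (Complex (of_int l1 * x / of_int l0) (of_int l2 * y / of_int l0), Complex x y, Complex x (- y)))"

lemma normal_formE: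
  assumes "normal_form l0 l1 l2 = (a0, a1, a2)" "(l0, l1, l2) \<in> ell_triples"
  obtains x y where "x > 0" "y > 0" "x\<^sup>2 + y\<^sup>2 = 1" "(real_of_int l0)\<^sup>2 = (of_int l1 * x)\<^sup>2 + (of_int l2 * y)\<^sup>2"
    "a0 = Complex (of_int l1 * x / of_int l0) (of_int l2 * y / of_int l0)" "a1 = Complex x y" "a2 = Complex x (- y)"
    "x\<^sup>2 = (of_int l2 ^ 2 - of_int l0 ^ 2) / (of_int l2 ^ 2 - of_int l1 ^ 2)"
proof -
  have l: "0 \<le> l1" "l1 < l0" "l0 < l2" using assms(2) by (auto simp: ell_triples_def)
  define p where "p = (real_of_int l2)\<^sup>2 - (real_of_int l0)\<^sup>2"
  define r where "r = (real_of_int l0)\<^sup>2 - (real_of_int l1)\<^sup>2"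
  have "(real_of_int l1)\<^sup>2 < (real_of_int l0)\<^sup>2" "(real_of_int l0)\<^sup>2 < (real_of_int l2)\<^sup>2"
    using l by (auto intro!: power_strict_mono)
  then have pr: "p > 0" "r > 0" by (simp_all add: p_def r_def)
  define x where "x = sqrt (p / (p + r))"
  define y where "y = sqrt (r / (p + r))"
  have sum: "(real_of_int l2)\<^sup>2 - (real_of_int l1)\<^sup>2 = p + r" by (simp add: p_def r_def)
  have sq: "x\<^sup>2 = p / (p + r)" "y\<^sup>2 = r / (p + r)" using pr by (simp_all add: x_def y_def)
  have "x\<^sup>2 + y\<^sup>2 = (p + r) / (p + r)" unfolding sq by (rule add_divide_distrib[symmetric])
  then have s1: "x\<^sup>2 + y\<^sup>2 = 1" using pr by simp
  have "(real_of_int l1)\<^sup>2 * p + (of_int l2)\<^sup>2 * r = (of_int l0)\<^sup>2 * (p + r)"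
    unfolding p_def r_def by (simp add: algebra_simps)
  then have "(real_of_int l0)\<^sup>2 = ((of_int l1)\<^sup>2 * p + (of_int l2)\<^sup>2 * r) / (p + r)"
    using pr by (simp add: eq_divide_eq)
  then have s2: "(real_of_int l0)\<^sup>2 = (of_int l1 * x)\<^sup>2 + (of_int l2 * y)\<^sup>2"
    unfolding power_mult_distrib sq by (simp add: add_divide_distrib)
  have "x > 0" "y > 0" using pr by (simp_all add: x_def y_def)
  moreover have "a0 = Complex (of_int l1 * x / of_int l0) (of_int l2 * y / of_int l0)" "a1 = Complex x y" "a2 = Complex x (- y)"
    using assms(1) unfolding normal_form_def Let_def sum p_def[symmetric] r_def[symmetric] x_def[symmetric] y_def[symmetric]
    by simp_all
  moreover have "x\<^sup>2 = (of_int l2 ^ 2 - of_int l0 ^ 2) / (of_int l2 ^ 2 - of_int l1 ^ 2)"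
    unfolding sum sq p_def[symmetric] ..
  ultimately show ?thesis using s1 s2 that by blast
qed

lemma normal_form_relation:
  assumes nf: "normal_form l0 l1 l2 = (a0, a1, a2)" and l: "(l0, l1, l2) \<in> ell_triples"
  shows "int_rel a0 a1 a2 l0 l1 l2" "a0\<^sup>2 \<noteq> a1\<^sup>2" "a0\<^sup>2 \<noteq> a2\<^sup>2" "a1\<^sup>2 \<noteq> a2\<^sup>2"
proof -
  obtain x y where xy: "x > 0" "y > 0" "x\<^sup>2 + y\<^sup>2 = 1" "(real_of_int l0)\<^sup>2 = (of_int l1 * x)\<^sup>2 + (of_int l2 * y)\<^sup>2"
    and a: "a0 = Complex (of_int l1 * x / of_int l0) (of_int l2 * y / of_int l0)" "a1 = Complex x y" "a2 = Complex x (- y)"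
    using normal_formE[OF nf l] by metis
  have l': "0 \<le> l1" "l1 < l0" "l0 < l2" "gcd l0 (gcd l1 l2) = 1" using l by (auto simp: ell_triples_def)
  have "(norm a0)\<^sup>2 = ((of_int l1 * x)\<^sup>2 + (of_int l2 * y)\<^sup>2) / (of_int l0)\<^sup>2"
    by (simp add: a cmod_power2 power_divide add_divide_distrib)
  also have "\<dots> = 1" unfolding xy(4)[symmetric] using l' by simp
  finally have "norm a0 = 1" by (metis norm_ge_zero one_power2 power2_eq_iff_nonneg zero_le_one)
  moreover have "norm a1 = 1" "norm a2 = 1" using xy(3) by (simp_all add: a cmod_def)
  moreover have "of_int l0 * a0 = of_int l1 * ((a1 + a2) / 2) + of_int l2 * ((a1 - a2) / 2)"
    using l' by (simp add: a complex_eq_iff)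
  ultimately show "int_rel a0 a1 a2 l0 l1 l2" using l' by (simp add: int_rel_def)
  \<comment> \<open>The real part of \<open>a0\<close> is \<open>l1 / l0\<close> times
    \<open>x\<close>, and \<open>l1 < l0\<close> keeps it away from the real parts of
    \<open>a1\<close>, \<open>a2\<close> and their negatives.\<close>
  have "a0 \<noteq> b" if "\<bar>Re b\<bar> = x" for b
  proof
    assume "a0 = b"
    then have "\<bar>Re a0\<bar> = x" using that by simp
    then have "\<bar>of_int l1 * x / of_int l0\<bar> = x" by (simp only: a complex.sel)
    then have "of_int l1 * x = of_int l0 * x" using l' xy(1) by (simp add: abs_mult field_simps)
    then show False using xy(1) l' by simp
  qed
  from this[of a1] this[of "- a1"] this[of a2] this[of "- a2"] show "a0\<^sup>2 \<noteq> a1\<^sup>2" "a0\<^sup>2 \<noteq> a2\<^sup>2"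
    using xy(1) by (simp_all add: a(2,3) power2_eq_iff)
  have "a1 \<noteq> a2" "a1 \<noteq> - a2" using xy(1,2) by (simp_all add: a(2,3) complex_eq_iff)
  then show "a1\<^sup>2 \<noteq> a2\<^sup>2" by (simp add: power2_eq_iff)
qed

text \<open>Other signs of the square roots leave the spectral data fixed and already yield a sign
  of \<open>q0\<close> and the exchange of \<open>q\<close> and \<open>q'\<close>. The sign of
  \<open>q'\<close> needs the swap of the sym points. Together these moves reach the sorted absolute
  values.\<close>

lemma spec_equiv_ell_signs:
  assumes "int_rel a0 a1 a2 q0 q q'" "ell_of q0 q q' = (l0, l1, l2)"
  shows "\<exists>b0 b1 b2. spec_equiv (squares a0 a1 a2) (squares b0 b1 b2) \<and> int_rel b0 b1 b2 l0 l1 l2"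
proof -
  define P where "P q0 q q' \<longleftrightarrow> (\<exists>b0 b1 b2. spec_equiv (squares a0 a1 a2) (squares b0 b1 b2) \<and> int_rel b0 b1 b2 q0 q q')" for q0 q q'
  have "P q0 q q'" unfolding P_def using assms(1) spec_equiv.refl by blast
  have P0: "P (- q0) q q'" if "P q0 q q'" for q0 q q'
    using that int_rel_uminus0 unfolding P_def by (metis power2_minus)
  have P1: "P q0 q' q" if "P q0 q q'" for q0 q q'
    using that int_rel_uminus2 unfolding P_def by (metis power2_minus)
  have P2: "P q0 q (- q')" if "P q0 q q'" for q0 q q'
    using that int_rel_swap spec_equiv.swapping unfolding P_def by metis
  have "P \<bar>q0\<bar> q q'" using \<open>P q0 q q'\<close> P0 by (cases "q0 \<ge> 0") auto
  then have "P \<bar>q0\<bar> q \<bar>q'\<bar>" using P2 by (cases "q' \<ge> 0") auto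
  then have "P \<bar>q0\<bar> \<bar>q'\<bar> q" by (rule P1)
  then have *: "P \<bar>q0\<bar> \<bar>q'\<bar> \<bar>q\<bar>" using P2 by (cases "q \<ge> 0") auto
  then have "P \<bar>q0\<bar> \<bar>q\<bar> \<bar>q'\<bar>" by (rule P1)
  with * have "P \<bar>q0\<bar> (min \<bar>q\<bar> \<bar>q'\<bar>) (max \<bar>q\<bar> \<bar>q'\<bar>)" by (simp add: min_def max_def)
  then show ?thesis using assms(2) by (simp add: P_def ell_of_def)
qed

text \<open>The squared lengths of \<open>X\<close> and \<open>Y\<close> satisfy two linear
  equations with determinant \<open>l2^2 - l1^2\<close>, which is not 0, so they are those of the
  normal form. Once \<open>X\<close> is rotated to the positive real axis, only the sign of
  \<open>Y\<close> on the imaginary axis is open.\<close>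

lemma spec_equiv_normal_form:
  assumes h: "int_rel b0 b1 b2 l0 l1 l2" and l: "(l0, l1, l2) \<in> ell_triples"
    and nf: "normal_form l0 l1 l2 = (a0, a1, a2)"
  shows "spec_equiv (squares b0 b1 b2) (squares a0 a1 a2)"
proof -
  obtain x y where xy: "x > 0" "y > 0" "x\<^sup>2 + y\<^sup>2 = 1" "(real_of_int l0)\<^sup>2 = (of_int l1 * x)\<^sup>2 + (of_int l2 * y)\<^sup>2"
    and a: "a0 = Complex (of_int l1 * x / of_int l0) (of_int l2 * y / of_int l0)" "a1 = Complex x y" "a2 = Complex x (- y)"
    and x2: "x\<^sup>2 = (of_int l2 ^ 2 - of_int l0 ^ 2) / (of_int l2 ^ 2 - of_int l1 ^ 2)"
    by (rule normal_formE[OF nf l]) (rule that)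
  have l': "0 \<le> l1" "l1 < l0" "l0 < l2" using l by (auto simp: ell_triples_def)
  define X Y where XY: "X = (b1 + b2) / 2" "Y = (b1 - b2) / 2"
  have n: "norm b0 = 1" "norm b1 = 1" "norm b2 = 1" and e: "of_int l0 * b0 = of_int l1 * X + of_int l2 * Y"
    using h by (auto simp: int_rel_def XY)
  have orth: "X \<bullet> Y = 0" and sum: "(norm X)\<^sup>2 + (norm Y)\<^sup>2 = 1"
    using half_sums_orthogonal[OF n(2,3)] by (auto simp: XY)
  have nrm: "(real_of_int l0)\<^sup>2 = (of_int l1)\<^sup>2 * (norm X)\<^sup>2 + (of_int l2)\<^sup>2 * (norm Y)\<^sup>2"
    using int_rel_norm[OF h] by (simp only: XY)
  have "(real_of_int l1)\<^sup>2 < (of_int l2)\<^sup>2" using l' by (auto intro!: power_strict_mono)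
  then have dn: "(real_of_int l2)\<^sup>2 - (of_int l1)\<^sup>2 \<noteq> 0" by simp
  have Y2: "(norm Y)\<^sup>2 = 1 - (norm X)\<^sup>2" using sum by simp
  have "(norm X)\<^sup>2 * ((of_int l2)\<^sup>2 - (of_int l1)\<^sup>2) = (real_of_int l2)\<^sup>2 - (of_int l0)\<^sup>2"
    unfolding nrm Y2 by (simp add: algebra_simps)
  then have "(norm X)\<^sup>2 = x\<^sup>2" unfolding x2 using dn by (simp add: eq_divide_eq)
  then have X: "norm X = x" using xy(1) by simp
  then have "(norm Y)\<^sup>2 = y\<^sup>2" using Y2 xy(3) by simp
  then have Y: "norm Y = y" using xy(2) by simp
  \<comment> \<open>The rotation of the square roots that makes \<open>X\<close> real and positive;
    on the spectral data it acts by its square.\<close>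
  define d where "d = cnj X / of_real x"
  have nd: "norm d = 1" using xy(1) X by (simp add: d_def norm_divide)
  have dX: "d * X = of_real x"
  proof -
    have "cnj X * X = of_real (x\<^sup>2)" using complex_norm_square[of X] X by (simp add: mult.commute)
    then show ?thesis using xy(1) by (simp add: d_def power2_eq_square)
  qed
  have "Re (d * Y) = 0"
  proof -
    have "Re (cnj X * Y) = 0" using orth by (simp add: inner_complex_def)
    then show ?thesis by (simp add: d_def)
  qed
  moreover have "norm (d * Y) = y" using nd Y by (simp add: norm_mult)
  ultimately have "\<bar>Im (d * Y)\<bar> = y" by (simp add: cmod_def)
  then have dY: "d * Y = \<i> * of_real y \<or> d * Y = - (\<i> * of_real y)"
    using \<open>Re (d * Y) = 0\<close> by (auto simp: complex_eq_iff abs_if split: if_splits)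
  have b: "d * b1 = d * X + d * Y" "d * b2 = d * X - d * Y" by (simp_all add: XY field_simps)
  have "of_int l0 * (d * b0) = of_int l1 * (d * X) + of_int l2 * (d * Y)"
    using arg_cong[OF e, of "\<lambda>z. d * z"] by (simp add: algebra_simps)
  then have b0: "d * b0 = (of_int l1 * (d * X) + of_int l2 * (d * Y)) / of_int l0"
    using l' by (simp add: field_simps)
  have "norm (d\<^sup>2) = 1" using nd by (simp add: norm_power)
  from spec_equiv.rotation[OF spec_equiv.refl this, of "b0\<^sup>2" "b1\<^sup>2" "b2\<^sup>2"]
  have rot: "spec_equiv (squares b0 b1 b2) ((d * b0)\<^sup>2, (d * b1)\<^sup>2, (d * b2)\<^sup>2)"
    by (simp only: power_mult_distrib)
  have a': "a0 = (of_int l1 * of_real x + of_int l2 * (\<i> * of_real y)) / of_int l0"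
    "a1 = of_real x + \<i> * of_real y" "a2 = of_real x - \<i> * of_real y"
    using l' by (simp_all add: a complex_eq_iff)
  from dY show ?thesis
  proof
    assume "d * Y = \<i> * of_real y"
    then have "d * b0 = a0" "d * b1 = a1" "d * b2 = a2" unfolding b0 b dX a' by simp_all
    then show ?thesis using rot by simp
  next
    \<comment> \<open>The wrong sign of \<open>Y\<close> gives the complex conjugate of the normal
      form, which on the unit circle is removed by inversion.\<close>
    assume "d * Y = - (\<i> * of_real y)"
    then have c: "d * b0 = cnj a0" "d * b1 = cnj a1" "d * b2 = cnj a2"
      unfolding b0 b dX a' by simp_all
    have "norm a0 = 1" "norm a1 = 1" "norm a2 = 1"
      using normal_form_relation(1)[OF nf l] by (auto simp: int_rel_def)
    then have "inverse (cnj z) = z" if "z \<in> {a0, a1, a2}" for z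
      using that cnj_mult_self(2)[of z] by (intro inverse_unique) auto
    then have "inverse ((cnj a0)\<^sup>2) = a0\<^sup>2" "inverse ((cnj a1)\<^sup>2) = a1\<^sup>2" "inverse ((cnj a2)\<^sup>2) = a2\<^sup>2"
      by (simp_all flip: power_inverse)
    then show ?thesis using spec_equiv.inversion[OF rot[unfolded c]] by simp
  qed
qed

section \<open>Classes of spectral data and integer triples\<close>

lemma spectral_dataD:
  assumes "(lam0, lam1, lam2) \<in> spectral_data"
  shows "norm lam0 = 1" "norm lam1 = 1" "norm lam2 = 1" "lam0 \<noteq> lam1" "lam0 \<noteq> lam2" "lam1 \<noteq> lam2"
  using assms by (auto simp: spectral_data_def)

lemma spectral_has_ell:
  assumes "lam \<in> spectral_data"
  shows "\<exists>!l. has_ell lam l" "has_ell lam l \<Longrightarrow> l \<in> ell_triples" "corresponds lam l \<longleftrightarrow> has_ell lam l"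
proof -
  obtain lam0 lam1 lam2 where lam: "lam = (lam0, lam1, lam2)" by (cases lam)
  note sd = spectral_dataD[OF assms[unfolded lam]]
  have "\<exists>l. has_ell lam l" using exists_int_rel[OF assms[unfolded lam]] unfolding lam has_ell_csqrt by blast
  then show "\<exists>!l. has_ell lam l" using has_ell_unique[OF _ _ sd(6)] unfolding lam by blast
  show "corresponds lam l \<longleftrightarrow> has_ell lam l" unfolding lam using sd by (intro corresponds_iff_has_ell)
  assume "has_ell lam l"
  then obtain q0 q q' where q: "root_rel lam0 lam1 lam2 q0 q q'" "l = ell_of q0 q q'"
    unfolding lam has_ell_csqrt by blast
  show "l \<in> ell_triples" unfolding q(2) by (rule ell_of_in_ell_triples[OF q(1)]) (use sd in simp_all)
qed

lemma has_ell_spec_equiv_normal_form: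
  assumes lam: "lam \<in> spectral_data" "has_ell lam (l0, l1, l2)" and nf: "normal_form l0 l1 l2 = (a0, a1, a2)"
  shows "spec_equiv lam (squares a0 a1 a2)"
proof -
  obtain c0 c1 c2 q0 q q' where c: "lam = (squares c0 c1 c2)" "int_rel c0 c1 c2 q0 q q'" "ell_of q0 q q' = (l0, l1, l2)"
    using lam(2) unfolding has_ell_def by metis
  obtain b0 b1 b2 where b: "spec_equiv lam (squares b0 b1 b2)" "int_rel b0 b1 b2 l0 l1 l2"
    using spec_equiv_ell_signs[OF c(2,3)] c(1) by blast
  have "spec_equiv (squares b0 b1 b2) (squares a0 a1 a2)"
    using spec_equiv_normal_form[OF b(2) spectral_has_ell(2)[OF lam] nf] .
  \<comment> \<open>Transitivity; the rules of \<open>spec_equiv\<close> extend a chain at its right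
    end, so the induction is over the second relation.\<close>
  then show ?thesis using b(1)
    by (induction rule: spec_equiv.induct) (auto intro: spec_equiv.intros)
qed

text \<open>The triple can be read off any representative of a class, by invariance and uniqueness
  of \<open>has_ell\<close>. Two classes with the same triple contain the same normal form, and the
  normal form of an admissible triple is itself a spectral datum.\<close>

lemma spectral_data_bijection:
  "\<exists>\<Phi>. bij_betw \<Phi> (spectral_data // spec_rel) ell_triples \<and>
     (\<forall>lam\<in>spectral_data. \<forall>l. corresponds lam l \<longleftrightarrow> l = \<Phi> (spec_rel `` {lam}))"
proof -
  define \<Phi> where "\<Phi> X = (THE l. \<exists>lam\<in>X. has_ell lam l)" for X
  have \<Phi>: "\<Phi> (spec_rel `` {lam}) = l" if lam: "lam \<in> spectral_data" and l: "has_ell lam l" for lam l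
    unfolding \<Phi>_def
  proof (rule the_equality)
    have "lam \<in> spec_rel `` {lam}" using lam equiv_spec_rel by (rule_tac equiv_class_self)
    then show "\<exists>lam\<in>spec_rel `` {lam}. has_ell lam l" using l by blast
    fix l' assume "\<exists>lam\<in>spec_rel `` {lam}. has_ell lam l'"
    then obtain lam' where lam': "(lam, lam') \<in> spec_rel" "has_ell lam' l'" by blast
    then have "(lam', lam) \<in> spec_rel" using equiv_spec_rel by (meson equivE symD)
    then have "has_ell lam l'" using has_ell_spec_equiv[OF _ lam'(2)] by (simp add: spec_rel_def)
    then show "l' = l" using spectral_has_ell(1)[OF lam] l by blast
  qed
  have inj: "inj_on \<Phi> (spectral_data // spec_rel)"
  proof (rule inj_onI)
    fix X Y assume XY: "X \<in> spectral_data // spec_rel" "Y \<in> spectral_data // spec_rel" "\<Phi> X = \<Phi> Y"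
    obtain lam mu where lm: "lam \<in> spectral_data" "X = spec_rel `` {lam}" "mu \<in> spectral_data" "Y = spec_rel `` {mu}"
      using XY(1,2) by (auto elim!: quotientE)
    obtain l0 l1 l2 where l: "has_ell lam (l0, l1, l2)" using spectral_has_ell(1)[OF lm(1)] by (metis prod_cases3)
    obtain l' where l': "has_ell mu l'" using spectral_has_ell(1)[OF lm(3)] by blast
    have "l' = (l0, l1, l2)" using XY(3) \<Phi>[OF lm(1) l] \<Phi>[OF lm(3) l'] lm by simp
    with l' have m: "has_ell mu (l0, l1, l2)" by simp
    obtain a0 a1 a2 where nf: "normal_form l0 l1 l2 = (a0, a1, a2)" by (metis prod_cases3)
    have "(squares a0 a1 a2) \<in> spectral_data"
      using normal_form_relation[OF nf spectral_has_ell(2)[OF lm(1) l]] by (rule spectral_dataI)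
    then have "(lam, (squares a0 a1 a2)) \<in> spec_rel" "(mu, (squares a0 a1 a2)) \<in> spec_rel"
      using has_ell_spec_equiv_normal_form[OF lm(1) l nf] has_ell_spec_equiv_normal_form[OF lm(3) m nf] lm
      by (simp_all add: spec_rel_def)
    then show "X = Y" using equiv_spec_rel lm by (metis equiv_class_eq)
  qed
  have "\<Phi> ` (spectral_data // spec_rel) = ell_triples"
  proof (intro set_eqI iffI)
    fix l assume "l \<in> \<Phi> ` (spectral_data // spec_rel)"
    then obtain lam where lam: "lam \<in> spectral_data" "l = \<Phi> (spec_rel `` {lam})" by (auto elim!: quotientE)
    obtain l' where "has_ell lam l'" using spectral_has_ell(1)[OF lam(1)] by blast
    then show "l \<in> ell_triples" using \<Phi>[OF lam(1)] spectral_has_ell(2)[OF lam(1)] lam(2) by simp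
  next
    fix l assume l: "l \<in> ell_triples"
    obtain l0 l1 l2 where l_eq: "l = (l0, l1, l2)" by (cases l)
    obtain a0 a1 a2 where nf: "normal_form l0 l1 l2 = (a0, a1, a2)" by (metis prod_cases3)
    note rel = normal_form_relation[OF nf l[unfolded l_eq]]
    have sd: "(squares a0 a1 a2) \<in> spectral_data" by (rule spectral_dataI[OF rel])
    have "l = ell_of l0 l1 l2" using l by (auto simp: l_eq ell_of_def ell_triples_def)
    then have "has_ell (squares a0 a1 a2) l" using rel(1) unfolding has_ell_def by blast
    then have "l = \<Phi> (spec_rel `` {(squares a0 a1 a2)})" using \<Phi>[OF sd] by simp
    moreover have "spec_rel `` {(squares a0 a1 a2)} \<in> spectral_data // spec_rel" using sd by (rule quotientI)
    ultimately show "l \<in> \<Phi> ` (spectral_data // spec_rel)" by blast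
  qed
  with inj have "bij_betw \<Phi> (spectral_data // spec_rel) ell_triples" by (simp add: bij_betw_def)
  moreover have "corresponds lam l \<longleftrightarrow> l = \<Phi> (spec_rel `` {lam})" if lam: "lam \<in> spectral_data" for lam l
    using \<Phi>[OF lam] spectral_has_ell(1,3)[OF lam] by metis
  ultimately show ?thesis by blast
qed

lemma corresponds_positive:
  assumes "(lam0, lam1, lam2) \<in> spectral_data" "corresponds (lam0, lam1, lam2) l"
  obtains q0 q q' where "q0 > 0" "root_rel lam0 lam1 lam2 q0 q q'" "l = ell_of q0 q q'"
proof -
  obtain q0 q q' where q: "root_rel lam0 lam1 lam2 q0 q q'" "l = ell_of q0 q q'"
    using spectral_has_ell(3)[OF assms(1)] assms(2) unfolding has_ell_csqrt by blast
  have "q0 \<noteq> 0" using q(1) by (simp add: int_rel_def)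
  then consider "q0 > 0" | "- q0 > 0" by linarith
  then show ?thesis
  proof cases
    case 2
    show ?thesis by (rule that[OF 2 int_rel_uminus[OF q(1)]]) (simp only: q(2) ell_of_simps(1-3))
  qed (use q that in blast)
qed

lemma l1_zero_iff_rotational:
  assumes "lam \<in> spectral_data" "corresponds lam (l0, l1, l2)"
  shows "l1 = 0 \<longleftrightarrow> rotational lam"
proof -
  obtain a0 a1 a2 q0 q q' where a: "lam = (squares a0 a1 a2)" "int_rel a0 a1 a2 q0 q q'" "(l0, l1, l2) = ell_of q0 q q'"
    using spectral_has_ell(3)[OF assms(1)] assms(2) unfolding has_ell_def by blast
  have "rotational lam \<longleftrightarrow> min \<bar>q\<bar> \<bar>q'\<bar> = 0"
    unfolding a(1) using spectral_dataD(4,5)[OF assms(1)[unfolded a(1)]] by (rule rotational_iff_ell[OF a(2)])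
  moreover have "l1 = min \<bar>q\<bar> \<bar>q'\<bar>" using a(3) by (simp add: ell_of_def)
  ultimately show ?thesis by (simp only:)
qed

theorem theorem4p2:
  shows
    "(\<exists>\<Phi>. bij_betw \<Phi> (spectral_data // spec_rel) ell_triples \<and>
        (\<forall>lam\<in>spectral_data. \<forall>l. corresponds lam l \<longleftrightarrow> l = \<Phi> (spec_rel `` {lam})))
   \<and> (\<forall>lam0 lam1 lam2 l0 l1 l2 \<Gamma>.
        (lam0, lam1, lam2) \<in> spectral_data \<longrightarrow> corresponds (lam0, lam1, lam2) (l0, l1, l2) \<longrightarrow>
        \<Gamma> = max_lattice (lam0, lam1, lam2) \<longrightarrow>
        is_lattice \<Gamma> \<and>
        is_rectangular_lattice (Lam_dual lam1 lam2) \<and>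
        embedding_map (torus (Lam_dual lam1 lam2)) (top_of_set SU2) (descend (flat_cmc lam1 lam2)) \<and>
        sheeted_covering (nat l0) (torus \<Gamma>) (torus (Lam_dual lam1 lam2))
          (descend (torus_pt (Lam_dual lam1 lam2))) \<and>
        (\<forall>x\<in>topspace (torus \<Gamma>).
           descend (flat_cmc lam1 lam2) (descend (torus_pt (Lam_dual lam1 lam2)) x) =
           descend (flat_cmc lam1 lam2) x) \<and>
        (\<exists>A1 A2. A1 \<noteq> A2 \<and> {A. is_axis lam1 lam2 A} = {A1, A2} \<and>
           (\<forall>(A, l)\<in>{(A1, l1), (A2, l2)}. \<forall>H. hemisphere A H \<longrightarrow>
              has_total_turning_number lam1 lam2 \<Gamma> A H (of_int l0) \<and>
              is_union_of_wrapped_circles lam1 lam2 \<Gamma> H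
                (nat (gcd l0 l)) (nat (l0 div gcd l0 l)))))
   \<and> (\<forall>lam l0 l1 l2.
        lam \<in> spectral_data \<longrightarrow> corresponds lam (l0, l1, l2) \<longrightarrow> (l1 = 0 \<longleftrightarrow> rotational lam))"
proof (intro conjI spectral_data_bijection allI impI ballI)
  fix lam0 lam1 lam2 l0 l1 l2 \<Gamma>
  assume sd: "(lam0, lam1, lam2) \<in> spectral_data" and c: "corresponds (lam0, lam1, lam2) (l0, l1, l2)"
    and \<Gamma>: "\<Gamma> = max_lattice (lam0, lam1, lam2)"
  obtain q0 q q' where q0: "q0 > 0" and h: "root_rel lam0 lam1 lam2 q0 q q'"
    and l: "(l0, l1, l2) = ell_of q0 q q'"
    using corresponds_positive[OF sd c] by blast
  have ls: "l0 = q0" "l1 = min \<bar>q\<bar> \<bar>q'\<bar>" "l2 = max \<bar>q\<bar> \<bar>q'\<bar>" using l q0 by (simp_all add: ell_of_def)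
  obtain k1 k2 b1 b2 d1 d2 where
    cc: "clifford_cover lam1 lam2 k1 k2 b1 b2 d1 d2 \<Gamma> q0 q q'" "clifford_cover lam1 lam2 k2 k1 d1 d2 b1 b2 \<Gamma> q0 q' q"
    using clifford_cover_instance[OF spectral_dataD(2,3,6)[OF sd] h q0] unfolding \<Gamma> .
  interpret b: clifford_cover lam1 lam2 k1 k2 b1 b2 d1 d2 \<Gamma> q0 q q' by (rule cc(1))
  interpret d: clifford_cover lam1 lam2 k2 k1 d1 d2 b1 b2 \<Gamma> q0 q' q by (rule cc(2))
  let ?L = "Lam_dual lam1 lam2" and ?f = "flat_cmc lam1 lam2"
  have axes: "{A. is_axis lam1 lam2 A} = {b.axis, d.axis}"
    using b.is_axis_cases b.is_axis_axis d.is_axis_axis unfolding d.axis_def[symmetric] by blast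
  have ne: "b.axis \<noteq> d.axis" using b.axis_neq by (simp add: d.axis_def)
  note curves = b.profile_curves_axis d.profile_curves_axis ne axes ls(1)
  show "\<exists>A1 A2. A1 \<noteq> A2 \<and> {A. is_axis lam1 lam2 A} = {A1, A2} \<and>
           (\<forall>(A, l)\<in>{(A1, l1), (A2, l2)}. \<forall>H. hemisphere A H \<longrightarrow>
              has_total_turning_number lam1 lam2 \<Gamma> A H (of_int l0) \<and>
              is_union_of_wrapped_circles lam1 lam2 \<Gamma> H
                (nat (gcd l0 l)) (nat (l0 div gcd l0 l)))"
  \<comment> \<open>The curves about \<open>b.axis\<close> are counted by \<open>q'\<close> and
    those about \<open>d.axis\<close> by \<open>q\<close>. The axis to be labelled by
    \<open>l1\<close> is the one that goes with the coefficient of smaller absolute value.\<close>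
  proof (cases "\<bar>q\<bar> \<le> \<bar>q'\<bar>")
    case True
    then have "l1 = \<bar>q\<bar>" "l2 = \<bar>q'\<bar>" using ls by auto
    then show ?thesis using curves by (intro exI[of _ "d.axis"] exI[of _ "b.axis"]) auto
  next
    case False
    then have "l1 = \<bar>q'\<bar>" "l2 = \<bar>q\<bar>" using ls by auto
    then show ?thesis using curves by (intro exI[of _ "b.axis"] exI[of _ "d.axis"]) auto
  qed
  show "is_lattice \<Gamma>" by (rule b.is_lattice_\<Gamma>)
  show "is_rectangular_lattice ?L" by (rule b.is_rectangular_lattice_dual)
  show "embedding_map (torus ?L) (top_of_set SU2) (descend ?f)"
    by (rule b.embedding_flat_cmc)
  show "sheeted_covering (nat l0) (torus \<Gamma>) (torus ?L) (descend (torus_pt ?L))"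
    unfolding ls(1) by (rule b.sheeted_covering_\<Gamma>)
  fix x assume "x \<in> topspace (torus \<Gamma>)"
  then obtain z where x: "x = torus_pt \<Gamma> z" by auto
  show "descend ?f (descend (torus_pt ?L) x) = descend ?f x"
    unfolding x b.descend_torus_pt_\<Lambda> b.descend_\<Gamma> b.descend_\<Lambda> by (rule HOL.refl)
next
  fix lam l0 l1 l2 assume "lam \<in> spectral_data" "corresponds lam (l0, l1, l2)"
  then show "l1 = 0 \<longleftrightarrow> rotational lam" by (rule l1_zero_iff_rotational)
qed

end
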